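(* Let $T=[T_1,\ldots,T_n]\in[B(\mathcal H)^n]_1^-$ be a row contraction. Then $T$ is completely non-coisometric if and only if $\Gamma(T)\in\mathbb N_\infty\times\mathbb N_\infty\times\{0\}$. In this case, the characteristic function $\Theta_T$ is a noncommutative polynomial of degree $m\in\mathbb N$ if and only if there exist subspaces $\mathcal H_v$ and $\mathcal H_{nil}$ of $\mathcal H$ such that $\mathcal H=\mathcal H_v\oplus\mathcal H_{nil}$ and each $T_i$ admits a representation $$T_i=\begin{bmatrix}V_i&*\\0&N_i\end{bmatrix},\qquad i=1,\ldots,n,$$ where $V=[V_1,\ldots,V_n]\in[B(\mathcal H_v)^n]_1^-$ is a pure row isometry and $N=[N_1,\ldots,N_n]\in[B(\mathcal H_{nil})^n]_1^-$ is a nilpotent row contraction of order $m$. Moreover, the degree of $\Theta_T$ is the smallest possible order of $N$ in the representation of $T$.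
   Context: $n\ge1$ is an integer, $\mathbb N=\{0,1,2,\ldots\}$, $\mathbb N_\infty=\mathbb N\cup\{\infty\}$; dimensions are regarded as elements of $\mathbb N_\infty$. Hilbert spaces are complex, subspaces are closed, direct sums are orthogonal, and summands may be $\{0\}$; $*$ denotes an unspecified entry. $\mathbb F_n^+$ is the unital free semigroup on $g_1,\ldots,g_n$ with identity $g_0$; $|g_0|=0$, $|g_{i_1}\cdots g_{i_k}|=k$; for $X=(X_1,\ldots,X_n)\in B(\mathcal H)^n$ put $X_{g_0}=I$ and $X_\alpha=X_{i_1}\cdots X_{i_k}$ if $\alpha=g_{i_1}\cdots g_{i_k}$. $[B(\mathcal H)^n]_1^-$ is the set of row contractions, i.e. $(X_1,\ldots,X_n)\in B(\mathcal H)^n$ with $\sum_iX_iX_i^*\le I$; an $n$-tuple is identified with the row operator $[X_1,\ldots,X_n]:\mathcal H^{(n)}\to\mathcal H$, where $\mathcal H^{(n)}$ is the direct sum of $n$ copies of $\mathcal H$. A row contraction $T$ is completely non-coisometric (c.n.c.) if the only $h\in\mathcal H$ with $\sum_{|\alpha|=k}\|T_\alpha^*h\|^2=\|h\|^2$ for all $k=1,2,\ldots$ is $h=0$. $T$ is pure if $\lim_{k\to\infty}\sum_{|\alpha|=k}\|T_\alpha^*h\|^2=0$ for all $h\in\mathcal H$; it is a (row) isometry if $T_i^*T_j=\delta_{ij}I$ for all $i,j$, and a pure row isometry if it is both. An $n$-tuple $N$ is nilpotent if there is $m\in\mathbb N$ with $N_\alpha=0$ for all $|\alpha|=m$; the smallest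 such $m$ is its order (so order $0$ means the space is $\{0\}$). Defect operators: $\Delta_T=(I-\sum_iT_iT_i^* )^{1/2}\in B(\mathcal H)$, $\Delta_{T^*}=(I-T^*T)^{1/2}\in B(\mathcal H^{(n)})$; defect spaces $\mathcal D_T=\overline{\Delta_T\mathcal H}$, $\mathcal D_{T^*}=\overline{\Delta_{T^*}\mathcal H^{(n)}}$. The characteristic function of $T$ is the function defined, for any Hilbert space $\mathcal G$ and $X\in B(\mathcal G)^n$ with $\|\sum_iX_iX_i^*\|<1$, by $$\Theta_T(X)=-I_{\mathcal G}\otimes(T|_{\mathcal D_{T^*}})+(I_{\mathcal G}\otimes\Delta_T)\Big(I-\sum_{i=1}^nX_i\otimes T_i^*\Big)^{-1}[X_1\otimes I_{\mathcal H},\ldots,X_n\otimes I_{\mathcal H}](I_{\mathcal G}\otimes\Delta_{T^*}|_{\mathcal D_{T^*}}).$$ It has a unique expansion $\Theta_T(X)=\sum_{k\ge0}\sum_{|\alpha|=k}X_\alpha\otimes A_{(\alpha)}$ with $A_{(\alpha)}\in B(\mathcal D_{T^*},\mathcal D_T)$. It is a noncommutative polynomial if only finitely many $A_{(\alpha)}$ are nonzero; its degree $\deg(\Theta_T)$ is then the largest $|\alpha|$ with $A_{(\alpha)}\ne0$, with the convention that constants (including zero) have degree $0$; $\deg(\Theta_T)=\infty$ if $\Theta_T$ is not a polynomial. $F^2(H_n)=\mathbb C1\oplus\bigoplus_{k\ge1}(\mathbb C^n)^{\otimes k}$ is the full Fock space; with $e_1,\ldots,e_n$ the standard orthonormal basis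 of $\mathbb C^n$, it has orthonormal basis $\{e_\alpha\}_{\alpha\in\mathbb F_n^+}$, where $e_{g_0}=1$ and $e_\alpha=e_{i_1}\otimes\cdots\otimes e_{i_k}$ if $\alpha=g_{i_1}\cdots g_{i_k}$. The noncommutative Poisson kernel of $T$ is $K_T:\mathcal H\to F^2(H_n)\otimes\mathcal D_T$, $K_Th=\sum_{\alpha\in\mathbb F_n^+}e_\alpha\otimes\Delta_TT_\alpha^*h$. The map $\Gamma:[B(\mathcal H)^n]_1^-\to\mathbb N_\infty\times\mathbb N_\infty\times\mathbb N_\infty$ is $\Gamma(T)=(p,m,q)$ with $m=\deg(\Theta_T)$, $q=\dim\ker K_T$, and $p=\dim(\mathcal D_m\ominus\mathcal D_{m+1})$ if $m\in\mathbb N$, $p=\dim\overline{\Delta_T\mathcal H}$ if $m=\infty$, where $\mathcal D_k=\overline{\mathrm{span}}\{T_\beta\Delta_Th:h\in\mathcal H,|\beta|\ge k\}$.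
   Formalization: With the same m on both sides the second equivalence fails (unilateral shift: degree 0, yet N=0 of order 1 occurs); proved instead: Θ_T is a polynomial iff some representation exists, and it has degree m iff m is the smallest order of N that occurs. *)

theory Defs
  imports "HOL-Analysis.Analysis" "HOL-Library.Extended_Nat" "HOL-Library.Nonpos_Ints"
begin

section \<open>Complex Hilbert spaces\<close>

text \<open>The complex inner product is linear in its first argument; the real inner product of the
  superclass is its real part, so that norm, topology and completeness are those of the library.\<close>

class hilbert_space = real_inner + complete_space +
  fixes scaleC :: "complex \<Rightarrow> 'a \<Rightarrow> 'a"  (infixr \<open>*\<^sub>C\<close> 75)
    and cinner :: "'a \<Rightarrow> 'a \<Rightarrow> complex"
  assumes scaleC_add_right: "a *\<^sub>C (x + y) = a *\<^sub>C x + a *\<^sub>C y"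
    and scaleC_add_left: "(a + b) *\<^sub>C x = a *\<^sub>C x + b *\<^sub>C x"
    and scaleC_scaleC: "a *\<^sub>C (b *\<^sub>C x) = (a * b) *\<^sub>C x"
    and scaleC_of_real: "complex_of_real r *\<^sub>C x = r *\<^sub>R x"
    and cinner_commute: "cinner x y = cnj (cinner y x)"
    and cinner_add_left: "cinner (x + y) z = cinner x z + cinner y z"
    and cinner_scaleC_left: "cinner (a *\<^sub>C x) y = a * cinner x y"
    and Re_cinner: "Re (cinner x y) = inner x y"

global_interpretation complex_vector: vector_space "scaleC :: complex \<Rightarrow> 'a \<Rightarrow> 'a :: hilbert_space"
  defines csubspace = complex_vector.subspace
    and cspan = complex_vector.span
    and cdim = complex_vector.dim
  by unfold_locales
    (use scaleC_add_right scaleC_add_left scaleC_scaleC scaleC_of_real[of 1] in auto)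

subsection \<open>The scalar field and finite direct sums\<close>

instantiation complex :: hilbert_space
begin

definition scaleC_complex :: "complex \<Rightarrow> complex \<Rightarrow> complex"
  where "scaleC_complex a x = a * x"

definition cinner_complex :: "complex \<Rightarrow> complex \<Rightarrow> complex"
  where "cinner_complex x y = x * cnj y"

instance
  by standard
    (auto simp: scaleC_complex_def cinner_complex_def algebra_simps inner_complex_def scaleR_conv_of_real)

end

instantiation vec :: (hilbert_space, finite) hilbert_space
begin

definition scaleC_vec :: "complex \<Rightarrow> 'a ^ 'b \<Rightarrow> 'a ^ 'b"
  where "scaleC_vec a x = (\<chi> i. a *\<^sub>C (x $ i))"

definition cinner_vec :: "'a ^ 'b \<Rightarrow> 'a ^ 'b \<Rightarrow> complex"
  where "cinner_vec x y = (\<Sum>i\<in>UNIV. cinner (x $ i) (y $ i))"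

instance
proof
  fix a b :: complex and r :: real and x y z :: "'a ^ 'b"
  show "a *\<^sub>C (x + y) = a *\<^sub>C x + a *\<^sub>C y" "(a + b) *\<^sub>C x = a *\<^sub>C x + b *\<^sub>C x"
    "a *\<^sub>C (b *\<^sub>C x) = (a * b) *\<^sub>C x" "complex_of_real r *\<^sub>C x = r *\<^sub>R x"
    by (simp_all add: scaleC_vec_def vec_eq_iff scaleC_add_right scaleC_add_left scaleC_scaleC
        scaleC_of_real)
  show "cinner x y = cnj (cinner y x)"
    by (simp add: cinner_vec_def) (meson cinner_commute)
  show "cinner (x + y) z = cinner x z + cinner y z" "cinner (a *\<^sub>C x) y = a * cinner x y"
    "Re (cinner x y) = inner x y"
    by (simp_all add: cinner_vec_def scaleC_vec_def inner_vec_def cinner_add_left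
        cinner_scaleC_left Re_cinner sum.distrib sum_distrib_left)
qed

end

subsection \<open>Norm estimates\<close>

lemma norm_scaleC: "norm (a *\<^sub>C z) = norm a * norm (z :: 'a :: hilbert_space)"
proof -
  have r: "cinner z z = complex_of_real (norm z ^ 2)" for z :: 'a
    by (simp add: complex_eq_iff Re_cinner power2_norm_eq_inner)
      (metis cinner_commute cnj.simps(2) equal_neg_zero)
  have "complex_of_real (norm (a *\<^sub>C z) ^ 2) = a * cnj a * cinner z z"
    using r[of "a *\<^sub>C z"] cinner_scaleC_left[of a z "a *\<^sub>C z"] cinner_commute[of z "a *\<^sub>C z"]
      cinner_scaleC_left[of a z z] cinner_commute[of z z]
    by (metis complex_cnj_mult mult.assoc)
  also have "\<dots> = complex_of_real ((norm a * norm z) ^ 2)"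
    by (simp add: r complex_norm_square[symmetric] power_mult_distrib flip: of_real_power of_real_mult)
  finally show ?thesis
    by (metis norm_ge_zero mult_nonneg_nonneg of_real_eq_iff power2_eq_imp_eq)
qed

lemma norm_cinner_le: "norm (cinner x y) \<le> norm x * norm (y :: 'a :: hilbert_space)"
proof (cases "cinner x y = 0")
  case False
  define c where "c = cnj (sgn (cinner x y))"
  have c: "norm c = 1" using False by (simp add: c_def norm_sgn)
  have "complex_of_real (norm (cinner x y)) = cinner (c *\<^sub>C x) y"
    unfolding cinner_scaleC_left c_def using False
    by (simp add: sgn_eq complex_norm_square[symmetric] power2_eq_square
        mult.commute[of "cnj _"])
  then have "norm (cinner x y) = inner (c *\<^sub>C x) y"
    by (metis Re_cinner Re_complex_of_real)
  also have "\<dots> \<le> norm (c *\<^sub>C x) * norm y" by (rule norm_cauchy_schwarz)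
  finally show ?thesis by (simp add: norm_scaleC c)
qed simp

lemma bounded_linear_scaleC: "bounded_linear (\<lambda>x :: 'a :: hilbert_space. a *\<^sub>C x)"
proof (rule bounded_linear_intro[where K = "norm a"])
  fix x y :: 'a and r :: real
  show "a *\<^sub>C (x + y) = a *\<^sub>C x + a *\<^sub>C y" by (rule scaleC_add_right)
  show "a *\<^sub>C (r *\<^sub>R x) = r *\<^sub>R (a *\<^sub>C x)"
    by (simp only: scaleC_of_real[symmetric] scaleC_scaleC mult.commute)
  show "norm (a *\<^sub>C x) \<le> norm x * norm a" by (simp add: norm_scaleC mult.commute)
qed

subsection \<open>Square-summable families\<close>

definition square_summable :: "('i \<Rightarrow> 'h :: real_normed_vector) \<Rightarrow> bool"
  where "square_summable f \<longleftrightarrow> (\<lambda>i. (norm (f i))\<^sup>2) summable_on UNIV"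

lemma square_summable_zero: "square_summable (\<lambda>_. 0)"
  by (simp add: square_summable_def)

lemma square_summable_add:
  assumes "square_summable f" "square_summable g"
  shows "square_summable (\<lambda>i. f i + g i)"
  unfolding square_summable_def
proof (rule summable_on_comparison_test)
  show "(\<lambda>i. 2 * (norm (f i))\<^sup>2 + 2 * (norm (g i))\<^sup>2) summable_on UNIV"
    using assms unfolding square_summable_def
    by (intro summable_on_add summable_on_cmult_right)
  fix i
  have "(norm (f i + g i))\<^sup>2 \<le> (norm (f i) + norm (g i))\<^sup>2"
    by (intro power_mono norm_triangle_ineq norm_ge_zero)
  also have "\<dots> \<le> 2 * (norm (f i))\<^sup>2 + 2 * (norm (g i))\<^sup>2"
    using sum_squares_bound[of "norm (f i)" "norm (g i)"] by (simp add: power2_sum)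
  finally show "(norm (f i + g i))\<^sup>2 \<le> 2 * (norm (f i))\<^sup>2 + 2 * (norm (g i))\<^sup>2" .
qed simp

lemma square_summable_bound:
  assumes "square_summable f" "\<And>i. norm (g i) \<le> c * norm (f i)"
  shows "square_summable g"
  unfolding square_summable_def
proof (rule summable_on_comparison_test)
  show "(\<lambda>i. c\<^sup>2 * (norm (f i))\<^sup>2) summable_on UNIV"
    using assms(1) unfolding square_summable_def by (rule summable_on_cmult_right)
  show "(norm (g i))\<^sup>2 \<le> c\<^sup>2 * (norm (f i))\<^sup>2" for i
    using power_mono[OF assms(2)[of i] norm_ge_zero, of 2] by (simp add: power_mult_distrib)
qed simp

lemma square_summable_scaleC: "square_summable f \<Longrightarrow> square_summable (\<lambda>i. a *\<^sub>C f i)"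
  by (erule square_summable_bound[where c = "norm a"]) (simp add: norm_scaleC)

lemma square_summable_scaleR: "square_summable f \<Longrightarrow> square_summable (\<lambda>i. r *\<^sub>R f i)"
  by (erule square_summable_bound[where c = "\<bar>r\<bar>"]) simp

lemma square_summable_uminus: "square_summable f \<Longrightarrow> square_summable (\<lambda>i. - f i)"
  by (erule square_summable_bound[where c = 1]) simp

lemma square_summable_diff:
  "square_summable f \<Longrightarrow> square_summable g \<Longrightarrow> square_summable (\<lambda>i. f i - g i)"
  using square_summable_add[OF _ square_summable_uminus, of f g] by simp

lemma summable_cinner:
  fixes f g :: "'i \<Rightarrow> 'h :: hilbert_space"
  assumes "square_summable f" "square_summable g"
  shows "(\<lambda>i. cinner (f i) (g i)) summable_on UNIV"
proof (rule abs_summable_summable)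
  have "norm (cinner (f i) (g i)) \<le> (norm (f i))\<^sup>2 + (norm (g i))\<^sup>2" for i
  proof -
    have "norm (cinner (f i) (g i)) \<le> norm (f i) * norm (g i)" by (rule norm_cinner_le)
    also have "\<dots> \<le> (norm (f i))\<^sup>2 + (norm (g i))\<^sup>2"
      using sum_squares_bound[of "norm (f i)" "norm (g i)"]
        mult_nonneg_nonneg[of "norm (f i)" "norm (g i)"]
      unfolding mult.assoc using norm_ge_zero[of "f i"] norm_ge_zero[of "g i"] by linarith
    finally show ?thesis .
  qed
  with assms show "(\<lambda>i. norm (cinner (f i) (g i))) summable_on UNIV"
    unfolding square_summable_def
    by (intro Infinite_Sum.abs_summable_on_comparison_test'[OF summable_on_add])
qed

lemma summable_inner:
  fixes f g :: "'i \<Rightarrow> 'h :: hilbert_space"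
  assumes "square_summable f" "square_summable g"
  shows "(\<lambda>i. inner (f i) (g i)) summable_on UNIV"
  using summable_on_bounded_linear[OF bounded_linear_Re summable_cinner[OF assms]]
  by (simp add: Re_cinner)

typedef (overloaded) ('i, 'h :: hilbert_space) l2 = "{f :: 'i \<Rightarrow> 'h. square_summable f}"
  morphisms l2_coord Abs_l2
  using square_summable_zero by blast

lemma square_summable_coord: "square_summable (l2_coord u)"
  using l2_coord by auto

lemmas coord_Abs = Abs_l2_inverse[unfolded mem_Collect_eq]

lemma l2_eqI: "(\<And>i. l2_coord u i = l2_coord v i) \<Longrightarrow> u = v"
  by (metis ext l2_coord_inject)

instantiation l2 :: (type, hilbert_space) real_inner
begin

definition zero_l2 :: "('a, 'b) l2" where "0 = Abs_l2 (\<lambda>_. 0 :: 'b)"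
definition plus_l2 :: "('a, 'b) l2 \<Rightarrow> ('a, 'b) l2 \<Rightarrow> ('a, 'b) l2"
  where "u + v = Abs_l2 (\<lambda>i. l2_coord u i + l2_coord v i)" for u v :: "('a, 'b) l2"
definition minus_l2 :: "('a, 'b) l2 \<Rightarrow> ('a, 'b) l2 \<Rightarrow> ('a, 'b) l2"
  where "u - v = Abs_l2 (\<lambda>i. l2_coord u i - l2_coord v i)" for u v :: "('a, 'b) l2"
definition uminus_l2 :: "('a, 'b) l2 \<Rightarrow> ('a, 'b) l2"
  where "- u = Abs_l2 (\<lambda>i. - l2_coord u i)" for u :: "('a, 'b) l2"
definition scaleR_l2 :: "real \<Rightarrow> ('a, 'b) l2 \<Rightarrow> ('a, 'b) l2"
  where "scaleR r u = Abs_l2 (\<lambda>i. r *\<^sub>R l2_coord u i)" for u :: "('a, 'b) l2"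
definition inner_l2 :: "('a, 'b) l2 \<Rightarrow> ('a, 'b) l2 \<Rightarrow> real"
  where "inner u v = (\<Sum>\<^sub>\<infinity>i. inner (l2_coord u i) (l2_coord v i))" for u v :: "('a, 'b) l2"
definition norm_l2 :: "('a, 'b) l2 \<Rightarrow> real"
  where "norm u = sqrt (inner u u)" for u :: "('a, 'b) l2"
definition sgn_l2 :: "('a, 'b) l2 \<Rightarrow> ('a, 'b) l2"
  where "sgn u = scaleR (inverse (norm u)) u" for u :: "('a, 'b) l2"
definition dist_l2 :: "('a, 'b) l2 \<Rightarrow> ('a, 'b) l2 \<Rightarrow> real"
  where "dist u v = norm (u - v)" for u v :: "('a, 'b) l2"
definition uniformity_l2 :: "(('a, 'b) l2 \<times> ('a, 'b) l2) filter"
  where "uniformity = (INF e\<in>{0<..}. principal {(x :: ('a, 'b) l2, y). dist x y < e})"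
definition open_l2 :: "('a, 'b) l2 set \<Rightarrow> bool"
  where "open U \<longleftrightarrow> (\<forall>x\<in>U. eventually (\<lambda>(x', y). x' = x \<longrightarrow> y \<in> U) uniformity)"
  for U :: "('a, 'b) l2 set"

lemma l2_coord_simps:
  "l2_coord (0 :: ('a, 'b) l2) = (\<lambda>_. 0)"
  "l2_coord (u + v) = (\<lambda>i. l2_coord u i + l2_coord v i)"
  "l2_coord (u - v) = (\<lambda>i. l2_coord u i - l2_coord v i)"
  "l2_coord (- u) = (\<lambda>i. - l2_coord u i)"
  "l2_coord (r *\<^sub>R u) = (\<lambda>i. r *\<^sub>R l2_coord u i)"
  for u v :: "('a, 'b) l2"
  unfolding zero_l2_def plus_l2_def minus_l2_def uminus_l2_def scaleR_l2_def
  by (rule coord_Abs, intro square_summable_zero square_summable_add square_summable_diff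
      square_summable_uminus square_summable_scaleR square_summable_coord)+

instance
proof
  fix r s :: real and x y z :: "('a, 'b) l2" and U :: "('a, 'b) l2 set"
  show "x + y + z = x + (y + z)" "x + y = y + x" "0 + x = x" "- x + x = 0" "x - y = x + - y"
    "r *\<^sub>R (x + y) = r *\<^sub>R x + r *\<^sub>R y" "(r + s) *\<^sub>R x = r *\<^sub>R x + s *\<^sub>R x"
    "r *\<^sub>R s *\<^sub>R x = (r * s) *\<^sub>R x" "1 *\<^sub>R x = x"
    by (rule l2_eqI; simp add: l2_coord_simps algebra_simps)+
  show "inner x y = inner y x" by (simp add: inner_l2_def inner_commute)
  show "inner (x + y) z = inner x z + inner y z"
    by (simp add: inner_l2_def l2_coord_simps inner_add_left infsum_add summable_inner
        square_summable_coord)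
  show "inner (r *\<^sub>R x) y = r * inner x y"
    by (simp add: inner_l2_def l2_coord_simps infsum_cmult_right summable_inner
        square_summable_coord)
  show "0 \<le> inner x x" by (simp add: inner_l2_def infsum_nonneg)
  show "inner x x = 0 \<longleftrightarrow> x = 0"
  proof
    assume "inner x x = 0"
    then have "inner (l2_coord x i) (l2_coord x i) = 0" for i
      unfolding inner_l2_def
      by (rule nonneg_infsum_le_0D[OF eq_refl])
        (auto intro: summable_inner square_summable_coord)
    then show "x = 0" by (intro l2_eqI) (simp add: l2_coord_simps)
  qed (simp add: inner_l2_def l2_coord_simps)
qed (simp_all add: norm_l2_def sgn_l2_def dist_l2_def uniformity_l2_def open_l2_def)

end

lemma norm_l2_square: "(norm u)\<^sup>2 = (\<Sum>\<^sub>\<infinity>i. (norm (l2_coord u i))\<^sup>2)"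
  by (simp add: power2_norm_eq_inner inner_l2_def)

lemma sum_coord_le_norm_l2:
  assumes "finite F"
  shows "(\<Sum>i\<in>F. (norm (l2_coord u i))\<^sup>2) \<le> (norm u)\<^sup>2"
  unfolding norm_l2_square
  using square_summable_coord[of u] assms
  by (intro finite_sum_le_infsum) (auto simp: square_summable_def)

lemma norm_coord_le: "norm (l2_coord u i) \<le> norm u"
  using sum_coord_le_norm_l2[of "{i}" u] by (simp add: power2_le_iff_abs_le)

instance l2 :: (type, hilbert_space) complete_space
proof
  fix X :: "nat \<Rightarrow> ('a, 'b) l2"
  assume X: "Cauchy X"
  have "Cauchy (\<lambda>n. l2_coord (X n) i)" for i
    using X unfolding Cauchy_def dist_norm
    by (metis (no_types) l2_coord_simps(3) norm_coord_le order_le_less_trans)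
  then have "\<forall>i. \<exists>l. (\<lambda>n. l2_coord (X n) i) \<longlonglongrightarrow> l"
    using Cauchy_convergent convergent_def by blast
  then obtain f where f: "\<And>i. (\<lambda>n. l2_coord (X n) i) \<longlonglongrightarrow> f i" by metis
  have fin: "(\<Sum>i\<in>F. (norm (l2_coord (X m) i - f i))\<^sup>2) \<le> e\<^sup>2"
    if "finite F" "\<And>n. n \<ge> N \<Longrightarrow> norm (X m - X n) \<le> e" for F m N e
  proof (rule LIMSEQ_le_const2)
    show "(\<lambda>n. \<Sum>i\<in>F. (norm (l2_coord (X m) i - l2_coord (X n) i))\<^sup>2)
        \<longlonglongrightarrow> (\<Sum>i\<in>F. (norm (l2_coord (X m) i - f i))\<^sup>2)"
      by (intro tendsto_intros f)
    have "(\<Sum>i\<in>F. (norm (l2_coord (X m) i - l2_coord (X n) i))\<^sup>2) \<le> e\<^sup>2" if "n \<ge> N" for n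
      using sum_coord_le_norm_l2[OF \<open>finite F\<close>, of "X m - X n"]
        power_mono[OF \<open>\<And>n. n \<ge> N \<Longrightarrow> norm (X m - X n) \<le> e\<close>[OF that] norm_ge_zero, of 2]
      by (simp add: l2_coord_simps)
    then show "\<exists>N. \<forall>n\<ge>N. (\<Sum>i\<in>F. (norm (l2_coord (X m) i - l2_coord (X n) i))\<^sup>2) \<le> e\<^sup>2" by blast
  qed
  have ss: "square_summable (\<lambda>i. l2_coord (X m) i - f i)"
    if "\<And>n. n \<ge> N \<Longrightarrow> norm (X m - X n) \<le> e" for m N e
    unfolding square_summable_def
    using fin[OF _ that] by (intro nonneg_bdd_above_summable_on) (auto intro!: bdd_aboveI)
  have tail: "\<exists>N. \<forall>m\<ge>N. \<forall>n\<ge>N. norm (X m - X n) \<le> e" if "e > 0" for e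
    using X that unfolding Cauchy_def dist_norm by (meson less_imp_le)
  obtain N0 where "\<forall>m\<ge>N0. \<forall>n\<ge>N0. norm (X m - X n) \<le> 1" using tail[of 1] by auto
  then have "square_summable (\<lambda>i. l2_coord (X N0) i - f i)" by (intro ss[of N0 N0 1]) auto
  from square_summable_diff[OF square_summable_coord[of "X N0"] this] have f': "square_summable f" by simp
  have "X \<longlonglongrightarrow> Abs_l2 f"
  proof (rule LIMSEQ_I)
    fix e :: real assume "e > 0"
    then obtain N where N: "\<forall>m\<ge>N. \<forall>n\<ge>N. norm (X m - X n) \<le> e / 2" using tail[of "e / 2"] by auto
    have "norm (X m - Abs_l2 f) < e" if "m \<ge> N" for m
    proof -
      have "(norm (X m - Abs_l2 f))\<^sup>2 \<le> (e / 2)\<^sup>2"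
        unfolding norm_l2_square
      proof (rule infsum_le_finite_sums)
        show "(\<lambda>i. (norm (l2_coord (X m - Abs_l2 f) i))\<^sup>2) summable_on UNIV"
          using square_summable_coord unfolding square_summable_def by blast
        show "(\<Sum>i\<in>F. (norm (l2_coord (X m - Abs_l2 f) i))\<^sup>2) \<le> (e / 2)\<^sup>2" if "finite F" for F
          using fin[OF that, of N m "e / 2"] N \<open>m \<ge> N\<close> by (simp add: l2_coord_simps coord_Abs[OF f'])
      qed
      then have "norm (X m - Abs_l2 f) \<le> e / 2"
        using \<open>e > 0\<close> by (simp add: power2_le_iff_abs_le)
      then show ?thesis using \<open>e > 0\<close> by simp
    qed
    then show "\<exists>N. \<forall>n\<ge>N. norm (X n - Abs_l2 f) < e" by blast
  qed
  then show "convergent X" by (rule convergentI)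
qed

instantiation l2 :: (type, hilbert_space) hilbert_space
begin

definition scaleC_l2 :: "complex \<Rightarrow> ('a, 'b) l2 \<Rightarrow> ('a, 'b) l2"
  where "a *\<^sub>C u = Abs_l2 (\<lambda>i. a *\<^sub>C l2_coord u i)" for u :: "('a, 'b) l2"
definition cinner_l2 :: "('a, 'b) l2 \<Rightarrow> ('a, 'b) l2 \<Rightarrow> complex"
  where "cinner u v = (\<Sum>\<^sub>\<infinity>i. cinner (l2_coord u i) (l2_coord v i))"
  for u v :: "('a, 'b) l2"

lemma l2_coord_scaleC: "l2_coord (a *\<^sub>C u) = (\<lambda>i. a *\<^sub>C l2_coord u i)" for u :: "('a, 'b) l2"
  unfolding scaleC_l2_def by (intro coord_Abs square_summable_scaleC square_summable_coord)

instance
proof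
  fix a b :: complex and r :: real and x y z :: "('a, 'b) l2"
  show "a *\<^sub>C (x + y) = a *\<^sub>C x + a *\<^sub>C y" "(a + b) *\<^sub>C x = a *\<^sub>C x + b *\<^sub>C x"
    "a *\<^sub>C (b *\<^sub>C x) = (a * b) *\<^sub>C x" "complex_of_real r *\<^sub>C x = r *\<^sub>R x"
    by (rule l2_eqI; simp add: l2_coord_simps l2_coord_scaleC scaleC_add_right scaleC_add_left
        scaleC_scaleC scaleC_of_real)+
  show "cinner x y = cnj (cinner y x)"
    unfolding cinner_l2_def
    by (subst cinner_commute) (simp add: infsum_cnj)
  show "cinner (x + y) z = cinner x z + cinner y z"
    by (simp add: cinner_l2_def l2_coord_simps cinner_add_left infsum_add summable_cinner
        square_summable_coord)
  show "cinner (a *\<^sub>C x) y = a * cinner x y"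
    by (simp add: cinner_l2_def l2_coord_scaleC cinner_scaleC_left infsum_cmult_right
        summable_cinner square_summable_coord)
  show "Re (cinner x y) = inner x y"
    unfolding cinner_l2_def inner_l2_def
    by (subst infsum_Re[symmetric])
      (simp_all add: Re_cinner summable_cinner square_summable_coord)
qed

end

section \<open>Hilbert space tensor products\<close>

definition orthonormal :: "'a :: hilbert_space set \<Rightarrow> bool"
  where "orthonormal B \<longleftrightarrow> (\<forall>b\<in>B. \<forall>c\<in>B. cinner b c = (if b = c then 1 else 0))"

definition orthonormal_basis :: "'a :: hilbert_space set \<Rightarrow> bool"
  where "orthonormal_basis B \<longleftrightarrow> orthonormal B \<and> closure (cspan B) = UNIV"

definition chosen_basis :: "'a :: hilbert_space set"
  where "chosen_basis = (SOME B. orthonormal_basis B)"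

text \<open>The Hilbert space tensor product of \<open>'g\<close> and \<open>'h\<close> is modelled as the \<open>'h\<close>-valued
  square-summable families indexed by an orthonormal basis \<open>B\<close> of \<open>'g\<close>, the elementary tensor of
  \<open>g\<close> and \<open>h\<close> having the entry \<open>\<langle>g, b\<rangle> h\<close> at \<open>b \<in> B\<close>.  Families on \<open>B\<close> are encoded as families on
  all of \<open>'g\<close> vanishing outside \<open>B\<close>, as a type cannot be indexed by the (possibly empty) set \<open>B\<close>.
  Up to the canonical unitary equivalence the result does not depend on \<open>B\<close>.\<close>

typedef (overloaded) ('g :: hilbert_space, 'h :: hilbert_space) tensor =
  "{u :: ('g, 'h) l2. \<forall>x. x \<notin> chosen_basis \<longrightarrow> l2_coord u x = 0}"
  morphisms tensor_family Abs_tensor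
  by (rule exI[of _ 0]) (simp add: l2_coord_simps)

lemma tensor_family_outside: "x \<notin> chosen_basis \<Longrightarrow> l2_coord (tensor_family u) x = 0"
  using tensor_family[of u] by auto

lemmas family_Abs = Abs_tensor_inverse[unfolded mem_Collect_eq]

lemma tensor_eqI: "tensor_family u = tensor_family v \<Longrightarrow> u = v"
  by (simp add: tensor_family_inject)

instantiation tensor :: (hilbert_space, hilbert_space) real_inner
begin

definition zero_tensor :: "('a, 'b) tensor" where "0 = Abs_tensor (0 :: ('a, 'b) l2)"
definition plus_tensor :: "('a, 'b) tensor \<Rightarrow> ('a, 'b) tensor \<Rightarrow> ('a, 'b) tensor"
  where "u + v = Abs_tensor (tensor_family u + tensor_family v)" for u v :: "('a, 'b) tensor"
definition minus_tensor :: "('a, 'b) tensor \<Rightarrow> ('a, 'b) tensor \<Rightarrow> ('a, 'b) tensor"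
  where "u - v = Abs_tensor (tensor_family u - tensor_family v)" for u v :: "('a, 'b) tensor"
definition uminus_tensor :: "('a, 'b) tensor \<Rightarrow> ('a, 'b) tensor"
  where "- u = Abs_tensor (- tensor_family u)" for u :: "('a, 'b) tensor"
definition scaleR_tensor :: "real \<Rightarrow> ('a, 'b) tensor \<Rightarrow> ('a, 'b) tensor"
  where "scaleR r u = Abs_tensor (r *\<^sub>R tensor_family u)" for u :: "('a, 'b) tensor"
definition inner_tensor :: "('a, 'b) tensor \<Rightarrow> ('a, 'b) tensor \<Rightarrow> real"
  where "inner u v = inner (tensor_family u) (tensor_family v)" for u v :: "('a, 'b) tensor"
definition norm_tensor :: "('a, 'b) tensor \<Rightarrow> real"
  where "norm u = sqrt (inner u u)" for u :: "('a, 'b) tensor"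
definition sgn_tensor :: "('a, 'b) tensor \<Rightarrow> ('a, 'b) tensor"
  where "sgn u = scaleR (inverse (norm u)) u" for u :: "('a, 'b) tensor"
definition dist_tensor :: "('a, 'b) tensor \<Rightarrow> ('a, 'b) tensor \<Rightarrow> real"
  where "dist u v = norm (u - v)" for u v :: "('a, 'b) tensor"
definition uniformity_tensor :: "(('a, 'b) tensor \<times> ('a, 'b) tensor) filter"
  where "uniformity = (INF e\<in>{0<..}. principal {(x :: ('a, 'b) tensor, y). dist x y < e})"
definition open_tensor :: "('a, 'b) tensor set \<Rightarrow> bool"
  where "open U \<longleftrightarrow> (\<forall>x\<in>U. eventually (\<lambda>(x', y). x' = x \<longrightarrow> y \<in> U) uniformity)"
  for U :: "('a, 'b) tensor set"

lemma tensor_family_simps: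
  "tensor_family (0 :: ('a, 'b) tensor) = 0"
  "tensor_family (u + v) = tensor_family u + tensor_family v"
  "tensor_family (u - v) = tensor_family u - tensor_family v"
  "tensor_family (- u) = - tensor_family u"
  "tensor_family (r *\<^sub>R u) = r *\<^sub>R tensor_family u"
  for u v :: "('a, 'b) tensor"
  unfolding zero_tensor_def plus_tensor_def minus_tensor_def uminus_tensor_def scaleR_tensor_def
  by (rule family_Abs, simp add: l2_coord_simps tensor_family_outside)+

instance
proof
  fix r s :: real and x y z :: "('a, 'b) tensor" and U :: "('a, 'b) tensor set"
  show "x + y + z = x + (y + z)" "x + y = y + x" "0 + x = x" "- x + x = 0" "x - y = x + - y"
    "r *\<^sub>R (x + y) = r *\<^sub>R x + r *\<^sub>R y" "(r + s) *\<^sub>R x = r *\<^sub>R x + s *\<^sub>R x"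
    "r *\<^sub>R s *\<^sub>R x = (r * s) *\<^sub>R x" "1 *\<^sub>R x = x"
    by (rule tensor_eqI; simp add: tensor_family_simps algebra_simps)+
  show "inner x y = inner y x" by (simp add: inner_tensor_def inner_commute)
  show "inner (x + y) z = inner x z + inner y z" "inner (r *\<^sub>R x) y = r * inner x y" "0 \<le> inner x x"
    by (simp_all add: inner_tensor_def tensor_family_simps inner_add_left)
  show "inner x x = 0 \<longleftrightarrow> x = 0"
    by (auto simp: inner_tensor_def tensor_family_simps intro: tensor_eqI)
qed (simp_all add: norm_tensor_def sgn_tensor_def dist_tensor_def uniformity_tensor_def open_tensor_def)

end

lemma norm_tensor_family: "norm (tensor_family u) = norm u"
  by (simp add: norm_eq_sqrt_inner inner_tensor_def)

instance tensor :: (hilbert_space, hilbert_space) complete_space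
proof
  fix X :: "nat \<Rightarrow> ('a, 'b) tensor"
  have dist: "dist (tensor_family u) (tensor_family v) = dist u v" for u v :: "('a, 'b) tensor"
    by (simp add: dist_norm norm_tensor_family flip: tensor_family_simps)
  assume "Cauchy X"
  then have "Cauchy (\<lambda>n. tensor_family (X n))" by (simp add: Cauchy_def dist)
  then obtain l where l: "(\<lambda>n. tensor_family (X n)) \<longlonglongrightarrow> l"
    using Cauchy_convergent convergent_def by blast
  have "l2_coord l x = 0" if "x \<notin> chosen_basis" for x
  proof -
    have "norm (l2_coord l x) \<le> norm (tensor_family (X n) - l)" for n
      using norm_coord_le[of "tensor_family (X n) - l" x]
      by (simp add: l2_coord_simps tensor_family_outside[OF that])
    moreover have "(\<lambda>n. norm (tensor_family (X n) - l)) \<longlonglongrightarrow> 0"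
      using l by (simp add: LIM_zero_iff tendsto_norm_zero_iff)
    ultimately have "norm (l2_coord l x) \<le> 0" by (meson LIMSEQ_le_const)
    then show ?thesis by simp
  qed
  then have "tensor_family (Abs_tensor l) = l" by (simp add: family_Abs)
  then have "X \<longlonglongrightarrow> Abs_tensor l"
    using l by (simp add: lim_sequentially) (metis dist)
  then show "convergent X" by (rule convergentI)
qed

instantiation tensor :: (hilbert_space, hilbert_space) hilbert_space
begin

definition scaleC_tensor :: "complex \<Rightarrow> ('a, 'b) tensor \<Rightarrow> ('a, 'b) tensor"
  where "a *\<^sub>C u = Abs_tensor (a *\<^sub>C tensor_family u)" for u :: "('a, 'b) tensor"
definition cinner_tensor :: "('a, 'b) tensor \<Rightarrow> ('a, 'b) tensor \<Rightarrow> complex"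
  where "cinner u v = cinner (tensor_family u) (tensor_family v)" for u v :: "('a, 'b) tensor"

lemma tensor_family_scaleC: "tensor_family (a *\<^sub>C u) = a *\<^sub>C tensor_family u"
  for u :: "('a, 'b) tensor"
  unfolding scaleC_tensor_def
  by (rule family_Abs) (simp add: l2_coord_scaleC tensor_family_outside)

instance
proof
  fix a b :: complex and r :: real and x y z :: "('a, 'b) tensor"
  show "a *\<^sub>C (x + y) = a *\<^sub>C x + a *\<^sub>C y" "(a + b) *\<^sub>C x = a *\<^sub>C x + b *\<^sub>C x"
    "a *\<^sub>C (b *\<^sub>C x) = (a * b) *\<^sub>C x" "complex_of_real r *\<^sub>C x = r *\<^sub>R x"
    by (rule tensor_eqI; simp add: tensor_family_simps tensor_family_scaleC scaleC_add_right
        scaleC_add_left scaleC_scaleC scaleC_of_real)+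
  show "cinner x y = cnj (cinner y x)"
    unfolding cinner_tensor_def by (rule cinner_commute)
  show "cinner (x + y) z = cinner x z + cinner y z" "cinner (a *\<^sub>C x) y = a * cinner x y"
    "Re (cinner x y) = inner x y"
    by (simp_all add: cinner_tensor_def inner_tensor_def tensor_family_simps tensor_family_scaleC
        cinner_add_left cinner_scaleC_left Re_cinner)
qed

end

definition tensor_vec :: "'g \<Rightarrow> 'h \<Rightarrow> ('g :: hilbert_space, 'h :: hilbert_space) tensor"
    (infixl \<open>\<otimes>\<^sub>v\<close> 70)
  where "g \<otimes>\<^sub>v h = Abs_tensor (Abs_l2 (\<lambda>b. if b \<in> chosen_basis then cinner g b *\<^sub>C h else 0))"


section \<open>Operators and subspaces\<close>

definition bounded_clinear :: "('a :: hilbert_space \<Rightarrow> 'b :: hilbert_space) \<Rightarrow> bool"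
  where "bounded_clinear f \<longleftrightarrow> bounded_linear f \<and> (\<forall>a x. f (a *\<^sub>C x) = a *\<^sub>C f x)"

definition closed_csubspace :: "'a :: hilbert_space set \<Rightarrow> bool"
  where "closed_csubspace M \<longleftrightarrow> csubspace M \<and> closed M"

definition orthogonal_to :: "'a :: hilbert_space set \<Rightarrow> 'a set"
  where "orthogonal_to M = {x. \<forall>y\<in>M. cinner x y = 0}"

definition proj :: "'a :: hilbert_space set \<Rightarrow> 'a \<Rightarrow> 'a"
  where "proj M x = (THE y. y \<in> M \<and> x - y \<in> orthogonal_to M)"

text \<open>The operators between closed subspaces \<open>M\<close> and \<open>N\<close>, each identified with its extension by \<open>0\<close>
  on the orthogonal complement of \<open>M\<close>.  Under this identification the identity of \<open>M\<close> is
  \<open>proj M\<close>, the restriction of \<open>f\<close> to \<open>M\<close> is \<open>f \<circ> proj M\<close>, and adjoints are adjoints between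
  the ambient spaces.\<close>

definition operators :: "'a :: hilbert_space set \<Rightarrow> 'b :: hilbert_space set \<Rightarrow> ('a \<Rightarrow> 'b) set"
  where "operators M N = {f. bounded_clinear f \<and> (\<forall>x\<in>orthogonal_to M. f x = 0) \<and> range f \<subseteq> N}"

definition adj :: "('a :: hilbert_space \<Rightarrow> 'b :: hilbert_space) \<Rightarrow> 'b \<Rightarrow> 'a"
  where "adj f = (THE g. \<forall>x y. cinner (f x) y = cinner x (g y))"

definition positive_operator :: "('a :: hilbert_space \<Rightarrow> 'a) \<Rightarrow> bool"
  where "positive_operator f \<longleftrightarrow> bounded_clinear f \<and> (\<forall>x. cinner (f x) x \<in> \<real>\<^sub>\<ge>\<^sub>0)"

definition sqrt_operator :: "('a :: hilbert_space \<Rightarrow> 'a) \<Rightarrow> 'a \<Rightarrow> 'a"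
  where "sqrt_operator f = (THE s. positive_operator s \<and> s \<circ> s = f)"

definition tensor_op ::
    "('g :: hilbert_space \<Rightarrow> 'k :: hilbert_space) \<Rightarrow> ('h :: hilbert_space \<Rightarrow> 'l :: hilbert_space) \<Rightarrow>
      ('g, 'h) tensor \<Rightarrow> ('k, 'l) tensor"  (infixl \<open>\<otimes>\<^sub>o\<close> 70)
  where "f \<otimes>\<^sub>o g = (THE F. bounded_clinear F \<and> (\<forall>x y. F (x \<otimes>\<^sub>v y) = f x \<otimes>\<^sub>v g y))"

text \<open>All infinite dimensions are identified with \<open>\<infinity>\<close>, and a finite Hilbert space dimension is the
  algebraic one.\<close>

definition hilbert_dim :: "'a :: hilbert_space set \<Rightarrow> enat"
  where "hilbert_dim M = (if \<exists>B. finite B \<and> M \<subseteq> cspan B then enat (cdim M) else \<infinity>)"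


section \<open>Row contractions\<close>

text \<open>The index type \<open>'n\<close> of an \<open>n\<close>-tuple has \<open>n \<ge> 1\<close> elements; \<open>'n list\<close> is the free semigroup
  \<open>\<bbbF>\<^sub>n\<^sup>+\<close> with identity \<open>[]\<close>, and \<open>'a ^ 'n\<close> is the direct sum of \<open>n\<close> copies of \<open>'a\<close>.
  The first argument \<open>M\<close> of the following notions is the closed subspace on which the tuple acts.\<close>

fun word_op :: "'a :: hilbert_space set \<Rightarrow> ('n \<Rightarrow> 'a \<Rightarrow> 'a) \<Rightarrow> 'n list \<Rightarrow> 'a \<Rightarrow> 'a"
  where
    "word_op M X [] = proj M"
  | "word_op M X (i # \<alpha>) = X i \<circ> word_op M X \<alpha>"

definition row_contraction_on :: "'a :: hilbert_space set \<Rightarrow> ('n :: finite \<Rightarrow> 'a \<Rightarrow> 'a) \<Rightarrow> bool"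
  where "row_contraction_on M X \<longleftrightarrow>
    (\<forall>i. X i \<in> operators M M) \<and>
    positive_operator (\<lambda>x. proj M x - (\<Sum>i\<in>UNIV. X i (adj (X i) x)))"

definition row_isometry_on :: "'a :: hilbert_space set \<Rightarrow> ('n :: finite \<Rightarrow> 'a \<Rightarrow> 'a) \<Rightarrow> bool"
  where "row_isometry_on M X \<longleftrightarrow>
    (\<forall>i j. \<forall>x\<in>M. adj (X i) (X j x) = (if i = j then x else 0))"

definition pure_on :: "'a :: hilbert_space set \<Rightarrow> ('n :: finite \<Rightarrow> 'a \<Rightarrow> 'a) \<Rightarrow> bool"
  where "pure_on M X \<longleftrightarrow>
    (\<forall>h\<in>M. (\<lambda>k. \<Sum>\<alpha> | length \<alpha> = k. (norm (adj (word_op M X \<alpha>) h))\<^sup>2) \<longlonglongrightarrow> 0)"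

definition nilpotent_of_order_on ::
    "'a :: hilbert_space set \<Rightarrow> ('n :: finite \<Rightarrow> 'a \<Rightarrow> 'a) \<Rightarrow> nat \<Rightarrow> bool"
  where "nilpotent_of_order_on M X m \<longleftrightarrow>
    (\<forall>\<alpha>. length \<alpha> = m \<longrightarrow> word_op M X \<alpha> = (\<lambda>_. 0)) \<and>
    (\<forall>k<m. \<exists>\<alpha>. length \<alpha> = k \<and> word_op M X \<alpha> \<noteq> (\<lambda>_. 0))"

abbreviation row_contraction :: "('n :: finite \<Rightarrow> 'a :: hilbert_space \<Rightarrow> 'a) \<Rightarrow> bool"
  where "row_contraction \<equiv> row_contraction_on UNIV"

abbreviation word :: "('n \<Rightarrow> 'a :: hilbert_space \<Rightarrow> 'a) \<Rightarrow> 'n list \<Rightarrow> 'a \<Rightarrow> 'a"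
  where "word \<equiv> word_op UNIV"

definition completely_non_coisometric :: "('n :: finite \<Rightarrow> 'a :: hilbert_space \<Rightarrow> 'a) \<Rightarrow> bool"
  where "completely_non_coisometric T \<longleftrightarrow>
    (\<forall>h. (\<forall>k\<ge>1. (\<Sum>\<alpha> | length \<alpha> = k. (norm (adj (word T \<alpha>) h))\<^sup>2) = (norm h)\<^sup>2) \<longrightarrow> h = 0)"

definition row :: "('n :: finite \<Rightarrow> 'k \<Rightarrow> 'l) \<Rightarrow> 'k ^ 'n \<Rightarrow> 'l :: hilbert_space"
  where "row X v = (\<Sum>i\<in>UNIV. X i (v $ i))"

definition defect :: "('n :: finite \<Rightarrow> 'a :: hilbert_space \<Rightarrow> 'a) \<Rightarrow> 'a \<Rightarrow> 'a"
  where "defect T = sqrt_operator (\<lambda>x. x - (\<Sum>i\<in>UNIV. T i (adj (T i) x)))"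

definition defect_adj :: "('n :: finite \<Rightarrow> 'a :: hilbert_space \<Rightarrow> 'a) \<Rightarrow> 'a ^ 'n \<Rightarrow> 'a ^ 'n"
  where "defect_adj T = sqrt_operator (\<lambda>v. v - adj (row T) (row T v))"

definition defect_space :: "('n :: finite \<Rightarrow> 'a :: hilbert_space \<Rightarrow> 'a) \<Rightarrow> 'a set"
  where "defect_space T = closure (range (defect T))"

definition defect_adj_space :: "('n :: finite \<Rightarrow> 'a :: hilbert_space \<Rightarrow> 'a) \<Rightarrow> ('a ^ 'n) set"
  where "defect_adj_space T = closure (range (defect_adj T))"


section \<open>Characteristic function\<close>

text \<open>The canonical identification of \<open>G \<otimes> H\<^sup>(\<^sup>n\<^sup>)\<close> with \<open>(G \<otimes> H)\<^sup>(\<^sup>n\<^sup>)\<close>.\<close>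

definition tensor_split ::
    "('g :: hilbert_space, 'a :: hilbert_space ^ 'n :: finite) tensor \<Rightarrow> ('g, 'a) tensor ^ 'n"
  where "tensor_split u = (\<chi> i. (id \<otimes>\<^sub>o (\<lambda>v. v $ i)) u)"

definition strict_row_contraction :: "('n :: finite \<Rightarrow> 'g :: hilbert_space \<Rightarrow> 'g) \<Rightarrow> bool"
  where "strict_row_contraction X \<longleftrightarrow>
    (\<forall>i. bounded_clinear (X i)) \<and> onorm (\<lambda>x. \<Sum>i\<in>UNIV. X i (adj (X i) x)) < 1"

definition char_fun ::
    "('n :: finite \<Rightarrow> 'a :: hilbert_space \<Rightarrow> 'a) \<Rightarrow> ('n \<Rightarrow> 'g :: hilbert_space \<Rightarrow> 'g) \<Rightarrow>
      ('g, 'a ^ 'n) tensor \<Rightarrow> ('g, 'a) tensor"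
  where "char_fun T X u =
    - (id \<otimes>\<^sub>o (row T \<circ> proj (defect_adj_space T))) u +
    (id \<otimes>\<^sub>o defect T)
      (inv (\<lambda>w. w - (\<Sum>i\<in>UNIV. (X i \<otimes>\<^sub>o adj (T i)) w))
        (row (\<lambda>i. X i \<otimes>\<^sub>o id)
          (tensor_split ((id \<otimes>\<^sub>o (defect_adj T \<circ> proj (defect_adj_space T))) u))))"

text \<open>The full Fock space, by coordinates with respect to the basis \<open>e\<^sub>\<alpha>\<close>.\<close>

type_synonym 'n fock = "('n list, complex) l2"

definition fock_basis :: "'n list \<Rightarrow> 'n fock"
  where "fock_basis \<alpha> = Abs_l2 (\<lambda>\<beta>. if \<beta> = \<alpha> then 1 else 0)"

text \<open>The expansion \<open>\<Theta>\<^sub>T(X) = \<Sum>\<^sub>k \<Sum>\<^sub>|\<^sub>\<alpha>\<^sub>|\<^sub>=\<^sub>k X\<^sub>\<alpha> \<otimes> A\<^sub>(\<^sub>\<alpha>\<^sub>)\<close> with convergence in norm, for all strict row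
  contractions \<open>X\<close> on the space \<open>'g\<close>.\<close>

definition char_expansion ::
    "'g :: hilbert_space itself \<Rightarrow> ('n :: finite \<Rightarrow> 'a :: hilbert_space \<Rightarrow> 'a) \<Rightarrow>
      ('n list \<Rightarrow> 'a ^ 'n \<Rightarrow> 'a) \<Rightarrow> bool"
  where "char_expansion _ T A \<longleftrightarrow>
    (\<forall>\<alpha>. A \<alpha> \<in> operators (defect_adj_space T) (defect_space T)) \<and>
    (\<forall>X :: 'n \<Rightarrow> 'g \<Rightarrow> 'g. strict_row_contraction X \<longrightarrow>
      (\<lambda>N. onorm (\<lambda>u. char_fun T X u - (\<Sum>k<N. \<Sum>\<alpha> | length \<alpha> = k. (word X \<alpha> \<otimes>\<^sub>o A \<alpha>) u)))
        \<longlonglongrightarrow> 0)"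

text \<open>A definition cannot quantify over all types \<open>'g\<close>.  The expansion over the single separable
  infinite-dimensional space \<^typ>\<open>'n fock\<close> determines the coefficients: evaluate it at multiples of
  the left creation operators.\<close>

definition char_coeff ::
    "('n :: finite \<Rightarrow> 'a :: hilbert_space \<Rightarrow> 'a) \<Rightarrow> 'n list \<Rightarrow> 'a ^ 'n \<Rightarrow> 'a"
  where "char_coeff T = (THE A. char_expansion TYPE('n fock) T A)"

definition char_support :: "('n :: finite \<Rightarrow> 'a :: hilbert_space \<Rightarrow> 'a) \<Rightarrow> 'n list set"
  where "char_support T = {\<alpha>. char_coeff T \<alpha> \<noteq> (\<lambda>_. 0)}"

definition char_polynomial :: "('n :: finite \<Rightarrow> 'a :: hilbert_space \<Rightarrow> 'a) \<Rightarrow> bool"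
  where "char_polynomial T \<longleftrightarrow> finite (char_support T)"

definition char_degree :: "('n :: finite \<Rightarrow> 'a :: hilbert_space \<Rightarrow> 'a) \<Rightarrow> enat"
  where "char_degree T =
    (if char_polynomial T then enat (Max (insert 0 (length ` char_support T))) else \<infinity>)"


section \<open>Poisson kernel and the invariant\<close>

definition poisson_kernel ::
    "('n :: finite \<Rightarrow> 'a :: hilbert_space \<Rightarrow> 'a) \<Rightarrow> 'a \<Rightarrow> ('n fock, 'a) tensor"
  where "poisson_kernel T h = (\<Sum>\<^sub>\<infinity>\<alpha>. fock_basis \<alpha> \<otimes>\<^sub>v defect T (adj (word T \<alpha>) h))"

definition defect_span :: "('n :: finite \<Rightarrow> 'a :: hilbert_space \<Rightarrow> 'a) \<Rightarrow> nat \<Rightarrow> 'a set"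
  where "defect_span T k = closure (cspan {word T \<beta> (defect T h) | \<beta> h. length \<beta> \<ge> k})"

definition Gamma_inv ::
    "('n :: finite \<Rightarrow> 'a :: hilbert_space \<Rightarrow> 'a) \<Rightarrow> enat \<times> enat \<times> enat"
  where "Gamma_inv T =
    ((case char_degree T of
        enat m \<Rightarrow> hilbert_dim (defect_span T m \<inter> orthogonal_to (defect_span T (Suc m)))
      | \<infinity> \<Rightarrow> hilbert_dim (closure (range (defect T)))),
     char_degree T,
     hilbert_dim {h. poisson_kernel T h = 0})"


section \<open>Triangular representations\<close>

text \<open>\<open>T\<^sub>i\<close> has the block matrix with rows \<open>(V\<^sub>i, *)\<close> and \<open>(0, N\<^sub>i)\<close> with respect to the orthogonal
  decomposition \<open>\<H>\<^sub>v \<oplus> \<H>\<^sub>n\<^sub>i\<^sub>l\<close> of the whole space.\<close>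

definition orthogonal_decomposition :: "'a :: hilbert_space set \<Rightarrow> 'a set \<Rightarrow> bool"
  where "orthogonal_decomposition Hv Hnil \<longleftrightarrow>
    closed_csubspace Hv \<and> closed_csubspace Hnil \<and> (\<forall>x\<in>Hv. \<forall>y\<in>Hnil. cinner x y = 0) \<and>
    (\<forall>h. \<exists>x\<in>Hv. \<exists>y\<in>Hnil. h = x + y)"

definition upper_triangular ::
    "('n \<Rightarrow> 'a :: hilbert_space \<Rightarrow> 'a) \<Rightarrow> 'a set \<Rightarrow> 'a set \<Rightarrow>
      ('n \<Rightarrow> 'a \<Rightarrow> 'a) \<Rightarrow> ('n \<Rightarrow> 'a \<Rightarrow> 'a) \<Rightarrow> bool"
  where "upper_triangular T Hv Hnil V N \<longleftrightarrow>
    (\<forall>i. \<exists>R\<in>operators Hnil Hv. \<forall>x\<in>Hv. \<forall>y\<in>Hnil. T i (x + y) = (V i x + R y) + N i y)"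

definition has_representation ::
    "('n :: finite \<Rightarrow> 'a :: hilbert_space \<Rightarrow> 'a) \<Rightarrow> nat \<Rightarrow> bool"
  where "has_representation T m \<longleftrightarrow>
    (\<exists>Hv Hnil V N. orthogonal_decomposition Hv Hnil \<and> upper_triangular T Hv Hnil V N \<and>
      row_contraction_on Hv V \<and> row_isometry_on Hv V \<and> pure_on Hv V \<and>
      row_contraction_on Hnil N \<and> nilpotent_of_order_on Hnil N m)"

end

theory Submission
  imports Defs
begin

text \<open>
  Expanding \<open>(I - \<Sum> X\<^sub>i \<otimes> T\<^sub>i\<^sup>*)\<^sup>-\<^sup>1\<close> into its Neumann series shows that the coefficient of \<open>\<Theta>\<^sub>T\<close> at a
  word \<open>\<beta> g\<^sub>i\<close> is \<open>\<Delta>\<^sub>T T\<^sub>\<gamma>\<^sup>* P\<^sub>i \<Delta>\<^sub>T\<^sub>*\<close>, where \<open>\<gamma>\<close> is \<open>\<beta>\<close> reversed and \<open>P\<^sub>i\<close> is the \<open>i\<close>-th coordinate of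
  \<open>\<H>\<^sup>n\<close> (\<open>char_expansion_fourier_coeff\<close>); evaluation at scaled creation operators on the Fock
  space shows that no other coefficients are possible (\<open>char_coeff_eq\<close>).  The adjoint of this
  coefficient vanishes iff \<open>\<Delta>\<^sub>T\<^sub>*\<close> annihilates the vectors with \<open>T\<^sub>\<gamma> \<Delta>\<^sub>T h\<close> in place \<open>i\<close> and \<open>0\<close> elsewhere.
  As \<open>\<parallel>\<Delta>\<^sub>T\<^sub>* v\<parallel>\<^sup>2 = \<parallel>v\<parallel>\<^sup>2 - \<parallel>T v\<parallel>\<^sup>2\<close>, the degree of \<open>\<Theta>\<^sub>T\<close> is at most \<open>m\<close> iff \<open>T\<close> is a row isometry on the
  invariant subspace \<open>M\<close>, the closed span of the \<open>T\<^sub>\<gamma> \<Delta>\<^sub>T h\<close> with \<open>|\<gamma>| \<ge> m\<close> (\<open>degree_le_iff\<close>).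

  Let \<open>T\<close> be completely non-coisometric and the degree at most \<open>m\<close>.  Restrict \<open>T\<close> to \<open>M\<close> and compress
  it to the complement of \<open>M\<close>.  The restriction is a row isometry; the intersection of the ranges
  of its powers consists of vectors \<open>h\<close> with \<open>\<Sum> \<parallel>T\<^sub>\<alpha>\<^sup>* h\<parallel>\<^sup>2 = \<parallel>h\<parallel>\<^sup>2\<close>, summed over \<open>|\<alpha>| = k\<close>, for all \<open>k\<close>,
  so it is \<open>{0}\<close> and the restriction is pure.  For \<open>y\<close> orthogonal to \<open>M\<close> and \<open>|\<alpha>| = m\<close> the vector
  \<open>T\<^sub>\<alpha>\<^sup>* y\<close> is again of this kind, hence \<open>0\<close>, and the compression is nilpotent of order at most \<open>m\<close>
  (\<open>representation_of_degree_le\<close>).  Conversely, in a representation of order \<open>m\<close> the operators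
  \<open>T\<^sub>\<alpha>\<close> with \<open>|\<alpha>| \<ge> m\<close> map into the first summand, where \<open>T\<close> is isometric, so the degree is at most
  \<open>m\<close> (\<open>degree_le_of_representation\<close>).  Thus every order that occurs bounds the degree, and below
  every bound for the degree there is an order that occurs: the least order is the degree.

  The vectors \<open>h\<close> above are those with \<open>\<Delta>\<^sub>T T\<^sub>\<alpha>\<^sup>* h = 0\<close> for all \<open>\<alpha>\<close>, because
  \<open>\<parallel>\<Delta>\<^sub>T x\<parallel>\<^sup>2 = \<parallel>x\<parallel>\<^sup>2 - \<Sum> \<parallel>T\<^sub>i\<^sup>* x\<parallel>\<^sup>2\<close> telescopes; they form the kernel of \<open>K\<^sub>T\<close>
  (\<open>poisson_kernel_eq_0_iff\<close>), whence the first equivalence.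

  The operators involved are characterised by properties, so their existence has to be established:
  projections and adjoints (\<open>orthogonal_decomposition_exists\<close>, \<open>riesz_representation\<close>), positive
  square roots (\<open>positive_sqrt_exists\<close>, \<open>positive_sqrt_unique\<close>), orthonormal bases
  (\<open>orthonormal_basis_exists\<close>) and tensor products of operators (\<open>tensor_op_exists\<close>).\<close>

section \<open>Inner products and complex-linear operators\<close>

lemma cinner_scaleC_right: "cinner x (a *\<^sub>C y) = cnj a * cinner x y"
  by (metis cinner_commute cinner_scaleC_left complex_cnj_mult)

lemma cinner_add_right: "cinner x (y + z) = cinner x y + cinner x z"
  by (metis cinner_commute cinner_add_left complex_cnj_add)

lemma cinner_zero_left [simp]: "cinner 0 x = 0"
  using cinner_add_left[of 0 0 x] by simp

lemma cinner_zero_right [simp]: "cinner x 0 = 0"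
  using cinner_add_right[of x 0 0] by simp

lemma cinner_minus_left: "cinner (- x) y = - cinner x y"
  by (metis add.right_inverse cinner_add_left cinner_zero_left minus_unique)

lemma cinner_minus_right: "cinner x (- y) = - cinner x y"
  by (metis add.right_inverse cinner_add_right cinner_zero_right minus_unique)

lemma cinner_diff_left: "cinner (x - y) z = cinner x z - cinner y z"
  using cinner_add_left[of x "- y" z] by (simp add: cinner_minus_left)

lemma cinner_diff_right: "cinner x (y - z) = cinner x y - cinner x z"
  using cinner_add_right[of x y "- z"] by (simp add: cinner_minus_right)

lemma cinner_scaleR_left: "cinner (r *\<^sub>R x) y = complex_of_real r * cinner x y"
  by (metis cinner_scaleC_left scaleC_of_real)

lemma cinner_scaleR_right: "cinner x (r *\<^sub>R y) = complex_of_real r * cinner x y"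
  by (metis cinner_scaleC_right scaleC_of_real complex_cnj_complex_of_real)

lemma cinner_sum_left: "cinner (sum f A) y = (\<Sum>i\<in>A. cinner (f i) y)"
  by (induction A rule: infinite_finite_induct) (simp_all add: cinner_add_left)

lemma cinner_sum_right: "cinner x (sum f A) = (\<Sum>i\<in>A. cinner x (f i))"
  by (induction A rule: infinite_finite_induct) (simp_all add: cinner_add_right)

lemmas cinner_simps = cinner_add_left cinner_add_right cinner_diff_left cinner_diff_right
  cinner_minus_left cinner_minus_right cinner_scaleC_left cinner_scaleC_right
  cinner_scaleR_left cinner_scaleR_right cinner_sum_left cinner_sum_right

lemma cinner_self: "cinner x x = complex_of_real ((norm x)\<^sup>2)"
  by (simp add: complex_eq_iff Re_cinner power2_norm_eq_inner)
    (metis cinner_commute cnj.simps(2) equal_neg_zero)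

lemma cinner_self_eq_0 [simp]: "cinner x x = 0 \<longleftrightarrow> x = 0"
  by (simp add: cinner_self)

lemma cinner_eq_0_commute: "cinner x y = 0 \<longleftrightarrow> cinner y x = 0"
  by (metis cinner_commute complex_cnj_zero)

lemma cinner_ext:
  assumes "\<And>z. cinner x z = cinner y z" shows "x = y"
  using assms[of "x - y"] cinner_self_eq_0[of "x - y"] by (simp add: cinner_diff_left)

lemma norm_square_diff:
  "(norm (x - y))\<^sup>2 = (norm x)\<^sup>2 - 2 * Re (cinner x y) + (norm (y :: 'a :: hilbert_space))\<^sup>2"
  by (simp add: Re_cinner power2_norm_eq_inner inner_diff_left inner_diff_right inner_commute)

lemma bounded_linear_cinner_left: "bounded_linear (\<lambda>x. cinner x y)"
  by (rule bounded_linear_intro[where K = "norm y"])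
    (simp_all add: cinner_simps scaleR_conv_of_real norm_cinner_le)

lemma bounded_linear_cinner_right: "bounded_linear (\<lambda>y. cinner x y)"
  by (rule bounded_linear_intro[where K = "norm x"])
    (simp_all add: cinner_simps scaleR_conv_of_real norm_cinner_le mult.commute[of "norm _" "norm x"])

lemmas tendsto_cinner_left = bounded_linear.tendsto[OF bounded_linear_cinner_left]
lemmas tendsto_cinner_right = bounded_linear.tendsto[OF bounded_linear_cinner_right]

lemma bounded_clinear_bounded: "bounded_clinear f \<Longrightarrow> bounded_linear f"
  and bounded_clinear_scaleC: "bounded_clinear f \<Longrightarrow> f (a *\<^sub>C x) = a *\<^sub>C f x"
  by (simp_all add: bounded_clinear_def)

lemma bounded_clinear_add: "bounded_clinear f \<Longrightarrow> f (x + y) = f x + f y"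
  and bounded_clinear_diff: "bounded_clinear f \<Longrightarrow> f (x - y) = f x - f y"
  and bounded_clinear_minus: "bounded_clinear f \<Longrightarrow> f (- x) = - f x"
  and bounded_clinear_0: "bounded_clinear f \<Longrightarrow> f 0 = 0"
  and bounded_clinear_sum: "bounded_clinear f \<Longrightarrow> f (sum g A) = (\<Sum>i\<in>A. f (g i))"
  and bounded_clinear_scaleR: "bounded_clinear f \<Longrightarrow> f (r *\<^sub>R x) = r *\<^sub>R f x"
  unfolding bounded_clinear_def
  by (simp_all add: linear_simps bounded_linear.linear linear_sum)

lemmas bounded_clinear_simps = bounded_clinear_add bounded_clinear_diff bounded_clinear_minus
  bounded_clinear_0 bounded_clinear_sum bounded_clinear_scaleR bounded_clinear_scaleC

lemma bounded_clinearI: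
  assumes "\<And>x y. f (x + y) = f x + f y" "\<And>a x. f (a *\<^sub>C x) = a *\<^sub>C f x"
    and "\<And>x. norm (f x) \<le> K * norm x"
  shows "bounded_clinear f"
  unfolding bounded_clinear_def
proof (intro conjI allI)
  show "bounded_linear f"
    by (rule bounded_linear_intro[where K = K])
      (use assms in \<open>simp_all add: mult.commute flip: scaleC_of_real\<close>)
qed (rule assms)

lemma bounded_clinear_normE:
  assumes "bounded_clinear f"
  obtains K where "K > 0" "\<And>x. norm (f x) \<le> K * norm x"
  using bounded_linear.pos_bounded[OF bounded_clinear_bounded[OF assms]]
  by (metis mult.commute)

lemma bounded_clinear_compose:
  assumes "bounded_clinear f" "bounded_clinear g" shows "bounded_clinear (\<lambda>x. f (g x))"
  using assms bounded_linear_compose by (auto simp: bounded_clinear_def)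

lemma bounded_clinear_comp:
  assumes "bounded_clinear f" "bounded_clinear g" shows "bounded_clinear (f \<circ> g)"
  using bounded_clinear_compose[OF assms] by (simp add: o_def)

lemma bounded_clinear_ident: "bounded_clinear (\<lambda>x. x)"
  and bounded_clinear_id: "bounded_clinear id"
  and bounded_clinear_zero: "bounded_clinear (\<lambda>_. 0)"
  by (auto simp: bounded_clinear_def bounded_linear_ident id_def)

lemma bounded_clinear_plus:
  "bounded_clinear f \<Longrightarrow> bounded_clinear g \<Longrightarrow> bounded_clinear (\<lambda>x. f x + g x)"
  and bounded_clinear_subtract:
  "bounded_clinear f \<Longrightarrow> bounded_clinear g \<Longrightarrow> bounded_clinear (\<lambda>x. f x - g x)"
  and bounded_clinear_uminus: "bounded_clinear f \<Longrightarrow> bounded_clinear (\<lambda>x. - f x)"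
  and bounded_clinear_times: "bounded_clinear f \<Longrightarrow> bounded_clinear (\<lambda>x. a *\<^sub>C f x)"
  and bounded_clinear_timesR: "bounded_clinear f \<Longrightarrow> bounded_clinear (\<lambda>x. r *\<^sub>R f x)"
  unfolding bounded_clinear_def
  by (auto intro: bounded_linear_add bounded_linear_sub bounded_linear_minus
      bounded_linear_compose[OF bounded_linear_scaleC]
      bounded_linear_compose[OF bounded_linear_scaleR_right]
      simp: scaleC_add_right complex_vector.scale_right_diff_distrib
        complex_vector.scale_minus_right scaleC_scaleC mult.commute
      simp flip: scaleC_of_real)

lemma bounded_clinear_setsum:
  "(\<And>i. i \<in> A \<Longrightarrow> bounded_clinear (f i)) \<Longrightarrow> bounded_clinear (\<lambda>x. \<Sum>i\<in>A. f i x)"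
  by (induction A rule: infinite_finite_induct)
    (auto intro: bounded_clinear_plus bounded_clinear_zero)

lemmas bounded_clinear_intros = bounded_clinear_comp bounded_clinear_ident
  bounded_clinear_id bounded_clinear_zero bounded_clinear_plus bounded_clinear_subtract
  bounded_clinear_uminus bounded_clinear_times bounded_clinear_timesR bounded_clinear_setsum

lemma bounded_clinear_nth: "bounded_clinear (\<lambda>v :: 'a :: hilbert_space ^ 'n :: finite. v $ i)"
  by (rule bounded_clinearI[where K = 1]) (simp_all add: scaleC_vec_def Finite_Cartesian_Product.norm_nth_le)

lemma norm_axis: "norm (axis i x :: 'a :: hilbert_space ^ 'n :: finite) = norm x"
proof -
  have "(norm (axis i x :: 'a ^ 'n))\<^sup>2 = (\<Sum>j\<in>UNIV. if j = i then (norm x)\<^sup>2 else 0)"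
    unfolding power2_norm_eq_inner inner_vec_def
    by (rule sum.cong) (auto simp: axis_def)
  also have "\<dots> = (norm x)\<^sup>2" by simp
  finally show ?thesis by simp
qed

lemma bounded_clinear_axis:
  "bounded_clinear (axis i :: 'a :: hilbert_space \<Rightarrow> 'a ^ 'n :: finite)"
  by (rule bounded_clinearI[where K = 1])
    (simp_all add: norm_axis, auto simp: axis_def vec_eq_iff scaleC_vec_def)

lemma cinner_axis_left: "cinner (axis i x) v = cinner x (v $ i)"
  and cinner_axis_right: "cinner v (axis i x) = cinner (v $ i) x"
proof -
  have "cinner (axis i x) v = (\<Sum>j\<in>UNIV. if j = i then cinner x (v $ i) else 0)"
    unfolding cinner_vec_def by (rule sum.cong) (auto simp: axis_def)
  then show *: "cinner (axis i x) v = cinner x (v $ i)" by simp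
  show "cinner v (axis i x) = cinner (v $ i) x"
    using * by (metis cinner_commute)
qed

lemma norm_vec_square: "(norm (v :: 'a :: hilbert_space ^ 'n :: finite))\<^sup>2 = (\<Sum>i\<in>UNIV. (norm (v $ i))\<^sup>2)"
  by (simp add: power2_norm_eq_inner inner_vec_def)


section \<open>Orthogonal projections and adjoints\<close>

lemma closed_csubspaceD:
  assumes "closed_csubspace M"
  shows "0 \<in> M" "x \<in> M \<Longrightarrow> y \<in> M \<Longrightarrow> x + y \<in> M" "x \<in> M \<Longrightarrow> a *\<^sub>C x \<in> M"
    "x \<in> M \<Longrightarrow> y \<in> M \<Longrightarrow> x - y \<in> M" "x \<in> M \<Longrightarrow> r *\<^sub>R x \<in> M" "closed M"
    "(\<And>i. i \<in> A \<Longrightarrow> f i \<in> M) \<Longrightarrow> sum f A \<in> M"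
  using assms unfolding closed_csubspace_def
  by (auto simp: complex_vector.subspace_0 complex_vector.subspace_add
      complex_vector.subspace_scale complex_vector.subspace_diff complex_vector.subspace_sum
      simp flip: scaleC_of_real)

lemma csubspace_closure:
  assumes "csubspace S" shows "csubspace (closure S)"
proof (rule complex_vector.subspaceI)
  show "0 \<in> closure S"
    using complex_vector.subspace_0[OF assms] closure_subset by blast
  show "x + y \<in> closure S" if "x \<in> closure S" "y \<in> closure S" for x y
    using that unfolding closure_sequential
    by (metis (no_types, lifting) tendsto_add complex_vector.subspace_add[OF assms])
  show "a *\<^sub>C x \<in> closure S" if "x \<in> closure S" for a x
    using that unfolding closure_sequential
    by (metis (no_types, lifting) bounded_linear.tendsto[OF bounded_linear_scaleC]
        complex_vector.subspace_scale[OF assms])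
qed

lemma closed_csubspace_closure_cspan: "closed_csubspace (closure (cspan S))"
  by (simp add: closed_csubspace_def csubspace_closure complex_vector.subspace_span)

lemma closure_cspan_minimal:
  assumes "closed_csubspace M" "S \<subseteq> M" shows "closure (cspan S) \<subseteq> M"
  using assms unfolding closed_csubspace_def
  by (intro closure_minimal complex_vector.span_minimal) auto

lemma closure_cspan_superset: "S \<subseteq> closure (cspan S)"
  by (meson closure_subset complex_vector.span_superset order_trans)

lemma closed_csubspace_UNIV: "closed_csubspace UNIV"
  by (simp add: closed_csubspace_def complex_vector.subspace_UNIV)

lemma closed_csubspace_vimage:
  assumes "bounded_clinear f" "closed_csubspace M" shows "closed_csubspace {x. f x \<in> M}"
  unfolding closed_csubspace_def
proof
  show "csubspace {x. f x \<in> M}"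
    by (rule complex_vector.subspaceI)
      (use assms in \<open>simp_all add: bounded_clinear_simps closed_csubspaceD\<close>)
  have "closed (f -` M)"
    using assms linear_continuous_on[OF bounded_clinear_bounded, of f UNIV]
    by (intro continuous_closed_vimage) (auto simp: closed_csubspaceD continuous_on_eq_continuous_at)
  then show "closed {x. f x \<in> M}" by (simp add: vimage_def)
qed

lemma closed_csubspace_0: "closed_csubspace {0}"
  by (simp add: closed_csubspace_def)

lemma closed_csubspace_kernel:
  assumes "bounded_clinear f" shows "closed_csubspace {x. f x = 0}"
  using closed_csubspace_vimage[OF assms closed_csubspace_0] by simp

lemma closed_csubspace_orthogonal_to: "closed_csubspace (orthogonal_to M)"
proof -
  have "closed {x. cinner x y = 0}" for y :: 'a
    using continuous_closed_vimage[of "{0}" "\<lambda>x. cinner x y"]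
      linear_continuous_at[OF bounded_linear_cinner_left]
    by (auto simp: vimage_def)
  then have "closed (\<Inter>y\<in>M. {x. cinner x y = 0})" by blast
  moreover have "orthogonal_to M = (\<Inter>y\<in>M. {x. cinner x y = 0})"
    by (auto simp: orthogonal_to_def)
  ultimately show ?thesis
    by (auto simp: closed_csubspace_def orthogonal_to_def complex_vector.subspace_def cinner_simps)
qed

lemma orthogonal_to_UNIV [simp]: "orthogonal_to UNIV = {0}"
  by (auto simp: orthogonal_to_def) (metis cinner_self_eq_0)

lemma orthogonal_to_closure_cspan: "orthogonal_to (closure (cspan S)) = orthogonal_to S"
proof
  show "orthogonal_to (closure (cspan S)) \<subseteq> orthogonal_to S"
    using closure_cspan_superset[of S] by (auto simp: orthogonal_to_def)
  show "orthogonal_to S \<subseteq> orthogonal_to (closure (cspan S))"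
  proof
    fix x assume "x \<in> orthogonal_to S"
    then have "S \<subseteq> orthogonal_to {x}"
      by (auto simp: orthogonal_to_def cinner_eq_0_commute)
    then have "closure (cspan S) \<subseteq> orthogonal_to {x}"
      by (rule closure_cspan_minimal[OF closed_csubspace_orthogonal_to])
    then show "x \<in> orthogonal_to (closure (cspan S))"
      by (auto simp: orthogonal_to_def cinner_eq_0_commute)
  qed
qed

text \<open>A minimising sequence for the distance from \<open>x\<close> to \<open>M\<close> is a Cauchy sequence by the parallelogram
  law.  Minimality of its limit \<open>l\<close> gives that the real inner products of \<open>x - l\<close> with \<open>M\<close> vanish;
  as \<open>M\<close> is closed under multiplication by \<open>\<i>\<close>, so do the complex ones.\<close>

lemma orthogonal_decomposition_exists:
  fixes M :: "'a :: hilbert_space set"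
  assumes "closed_csubspace M"
  shows "\<exists>y\<in>M. x - y \<in> orthogonal_to M"
proof -
  define d where "d = (INF y\<in>M. (norm (x - y))\<^sup>2)"
  have bdd: "bdd_below ((\<lambda>y. (norm (x - y))\<^sup>2) ` M)" by (rule bdd_belowI[where m = 0]) auto
  have ne: "M \<noteq> {}" using closed_csubspaceD(1)[OF assms] by auto
  have low: "d \<le> (norm (x - y))\<^sup>2" if "y \<in> M" for y
    unfolding d_def by (rule cINF_lower[OF bdd that])
  have "\<exists>y\<in>M. (norm (x - y))\<^sup>2 < d + e" if "e > 0" for e
    using cINF_less_iff[OF ne bdd, of "d + e"] that by (simp add: d_def)
  then have "\<forall>n. \<exists>y. y \<in> M \<and> (norm (x - y))\<^sup>2 < d + 1 / real (Suc n)"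
    by (metis of_nat_0_less_iff zero_less_Suc zero_less_divide_1_iff)
  then obtain y where yM: "\<And>n. y n \<in> M" and yd: "\<And>n. (norm (x - y n))\<^sup>2 < d + 1 / real (Suc n)"
    by metis
  have par: "(norm (y m - y n))\<^sup>2 \<le> 2 / real (Suc m) + 2 / real (Suc n)" for m n
  proof -
    have "(norm ((x - y n) - (x - y m)))\<^sup>2 + (norm ((x - y n) + (x - y m)))\<^sup>2
        = 2 * (norm (x - y n))\<^sup>2 + 2 * (norm (x - y m))\<^sup>2"
      by (simp add: power2_norm_eq_inner inner_diff_left inner_diff_right inner_add_left inner_add_right inner_commute)
    moreover have "(x - y n) + (x - y m) = 2 *\<^sub>R (x - (1/2) *\<^sub>R (y n + y m))"
      by (simp add: algebra_simps scaleR_2)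
    moreover have "d \<le> (norm (x - (1/2) *\<^sub>R (y n + y m)))\<^sup>2"
      by (intro low closed_csubspaceD[OF assms] yM)
    ultimately show ?thesis
      using yd[of m] yd[of n] by (simp add: power_mult_distrib)
  qed
  have "Cauchy y"
  proof (rule metric_CauchyI)
    fix e :: real assume e: "e > 0"
    then obtain N where N: "4 / e\<^sup>2 < real (Suc N)"
      using reals_Archimedean2[of "4 / e\<^sup>2"] by (meson less_trans of_nat_less_iff lessI)
    have "dist (y m) (y n) < e" if "m \<ge> N" "n \<ge> N" for m n
    proof -
      have "2 / real (Suc m) \<le> 2 / real (Suc N)" "2 / real (Suc n) \<le> 2 / real (Suc N)"
        using that by (auto intro!: divide_left_mono)
      then have "(norm (y m - y n))\<^sup>2 \<le> 4 / real (Suc N)" using par[of m n] by simp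
      also have "\<dots> < e\<^sup>2" using N e by (simp add: field_simps)
      finally show ?thesis using e by (simp add: dist_norm power_less_imp_less_base)
    qed
    then show "\<exists>N. \<forall>m\<ge>N. \<forall>n\<ge>N. dist (y m) (y n) < e" by blast
  qed
  then obtain l where l: "y \<longlonglongrightarrow> l" using Cauchy_convergent convergent_def by blast
  have lM: "l \<in> M"
    using closed_csubspaceD(6)[OF assms] yM l closed_sequentially by blast
  have "(\<lambda>n. (norm (x - y n))\<^sup>2) \<longlonglongrightarrow> (norm (x - l))\<^sup>2" by (intro tendsto_intros l)
  moreover have "(\<lambda>n. d + 1 / real (Suc n)) \<longlonglongrightarrow> d"
    using tendsto_add[OF tendsto_const[of d] LIMSEQ_inverse_real_of_nat]
    by (simp add: inverse_eq_divide)
  ultimately have ld: "(norm (x - l))\<^sup>2 \<le> d"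
    using yd by (meson LIMSEQ_le less_imp_le)
  have re: "inner (x - l) z = 0" if "z \<in> M" for z
  proof (rule ccontr)
    assume nz: "inner (x - l) z \<noteq> 0"
    then have z: "z \<noteq> 0" by auto
    \<comment> \<open>the minimum point of \<open>t \<mapsto> \<parallel>x - l - t z\<parallel>\<^sup>2\<close>\<close>
    define t where "t = inner (x - l) z / (norm z)\<^sup>2"
    have "(norm (x - l))\<^sup>2 \<le> (norm (x - (l + t *\<^sub>R z)))\<^sup>2"
      by (rule order_trans[OF ld low]) (intro closed_csubspaceD[OF assms] lM that)
    also have "\<dots> = (norm (x - l))\<^sup>2 - 2 * t * inner (x - l) z + t\<^sup>2 * (norm z)\<^sup>2"
      unfolding power2_norm_eq_inner
      by (simp add: inner_diff_left inner_diff_right inner_add_left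
          inner_add_right inner_commute power2_eq_square algebra_simps)
    also have "\<dots> = (norm (x - l))\<^sup>2 - (inner (x - l) z)\<^sup>2 / (norm z)\<^sup>2"
      using z by (simp add: t_def power2_eq_square field_simps)
    finally show False using nz z by (simp add: divide_le_0_iff)
  qed
  have "cinner (x - l) z = 0" if "z \<in> M" for z
  proof -
    have "Re (cinner (x - l) (\<i> *\<^sub>C z)) = 0"
      using re[of "\<i> *\<^sub>C z"] closed_csubspaceD(3)[OF assms that] by (simp add: Re_cinner)
    then show ?thesis
      using re[OF that] by (simp add: complex_eq_iff cinner_scaleC_right Re_cinner[symmetric])
  qed
  then show ?thesis using lM by (auto simp: orthogonal_to_def)
qed

lemma proj_eqI:
  assumes "closed_csubspace M" "y \<in> M" "x - y \<in> orthogonal_to M"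
  shows "proj M x = y"
  unfolding proj_def
proof (rule the_equality)
  fix z assume z: "z \<in> M \<and> x - z \<in> orthogonal_to M"
  have "y - z \<in> M" using assms z by (simp add: closed_csubspaceD)
  moreover have "cinner (y - z) w = 0" if "w \<in> M" for w
    using assms(3) z that by (auto simp: orthogonal_to_def cinner_simps)
  ultimately show "z = y" by (metis cinner_self_eq_0 eq_iff_diff_eq_0)
qed (use assms in auto)

lemma
  assumes "closed_csubspace M"
  shows proj_mem: "proj M x \<in> M" and proj_orthogonal: "x - proj M x \<in> orthogonal_to M"
  using orthogonal_decomposition_exists[OF assms, of x] proj_eqI[OF assms] by auto

lemma cinner_proj_member:
  assumes "closed_csubspace M" "y \<in> M" shows "cinner (proj M x) y = cinner x y"
  using proj_orthogonal[OF assms(1), of x] assms(2)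
  by (auto simp: orthogonal_to_def cinner_simps)

lemma proj_id: "closed_csubspace M \<Longrightarrow> x \<in> M \<Longrightarrow> proj M x = x"
  by (rule proj_eqI) (auto simp: orthogonal_to_def)

lemma proj_eq_0_iff:
  assumes "closed_csubspace M" shows "proj M x = 0 \<longleftrightarrow> x \<in> orthogonal_to M"
  using proj_orthogonal[OF assms, of x] proj_eqI[OF assms, of 0 x] closed_csubspaceD(1)[OF assms]
  by auto

lemma proj_UNIV [simp]: "proj UNIV = (\<lambda>x. x)"
  using proj_id[OF closed_csubspace_UNIV] by auto

lemma cinner_proj_left:
  assumes "closed_csubspace M"
  shows "cinner (proj M x) y = cinner (proj M x) (proj M y)"
  using cinner_proj_member[OF assms proj_mem[OF assms, of x], of y]
  by (metis cinner_commute)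

lemma cinner_proj:
  assumes "closed_csubspace M"
  shows "cinner (proj M x) y = cinner x (proj M y)"
  by (metis assms cinner_proj_left cinner_commute)

lemma norm_proj_le:
  assumes "closed_csubspace M" shows "norm (proj M x) \<le> norm x"
proof -
  have "complex_of_real ((norm (proj M x))\<^sup>2) = cinner x (proj M x)"
    by (metis cinner_proj_member[OF assms proj_mem[OF assms]] cinner_self)
  then have "(norm (proj M x))\<^sup>2 = norm (cinner x (proj M x))"
    by (metis norm_of_real abs_of_nonneg zero_le_power2)
  also have "\<dots> \<le> norm x * norm (proj M x)" by (rule norm_cinner_le)
  finally have "norm (proj M x) * norm (proj M x) \<le> norm x * norm (proj M x)"
    by (simp add: power2_eq_square)
  then show ?thesis by (cases "proj M x = 0") auto
qed

lemma bounded_clinear_proj: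
  assumes "closed_csubspace M" shows "bounded_clinear (proj M)"
proof (rule bounded_clinearI[where K = 1])
  fix x y :: 'a and a :: complex
  have "cinner (proj M (x + y)) z = cinner (proj M x + proj M y) z" for z
    using cinner_proj[OF assms] by (simp add: cinner_simps)
  then show "proj M (x + y) = proj M x + proj M y" by (rule cinner_ext)
  have "cinner (proj M (a *\<^sub>C x)) z = cinner (a *\<^sub>C proj M x) z" for z
    using cinner_proj[OF assms] by (simp add: cinner_simps)
  then show "proj M (a *\<^sub>C x) = a *\<^sub>C proj M x" by (rule cinner_ext)
qed (use norm_proj_le[OF assms] in simp)

lemma orthogonal_to_orthogonal_to:
  assumes "closed_csubspace M" shows "orthogonal_to (orthogonal_to M) = M"
proof
  show "M \<subseteq> orthogonal_to (orthogonal_to M)"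
    by (auto simp: orthogonal_to_def) (metis cinner_eq_0_commute)
  show "orthogonal_to (orthogonal_to M) \<subseteq> M"
  proof
    fix x assume x: "x \<in> orthogonal_to (orthogonal_to M)"
    have p: "x - proj M x \<in> orthogonal_to M" by (rule proj_orthogonal[OF assms])
    have "cinner x (x - proj M x) = 0" using x p by (auto simp: orthogonal_to_def)
    moreover have "cinner (x - proj M x) (proj M x) = 0"
      using p proj_mem[OF assms, of x] by (auto simp: orthogonal_to_def)
    then have "cinner (proj M x) (x - proj M x) = 0" by (simp only: cinner_eq_0_commute)
    ultimately have "cinner (x - proj M x) (x - proj M x) = 0" by (simp only: cinner_diff_left diff_self)
    then show "x \<in> M" using proj_mem[OF assms, of x] by simp
  qed
qed

text \<open>Riesz representation: a functional is determined by its value on one vector orthogonal to its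
  kernel.\<close>

lemma riesz_representation:
  fixes f :: "'a :: hilbert_space \<Rightarrow> complex"
  assumes f: "bounded_clinear f"
  shows "\<exists>y. \<forall>x. f x = cinner x y"
proof (cases "\<forall>x. f x = 0")
  case False
  then obtain x0 where x0: "f x0 \<noteq> 0" by blast
  define K where "K = {x. f x = 0}"
  have K: "closed_csubspace K" unfolding K_def by (rule closed_csubspace_kernel[OF f])
  define z where "z = x0 - proj K x0"
  have zK: "z \<in> orthogonal_to K" unfolding z_def by (rule proj_orthogonal[OF K])
  have fz: "f z \<noteq> 0"
    using x0 proj_mem[OF K, of x0] by (simp add: z_def bounded_clinear_diff[OF f] K_def)
  then have z: "z \<noteq> 0" using bounded_clinear_0[OF f] by auto
  have "f x = cinner x ((cnj (f z) / of_real ((norm z)\<^sup>2)) *\<^sub>C z)" for x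
  proof -
    have "x - (f x / f z) *\<^sub>C z \<in> K"
      using fz by (simp add: K_def bounded_clinear_simps[OF f] scaleC_complex_def)
    then have "cinner (x - (f x / f z) *\<^sub>C z) z = 0"
      using zK by (auto simp: orthogonal_to_def cinner_eq_0_commute)
    then have "cinner x z = f x / f z * of_real ((norm z)\<^sup>2)"
      by (simp add: cinner_simps cinner_self)
    then show ?thesis using fz z by (simp add: cinner_simps)
  qed
  then show ?thesis by blast
qed (auto intro!: exI[of _ 0])

lemma adj_eqI:
  assumes "\<And>x y. cinner (f x) y = cinner x (g y)" shows "adj f = g"
  unfolding adj_def
proof (rule the_equality)
  fix h assume h: "\<forall>x y. cinner (f x) y = cinner x (h y)"
  show "h = g"
  proof (rule ext, rule cinner_ext)
    fix x y
    have "cinner x (h y) = cinner x (g y)" using h assms by metis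
    then show "cinner (h y) x = cinner (g y) x" by (metis cinner_commute)
  qed
qed (use assms in auto)

lemma cinner_adj:
  assumes "bounded_clinear f" shows "cinner x (adj f y) = cinner (f x) y"
proof -
  have "bounded_clinear (\<lambda>x. cinner (f x) y)" for y
  proof -
    have "bounded_clinear (\<lambda>x. cinner x y)"
      by (rule bounded_clinearI[where K = "norm y"])
        (simp_all add: cinner_simps scaleC_complex_def norm_cinner_le mult.commute[of "norm y"])
    then show ?thesis by (rule bounded_clinear_compose[OF _ assms])
  qed
  then have "\<forall>y. \<exists>z. \<forall>x. cinner (f x) y = cinner x z" using riesz_representation by blast
  then obtain g where g: "\<And>x y. cinner (f x) y = cinner x (g y)" by metis
  then show ?thesis using adj_eqI[OF g] by simp
qed

lemma cinner_adj_left: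
  assumes "bounded_clinear f" shows "cinner (adj f y) x = cinner y (f x)"
  by (metis assms cinner_adj cinner_commute)

lemma norm_adj_le:
  assumes f: "bounded_clinear f" and K: "\<And>x. norm (f x) \<le> K * norm x" "0 \<le> K"
  shows "norm (adj f y) \<le> K * norm y"
proof (cases "adj f y = 0")
  case True
  have "0 \<le> K * norm y" using K(2) by simp
  then show ?thesis using True by simp
next
  case False
  have "(norm (adj f y))\<^sup>2 = norm (cinner (f (adj f y)) y)"
    by (metis cinner_adj[OF f] cinner_self norm_of_real abs_of_nonneg zero_le_power2)
  also have "\<dots> \<le> norm (f (adj f y)) * norm y" by (rule norm_cinner_le)
  also have "\<dots> \<le> K * norm (adj f y) * norm y" by (intro mult_right_mono K norm_ge_zero)
  finally have "norm (adj f y) * norm (adj f y) \<le> (K * norm y) * norm (adj f y)"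
    by (simp add: power2_eq_square mult_ac)
  then show ?thesis using False by simp
qed

lemma bounded_clinear_adj:
  assumes f: "bounded_clinear f" shows "bounded_clinear (adj f)"
proof -
  obtain K where K: "K > 0" "\<And>x. norm (f x) \<le> K * norm x" using bounded_clinear_normE[OF f] by metis
  show ?thesis
  proof (rule bounded_clinearI)
    show "norm (adj f x) \<le> K * norm x" for x by (rule norm_adj_le[OF f K(2) less_imp_le[OF K(1)]])
    show "adj f (x + y) = adj f x + adj f y" for x y
      by (rule cinner_ext) (simp add: cinner_simps cinner_adj_left[OF f])
    show "adj f (a *\<^sub>C x) = a *\<^sub>C adj f x" for a x
      by (rule cinner_ext) (simp add: cinner_simps cinner_adj_left[OF f])
  qed
qed

lemma adj_adj: "bounded_clinear f \<Longrightarrow> adj (adj f) = f"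
  by (rule adj_eqI) (rule cinner_adj_left)

lemma adj_comp:
  assumes "bounded_clinear f" "bounded_clinear g" shows "adj (f \<circ> g) = adj g \<circ> adj f"
  by (rule adj_eqI) (simp add: cinner_adj assms)

lemma adj_id: "adj id = id"
  by (rule adj_eqI) simp

lemma adj_proj: "closed_csubspace M \<Longrightarrow> adj (proj M) = proj M"
  by (rule adj_eqI) (rule cinner_proj)


section \<open>Positive operators and their square roots\<close>

lemma positive_operatorD:
  assumes "positive_operator f"
  shows "bounded_clinear f" "Re (cinner (f x) x) \<ge> 0" "Im (cinner (f x) x) = 0"
  using assms by (auto simp: positive_operator_def complex_nonneg_Reals_iff)

lemma positive_operatorI:
  assumes "bounded_clinear f" "\<And>x y. cinner (f x) y = cinner x (f y)"
    and "\<And>x. Re (cinner (f x) x) \<ge> 0"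
  shows "positive_operator f"
proof -
  have "Im (cinner (f x) x) = 0" for x
    using arg_cong[OF trans[OF assms(2) cinner_commute], of Im x x] by simp
  then show ?thesis using assms by (auto simp: positive_operator_def complex_nonneg_Reals_iff)
qed

text \<open>Polarisation: \<open>\<langle>f (x + y), x + y\<rangle>\<close> and \<open>\<langle>f (x + \<i> y), x + \<i> y\<rangle>\<close> are real, which determines the
  imaginary and the real part of \<open>\<langle>f x, y\<rangle> - \<langle>x, f y\<rangle>\<close>.\<close>

lemma positive_operator_selfadjoint:
  assumes "positive_operator f" shows "cinner (f x) y = cinner x (f y)"
proof -
  note D = positive_operatorD[OF assms]
  have "Im (cinner (f (x + y)) (x + y)) = 0" "Im (cinner (f (x + \<i> *\<^sub>C y)) (x + \<i> *\<^sub>C y)) = 0"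
    by (rule D)+
  then have "cinner (f y) x = cnj (cinner (f x) y)"
    using D(3)[of x] D(3)[of y]
    by (simp add: bounded_clinear_simps[OF D(1)] cinner_simps complex_eq_iff)
  then show ?thesis by (metis cinner_commute complex_cnj_cnj)
qed

text \<open>With \<open>c = I - b\<close> one has \<open>I - b\<^sup>2 = c + b c\<close> and \<open>b c = c b c + b c b\<close>, as \<open>b + c = I\<close>; both
  operators are positive.\<close>

lemma positive_operator_contractive:
  assumes b: "positive_operator b" and le: "\<And>x. Re (cinner (b x) x) \<le> (norm x)\<^sup>2"
  shows "norm (b x) \<le> norm x"
proof -
  note bs = bounded_clinear_simps[OF positive_operatorD(1)[OF b]]
  note sa = positive_operator_selfadjoint[OF b]
  define c where "c = x - b x"
  have "(norm x)\<^sup>2 - (norm (b x))\<^sup>2 = Re (cinner (x - b (b x)) x)"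
    by (simp add: cinner_simps cinner_self sa)
  also have "x - b (b x) = c + (b c)" by (simp add: c_def bs)
  also have "Re (cinner (c + b c) x) = ((norm x)\<^sup>2 - Re (cinner (b x) x))
      + (((norm (b x))\<^sup>2 - Re (cinner (b (b x)) (b x))) + Re (cinner (b c) c))"
    by (simp add: c_def cinner_simps bs cinner_self sa)
  also have "\<dots> \<ge> 0"
    using le[of x] le[of "b x"] positive_operatorD(2)[OF b, of c] by simp
  finally show ?thesis by (simp add: power2_le_iff_abs_le)
qed

text \<open>Writing the operator as \<open>I - b\<close> with \<open>\<parallel>b\<parallel> \<le> 1\<close>, its square root is \<open>I - y\<close> where
  \<open>y = (b + y\<^sup>2) / 2\<close>.  The fixed-point iteration for \<open>y\<close> is dominated, in norm, by the same iteration
  for the number \<open>b = 1\<close>, which is increasing and bounded by \<open>1\<close>.\<close>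

primrec sqrt_iter :: "('a :: hilbert_space \<Rightarrow> 'a) \<Rightarrow> nat \<Rightarrow> 'a \<Rightarrow> 'a" where
  "sqrt_iter b 0 = (\<lambda>_. 0)"
| "sqrt_iter b (Suc n) = (\<lambda>x. (1/2) *\<^sub>R (b x + sqrt_iter b n (sqrt_iter b n x)))"

primrec sqrt_majorant :: "nat \<Rightarrow> real" where
  "sqrt_majorant 0 = 0"
| "sqrt_majorant (Suc n) = (1 + (sqrt_majorant n)\<^sup>2) / 2"

lemma sqrt_majorant_bounds: "0 \<le> sqrt_majorant n" "sqrt_majorant n \<le> 1"
  by (induction n) (auto simp: power_le_one)

lemma sqrt_majorant_mono: "sqrt_majorant n \<le> sqrt_majorant (Suc n)"
proof -
  have "0 \<le> (1 - sqrt_majorant n)\<^sup>2" by simp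
  then show ?thesis by (simp add: power2_diff)
qed

lemma sqrt_majorant_convergent: "convergent sqrt_majorant"
proof (rule Bseq_mono_convergent)
  show "Bseq sqrt_majorant" by (rule BseqI'[where K = 1]) (simp add: sqrt_majorant_bounds)
  show "\<forall>m n. m \<le> n \<longrightarrow> sqrt_majorant m \<le> sqrt_majorant n"
    using lift_Suc_mono_le[of sqrt_majorant, OF sqrt_majorant_mono] by blast
qed

locale sqrt_iteration =
  fixes b :: "'a :: hilbert_space \<Rightarrow> 'a"
  assumes clinear: "bounded_clinear b" and contractive: "norm (b x) \<le> norm x"
begin

abbreviation "y \<equiv> sqrt_iter b"
abbreviation "a \<equiv> sqrt_majorant"

lemma clinear_iter: "bounded_clinear (y n)"
proof (induction n)
  case (Suc n)
  from bounded_clinear_timesR[OF bounded_clinear_plus[OF clinear bounded_clinear_compose[OF Suc Suc]]]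
  show ?case by simp
qed (simp add: bounded_clinear_zero)

lemma iter_commute:
  assumes "bounded_clinear g" "\<And>x. g (b x) = b (g x)"
  shows "g (y n x) = y n (g x)"
  by (induction n arbitrary: x) (auto simp: bounded_clinear_simps[OF assms(1)] assms(2))

lemma iter_iter: "y m (y n x) = y n (y m x)"
  using iter_commute[OF clinear refl] by (intro iter_commute clinear_iter) simp

lemma norm_iter_le: "norm (y n x) \<le> a n * norm x"
proof (induction n arbitrary: x)
  case (Suc n)
  have "norm (y n (y n x)) \<le> a n * (a n * norm x)"
    by (rule order_trans[OF Suc mult_left_mono[OF Suc]]) (rule sqrt_majorant_bounds)
  then have "norm (b x + y n (y n x)) \<le> norm x + a n * (a n * norm x)"
    by (intro norm_triangle_mono contractive)
  then show ?case
    unfolding sqrt_iter.simps sqrt_majorant.simps norm_scaleR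
    by (simp add: power2_eq_square algebra_simps)
qed simp

lemma norm_iter_diff_le: "norm (y (Suc n) x - y n x) \<le> (a (Suc n) - a n) * norm x"
proof (induction n arbitrary: x)
  case 0
  then show ?case using contractive[of x] by simp
next
  case (Suc n)
  let ?d = "y (Suc n) x - y n x"
  have e: "y (Suc (Suc n)) x - y (Suc n) x
      = (1/2) *\<^sub>R (y (Suc n) (y (Suc n) x) - y n (y n x))"
    by (simp only: sqrt_iter.simps(2)[of b "Suc n"] sqrt_iter.simps(2)[of b n]) (simp add: algebra_simps)
  have f: "y (Suc n) (y (Suc n) x) - y n (y n x) = y (Suc n) ?d + y n ?d"
    by (simp only: bounded_clinear_diff[OF clinear_iter] iter_iter[of n "Suc n"]) simp
  have "norm (y (Suc n) ?d + y n ?d) \<le> a (Suc n) * norm ?d + a n * norm ?d"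
    by (intro norm_triangle_mono norm_iter_le)
  also have "\<dots> = (a (Suc n) + a n) * norm ?d" by (simp only: distrib_right)
  also have "\<dots> \<le> (a (Suc n) + a n) * ((a (Suc n) - a n) * norm x)"
    by (intro mult_left_mono Suc add_nonneg_nonneg sqrt_majorant_bounds)
  also have "\<dots> = ((a (Suc n))\<^sup>2 - (a n)\<^sup>2) * norm x"
    by (simp only: power2_eq_square) (simp only: algebra_simps)
  also have "\<dots> = 2 * ((a (Suc (Suc n)) - a (Suc n)) * norm x)"
    by (simp only: sqrt_majorant.simps(2)[of "Suc n"] sqrt_majorant.simps(2)[of n])
      (simp add: field_simps)
  finally show ?case unfolding e f norm_scaleR by simp
qed

definition limit :: "'a \<Rightarrow> 'a" where "limit x = lim (\<lambda>n. y n x)"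

lemma iter_tendsto: "(\<lambda>n. y n x) \<longlonglongrightarrow> limit x"
proof -
  obtain l where "a \<longlonglongrightarrow> l" using sqrt_majorant_convergent convergent_def by blast
  then have s: "summable (\<lambda>n. (a (Suc n) - a n) * norm x)"
    by (intro summable_mult2 telescope_summable)
  have "Cauchy (\<lambda>n. \<Sum>i<n. y (Suc i) x - y i x)"
    proof (rule metric_CauchyI)
      fix e :: real assume "e > 0"
      with s obtain N where N: "\<And>m n. m \<ge> N \<Longrightarrow> norm (\<Sum>i=m..<n. (a (Suc i) - a i) * norm x) < e"
        unfolding summable_Cauchy by blast
      have *: "dist (\<Sum>i<m. y (Suc i) x - y i x) (\<Sum>i<n. y (Suc i) x - y i x) < e"
        if "N \<le> m" "m \<le> n" for m n
      proof -
        have "(\<Sum>i<n. y (Suc i) x - y i x) - (\<Sum>i<m. y (Suc i) x - y i x) = (\<Sum>i=m..<n. y (Suc i) x - y i x)"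
          using that sum_diff_nat_ivl[of 0 m n "\<lambda>i. y (Suc i) x - y i x"] by (simp add: atLeast0LessThan)
        moreover have "norm (\<Sum>i=m..<n. y (Suc i) x - y i x) \<le> (\<Sum>i=m..<n. (a (Suc i) - a i) * norm x)"
          by (rule sum_norm_le) (rule norm_iter_diff_le)
        moreover have "\<dots> < e" using N[OF that(1), of n] by simp
        ultimately have "dist (\<Sum>i<n. y (Suc i) x - y i x) (\<Sum>i<m. y (Suc i) x - y i x) < e"
          by (simp only: dist_norm)
        then show ?thesis by (simp only: dist_commute)
      qed
      show "\<exists>M. \<forall>m\<ge>M. \<forall>n\<ge>M. dist (\<Sum>i<m. y (Suc i) x - y i x) (\<Sum>i<n. y (Suc i) x - y i x) < e"
      proof (intro exI[of _ N] allI impI)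
        fix m n assume "m \<ge> N" "n \<ge> N"
        then show "dist (\<Sum>i<m. y (Suc i) x - y i x) (\<Sum>i<n. y (Suc i) x - y i x) < e"
          using *[of m n] *[of n m] by (cases "m \<le> n") (simp_all only: dist_commute not_le less_imp_le)
      qed
    qed
  moreover have "(\<Sum>i<n. y (Suc i) x - y i x) = y n x" for n
    by (subst sum_lessThan_telescope[of "\<lambda>i. y i x"]) simp
  ultimately have "Cauchy (\<lambda>n. y n x)" by simp
  then show ?thesis unfolding limit_def by (simp add: Cauchy_convergent convergent_LIMSEQ_iff[symmetric])
qed

lemma norm_limit_le: "norm (limit x) \<le> norm x"
proof (rule tendsto_upperbound[OF tendsto_norm[OF iter_tendsto]])
  have "norm (y n x) \<le> norm x" for n
    using norm_iter_le[of n x] mult_right_mono[OF sqrt_majorant_bounds(2)[of n] norm_ge_zero[of x]]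
    by simp
  then show "\<forall>\<^sub>F n in sequentially. norm (y n x) \<le> norm x" by simp
qed simp

lemma limit_eqI: "(\<lambda>n. y n x) \<longlonglongrightarrow> z \<Longrightarrow> limit x = z"
  by (rule LIMSEQ_unique[OF iter_tendsto])

lemma limit_commute:
  assumes "bounded_clinear g" "\<And>x. g (b x) = b (g x)"
  shows "g (limit x) = limit (g x)"
  using bounded_linear.tendsto[OF bounded_clinear_bounded[OF assms(1)] iter_tendsto, of x]
  by (intro limit_eqI[symmetric]) (simp add: iter_commute[OF assms])

lemma clinear_limit: "bounded_clinear limit"
proof (rule bounded_clinearI[where K = 1])
  show "limit (x + z) = limit x + limit z" for x z
    by (rule limit_eqI) (simp add: bounded_clinear_simps[OF clinear_iter] tendsto_add iter_tendsto)
  show "limit (c *\<^sub>C x) = c *\<^sub>C limit x" for c x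
    by (rule limit_eqI) (simp add: bounded_clinear_simps[OF clinear_iter] iter_tendsto
        bounded_linear.tendsto[OF bounded_linear_scaleC])
qed (simp add: norm_limit_le)

lemma limit_fixed_point: "limit x = (1/2) *\<^sub>R (b x + limit (limit x))"
proof -
  have "(\<lambda>n. y n (y n x - limit x)) \<longlonglongrightarrow> 0"
  proof (rule Lim_null_comparison)
    have "norm (y n (y n x - limit x)) \<le> norm (y n x - limit x)" for n
      using norm_iter_le[of n "y n x - limit x"] norm_ge_zero[of "y n x - limit x"]
        mult_right_mono[OF sqrt_majorant_bounds(2)[of n] norm_ge_zero[of "y n x - limit x"]] by simp
    then show "\<forall>\<^sub>F n in sequentially. norm (y n (y n x - limit x)) \<le> norm (y n x - limit x)" by simp
    show "(\<lambda>n. norm (y n x - limit x)) \<longlonglongrightarrow> 0"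
      using iter_tendsto[of x] by (simp add: LIM_zero_iff tendsto_norm_zero_iff)
  qed
  from tendsto_add[OF this iter_tendsto[of "limit x"]]
  have "(\<lambda>n. y n (y n x)) \<longlonglongrightarrow> limit (limit x)" by (simp add: bounded_clinear_diff[OF clinear_iter])
  then have "(\<lambda>n. y (Suc n) x) \<longlonglongrightarrow> (1/2) *\<^sub>R (b x + limit (limit x))"
    by (simp add: tendsto_intros)
  then show ?thesis by (intro limit_eqI) (rule LIMSEQ_imp_Suc)
qed

lemma limit_selfadjoint:
  assumes "\<And>x z. cinner (b x) z = cinner x (b z)"
  shows "cinner (limit x) z = cinner x (limit z)"
proof -
  have "cinner (y n x) z = cinner x (y n z)" for n x z
    by (induction n arbitrary: x z) (simp_all add: cinner_simps assms)
  then show ?thesis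
    using LIMSEQ_unique[OF tendsto_cinner_left[OF iter_tendsto[of x], of z]]
      tendsto_cinner_right[OF iter_tendsto[of z], of x] by simp
qed

end

text \<open>The constructed square root is a limit of polynomials in \<open>f\<close>, hence commutes with everything that
  commutes with \<open>f\<close>; this is what makes it unique.\<close>

lemma positive_sqrt_exists:
  assumes f: "positive_operator f"
  shows "\<exists>s. positive_operator s \<and> s \<circ> s = f \<and>
    (\<forall>g. bounded_clinear g \<longrightarrow> (\<forall>x. g (f x) = f (g x)) \<longrightarrow> (\<forall>x. g (s x) = s (g x)))"
proof -
  note fs = bounded_clinear_simps[OF positive_operatorD(1)[OF f]]
  note sa = positive_operator_selfadjoint[OF f]
  obtain K where K: "K > 0" "\<And>x. norm (f x) \<le> K * norm x"
    using bounded_clinear_normE[OF positive_operatorD(1)[OF f]] by metis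
  define b where "b = (\<lambda>x. x - (1 / K) *\<^sub>R f x)"
  have blin: "bounded_clinear b"
    unfolding b_def by (intro bounded_clinear_intros positive_operatorD(1)[OF f])
  have bsa: "cinner (b x) y = cinner x (b y)" for x y by (simp add: b_def cinner_simps sa)
  have bq: "Re (cinner (b x) x) = (norm x)\<^sup>2 - Re (cinner (f x) x) / K" for x
    by (simp add: b_def cinner_simps cinner_self)
  have "Re (cinner (f x) x) \<le> K * (norm x)\<^sup>2" for x
  proof -
    have "Re (cinner (f x) x) \<le> norm (f x) * norm x"
      using complex_Re_le_cmod norm_cinner_le by (rule order_trans)
    also have "\<dots> \<le> K * norm x * norm x" by (intro mult_right_mono K) simp
    finally show ?thesis by (simp add: power2_eq_square mult.assoc)
  qed
  then have bpos: "positive_operator b"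
    using K(1) by (intro positive_operatorI blin bsa) (simp add: bq field_simps)
  have bc: "norm (b x) \<le> norm x" for x
    by (rule positive_operator_contractive[OF bpos])
      (use K(1) positive_operatorD(2)[OF f] in \<open>simp add: bq\<close>)
  interpret sqrt_iteration b by unfold_locales (rule blin bc)+
  define s where "s = (\<lambda>x. sqrt K *\<^sub>R (x - limit x))"
  have slin: "bounded_clinear s" unfolding s_def by (intro bounded_clinear_intros clinear_limit)
  have "positive_operator s"
  proof (rule positive_operatorI[OF slin])
    show "cinner (s x) z = cinner x (s z)" for x z
      by (simp add: s_def cinner_simps limit_selfadjoint[OF bsa])
    have "Re (cinner (limit x) x) \<le> (norm x)\<^sup>2" for x
    proof -
      have "Re (cinner (limit x) x) \<le> norm (limit x) * norm x"
        using complex_Re_le_cmod norm_cinner_le by (rule order_trans)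
      also have "\<dots> \<le> norm x * norm x" by (intro mult_right_mono norm_limit_le) simp
      finally show ?thesis by (simp add: power2_eq_square)
    qed
    then show "0 \<le> Re (cinner (s x) x)" for x
      using K(1) by (simp add: s_def cinner_simps cinner_self)
  qed
  moreover have "s (s x) = f x" for x
  proof -
    have "s (s x) = K *\<^sub>R (x - 2 *\<^sub>R limit x + limit (limit x))"
      using K(1) by (simp add: s_def bounded_clinear_simps[OF clinear_limit] scaleR_2 algebra_simps)
    also have "2 *\<^sub>R limit x = b x + limit (limit x)" by (subst limit_fixed_point) simp
    also have "K *\<^sub>R (x - (b x + limit (limit x)) + limit (limit x)) = f x"
      using K(1) by (simp add: b_def)
    finally show ?thesis .
  qed
  moreover have "g (s x) = s (g x)" if g: "bounded_clinear g" "\<forall>x. g (f x) = f (g x)" for g x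
  proof -
    have "g (limit x) = limit (g x)"
      by (rule limit_commute[OF g(1)]) (simp add: b_def bounded_clinear_simps[OF g(1)] g(2))
    then show ?thesis by (simp add: s_def bounded_clinear_simps[OF g(1)])
  qed
  ultimately show ?thesis by (intro exI[of _ s]) auto
qed

text \<open>\<open>\<langle>f x, x\<rangle>\<close> is the squared norm of \<open>s x\<close> for a square root \<open>s\<close> of \<open>f\<close>.\<close>

lemma positive_operator_null:
  assumes "positive_operator f" "cinner (f x) x = 0" shows "f x = 0"
proof -
  obtain s where s: "positive_operator s" "s \<circ> s = f" using positive_sqrt_exists[OF assms(1)] by blast
  then have "f x = s (s x)" by auto
  moreover have "cinner (s x) (s x) = 0"
    using assms(2) positive_operator_selfadjoint[OF s(1)] by (simp add: \<open>f x = s (s x)\<close>)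
  ultimately show ?thesis using bounded_clinear_0[OF positive_operatorD(1)[OF s(1)]] by simp
qed

text \<open>If commuting positive \<open>s\<close> and \<open>t\<close> have the same square and \<open>z = (s - t) x\<close>, then
  \<open>\<langle>s z, z\<rangle> + \<langle>t z, z\<rangle> = \<langle>(s\<^sup>2 - t\<^sup>2) x, z\<rangle> = 0\<close>, so \<open>s z = t z = 0\<close> and \<open>z = 0\<close>.\<close>

lemma positive_sqrt_unique:
  assumes s: "positive_operator s" and t: "positive_operator t"
    and eq: "\<And>x. s (s x) = t (t x)" and comm: "\<And>x. s (t x) = t (s x)"
  shows "s = t"
proof
  fix x
  note ss = bounded_clinear_simps[OF positive_operatorD(1)[OF s]]
    and ts = bounded_clinear_simps[OF positive_operatorD(1)[OF t]]
  define z where "z = s x - t x"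
  have "s z + t z = 0" by (simp add: z_def ss ts eq comm)
  then have "cinner (s z) z + cinner (t z) z = 0" by (metis cinner_add_left cinner_zero_left)
  then have "cinner (s z) z = 0" "cinner (t z) z = 0"
    using positive_operatorD(2,3)[OF s, of z] positive_operatorD(2,3)[OF t, of z]
    by (auto simp: complex_eq_iff)
  then have "s z = 0" "t z = 0" using positive_operator_null s t by blast+
  then have "cinner z z = 0"
    using positive_operator_selfadjoint[OF s, of x z] positive_operator_selfadjoint[OF t, of x z]
    by (simp add: z_def cinner_diff_left)
  then show "s x = t x" by (simp add: z_def)
qed

lemma
  assumes "positive_operator f"
  shows sqrt_operator_positive: "positive_operator (sqrt_operator f)"
    and sqrt_operator_square: "sqrt_operator f (sqrt_operator f x) = f x"
proof -
  obtain s where s: "positive_operator s" "s \<circ> s = f"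
    and c: "\<And>g x. bounded_clinear g \<Longrightarrow> (\<And>x. g (f x) = f (g x)) \<Longrightarrow> g (s x) = s (g x)"
    using positive_sqrt_exists[OF assms] by metis
  have "sqrt_operator f = s"
    unfolding sqrt_operator_def
  proof (rule the_equality)
    fix t assume t: "positive_operator t \<and> t \<circ> t = f"
    then have f: "f = t \<circ> t" by simp
    have "t (f x) = f (t x)" for x by (simp add: f)
    then have "t (s x) = s (t x)" for x using c t positive_operatorD(1) by blast
    then show "t = s" using s t by (intro positive_sqrt_unique) (auto simp: fun_eq_iff)
  qed (use s in simp)
  then show "positive_operator (sqrt_operator f)" "sqrt_operator f (sqrt_operator f x) = f x"
    using s(1) fun_cong[OF s(2), of x] by simp_all
qed


section \<open>Orthogonal series and orthonormal bases\<close>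

subclass (in hilbert_space) banach ..

text \<open>The Cauchy criterion for series whose partial sums are controlled in the square of the norm only,
  as is the case for orthogonal series and for the series that define \<open>f \<otimes> g\<close>.\<close>

lemma summable_on_norm_square_bound:
  fixes v :: "'i \<Rightarrow> 'a :: banach" and w :: "'i \<Rightarrow> real"
  assumes w: "w summable_on A"
    and le: "\<And>S. finite S \<Longrightarrow> S \<subseteq> A \<Longrightarrow> (norm (sum v S))\<^sup>2 \<le> sum w S"
  shows "v summable_on A"
proof -
  obtain W where W: "(sum w \<longlongrightarrow> W) (finite_subsets_at_top A)"
    using w unfolding summable_on_def has_sum_def by blast
  have "\<exists>P. eventually P (finite_subsets_at_top A) \<and>
      (\<forall>F F'. P F \<and> P F' \<longrightarrow> dist (sum v F) (sum v F') < e)" if e: "e > 0" for e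
  proof -
    \<comment> \<open>two finite sums within \<open>d\<close> of \<open>W\<close> differ by less than \<open>2 d = (e / 2)\<^sup>2\<close>\<close>
    define d where "d = (e / 2)\<^sup>2 / 2"
    have "d > 0" using e by (simp add: d_def)
    then have "eventually (\<lambda>F. dist (sum w F) W < d) (finite_subsets_at_top A)"
      using W by (auto simp: tendsto_iff)
    then have "\<exists>X. finite X \<and> X \<subseteq> A \<and>
        (\<forall>F. finite F \<and> X \<subseteq> F \<and> F \<subseteq> A \<longrightarrow> dist (sum w F) W < d)"
      by (simp only: eventually_finite_subsets_at_top)
    then obtain F0 where F0: "finite F0" "F0 \<subseteq> A"
      and close: "\<And>F. finite F \<Longrightarrow> F0 \<subseteq> F \<Longrightarrow> F \<subseteq> A \<Longrightarrow> dist (sum w F) W < d"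
      by auto
    have near: "dist (sum v F) (sum v F0) < e / 2" if F: "finite F" "F0 \<subseteq> F" "F \<subseteq> A" for F
    proof -
      have "(dist (sum v F) (sum v F0))\<^sup>2 = (norm (sum v (F - F0)))\<^sup>2"
        by (simp only: dist_norm sum_diff[OF F(1,2)])
      also have "\<dots> \<le> sum w (F - F0)" by (rule le) (use F in auto)
      also have "\<dots> = sum w F - sum w F0" by (simp only: sum_diff[OF F(1,2)])
      also have "\<dots> < 2 * d"
        using close[OF F] close[OF F0(1) order_refl F0(2)] by (simp add: dist_real_def)
      also have "\<dots> = (e / 2)\<^sup>2" by (simp add: d_def)
      finally show ?thesis by (rule power_less_imp_less_base) (use e in simp)
    qed
    show ?thesis
    proof (intro exI conjI allI impI)
      show "eventually (\<lambda>F. finite F \<and> F0 \<subseteq> F \<and> F \<subseteq> A) (finite_subsets_at_top A)"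
        using F0 by (auto simp: eventually_finite_subsets_at_top)
      show "dist (sum v F) (sum v F') < e"
        if "(finite F \<and> F0 \<subseteq> F \<and> F \<subseteq> A) \<and> finite F' \<and> F0 \<subseteq> F' \<and> F' \<subseteq> A" for F F'
        by (rule dist_triangle_half_l[OF near near]) (use that in auto)
    qed
  qed
  then have "cauchy_filter (filtermap (sum v) (finite_subsets_at_top A))"
    by (simp add: cauchy_filter_metric_filtermap)
  moreover have "complete (UNIV :: 'a set)"
    by (meson Cauchy_convergent UNIV_I complete_def convergent_def)
  ultimately obtain L where "(sum v \<longlongrightarrow> L) (finite_subsets_at_top A)"
    using complete_uniform[where S = UNIV] by (force simp add: filterlim_def)
  then show ?thesis unfolding summable_on_def has_sum_def by blast
qed

lemma norm_square_sum_orthogonal: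
  assumes "finite S" "\<And>i j. i \<in> S \<Longrightarrow> j \<in> S \<Longrightarrow> i \<noteq> j \<Longrightarrow> cinner (v i) (v j) = 0"
  shows "(norm (\<Sum>i\<in>S. v i))\<^sup>2 = (\<Sum>i\<in>S. (norm (v i))\<^sup>2)"
proof -
  have "cinner (\<Sum>i\<in>S. v i) (\<Sum>i\<in>S. v i) = (\<Sum>i\<in>S. \<Sum>j\<in>S. cinner (v i) (v j))"
    by (simp add: cinner_simps) (rule sum.swap)
  also have "\<dots> = (\<Sum>i\<in>S. \<Sum>j\<in>S. if j = i then complex_of_real ((norm (v i))\<^sup>2) else 0)"
    by (intro sum.cong refl) (use assms(2) in \<open>auto simp: cinner_self\<close>)
  also have "\<dots> = complex_of_real (\<Sum>i\<in>S. (norm (v i))\<^sup>2)"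
    using assms(1) by simp
  finally show ?thesis unfolding cinner_self of_real_eq_iff .
qed

lemma orthogonal_summable:
  fixes v :: "'i \<Rightarrow> 'a :: hilbert_space"
  assumes "(\<lambda>i. (norm (v i))\<^sup>2) summable_on A"
    and "\<And>i j. i \<in> A \<Longrightarrow> j \<in> A \<Longrightarrow> i \<noteq> j \<Longrightarrow> cinner (v i) (v j) = 0"
  shows "v summable_on A"
  by (rule summable_on_norm_square_bound[OF assms(1)])
    (use norm_square_sum_orthogonal[of _ v] assms(2) in \<open>metis eq_refl subsetD\<close>)

text \<open>A maximal orthonormal set spans a dense subspace: otherwise a unit vector orthogonal to the closed
  span could be added.\<close>

lemma orthonormal_basis_exists: "\<exists>B :: 'a :: hilbert_space set. orthonormal_basis B"
proof -
  have "\<exists>M\<in>{B :: 'a set. orthonormal B}. \<forall>X\<in>{B. orthonormal B}. M \<subseteq> X \<longrightarrow> X = M"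
  proof (rule subset_Zorn_nonempty)
    show "{B :: 'a set. orthonormal B} \<noteq> {}" by (auto simp: orthonormal_def)
    fix \<C> :: "'a set set" assume c: "\<C> \<noteq> {}" "subset.chain {B. orthonormal B} \<C>"
    have "cinner b d = (if b = d then 1 else 0)" if bd: "b \<in> \<Union>\<C>" "d \<in> \<Union>\<C>" for b d
    proof -
      obtain X Y where XY: "X \<in> \<C>" "Y \<in> \<C>" "b \<in> X" "d \<in> Y" using bd by blast
      then have "X \<subseteq> Y \<or> Y \<subseteq> X" using c(2) unfolding subset.chain_def by blast
      then obtain Z where "Z \<in> \<C>" "b \<in> Z" "d \<in> Z" using XY by blast
      then show ?thesis using c(2) unfolding subset.chain_def orthonormal_def by blast
    qed
    then show "\<Union>\<C> \<in> {B. orthonormal B}" by (simp only: orthonormal_def mem_Collect_eq) blast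
  qed
  then obtain B :: "'a set" where B: "orthonormal B"
    and max: "\<And>X. orthonormal X \<Longrightarrow> B \<subseteq> X \<Longrightarrow> X = B" by blast
  have "x \<in> closure (cspan B)" for x
  proof (rule ccontr)
    assume x: "x \<notin> closure (cspan B)"
    note M = closed_csubspace_closure_cspan[of B]
    define z where "z = x - proj (closure (cspan B)) x"
    have z: "z \<noteq> 0" using x proj_mem[OF M, of x] by (auto simp: z_def)
    have zo: "cinner z b = 0" if "b \<in> B" for b
      using proj_orthogonal[OF M, of x] that unfolding z_def orthogonal_to_closure_cspan
      by (auto simp: orthogonal_to_def)
    define e where "e = (1 / norm z) *\<^sub>R z"
    have ee: "cinner e e = 1" using z by (simp add: cinner_self e_def)
    have eo: "cinner e b = 0" "cinner b e = 0" if "b \<in> B" for b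
      using zo[OF that] cinner_eq_0_commute[of z b] by (simp_all add: e_def cinner_simps)
    have "orthonormal (insert e B)"
      using B ee eo unfolding orthonormal_def by (metis insertE)
    then have "e \<in> B" using max[of "insert e B"] by blast
    then show False using eo(1)[of e] ee by simp
  qed
  then show ?thesis using B unfolding orthonormal_basis_def by blast
qed

lemma chosen_basis: "orthonormal chosen_basis" "closure (cspan chosen_basis) = UNIV"
  using someI_ex[OF orthonormal_basis_exists] by (auto simp: chosen_basis_def orthonormal_basis_def)

lemma cinner_chosen_basis:
  fixes b c :: "'a :: hilbert_space"
  shows "b \<in> chosen_basis \<Longrightarrow> c \<in> chosen_basis \<Longrightarrow> cinner b c = (if b = c then 1 else 0)"
  using chosen_basis(1)[where 'a = 'a] by (simp add: orthonormal_def)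

lemma norm_chosen_basis: "b \<in> chosen_basis \<Longrightarrow> norm b = 1"
  using cinner_chosen_basis[of b b] cinner_self[of b]
  by (metis norm_ge_zero of_real_eq_1_iff power2_eq_1_iff real_sqrt_abs real_sqrt_one abs_of_nonneg
      real_sqrt_unique)

text \<open>Bessel's inequality: a finite partial sum \<open>p\<close> of the expansion of \<open>x\<close> satisfies
  \<open>\<parallel>x - p\<parallel>\<^sup>2 = \<parallel>x\<parallel>\<^sup>2 - \<parallel>p\<parallel>\<^sup>2\<close>.\<close>

lemma bessel_summable: "(\<lambda>b. (norm (cinner x b))\<^sup>2) summable_on chosen_basis"
proof (rule nonneg_bounded_partial_sums_imp_summable_on)
  have "(\<Sum>b\<in>S. (norm (cinner x b))\<^sup>2) \<le> (norm x)\<^sup>2" if S: "finite S" "S \<subseteq> chosen_basis" for S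
  proof -
    define p where "p = (\<Sum>b\<in>S. cinner x b *\<^sub>C b)"
    have "(norm p)\<^sup>2 = (\<Sum>b\<in>S. (norm (cinner x b *\<^sub>C b))\<^sup>2)"
      unfolding p_def using S
      by (intro norm_square_sum_orthogonal) (auto simp: cinner_simps cinner_chosen_basis subset_iff)
    also have "\<dots> = (\<Sum>b\<in>S. (norm (cinner x b))\<^sup>2)"
      using S by (intro sum.cong) (auto simp: norm_scaleC norm_chosen_basis subset_iff)
    finally have p: "(norm p)\<^sup>2 = (\<Sum>b\<in>S. (norm (cinner x b))\<^sup>2)" .
    have "cinner x p = (\<Sum>b\<in>S. complex_of_real ((norm (cinner x b))\<^sup>2))"
      unfolding p_def by (simp add: cinner_simps mult.commute complex_norm_square flip: of_real_power)
    then have "Re (cinner x p) = (norm p)\<^sup>2" by (simp add: p)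
    then have "0 \<le> (norm x)\<^sup>2 - (norm p)\<^sup>2"
      using norm_square_diff[of x p] zero_le_power2[of "norm (x - p)"] by linarith
    then show ?thesis using p by simp
  qed
  then show "\<forall>\<^sub>F S in finite_subsets_at_top chosen_basis.
      (\<Sum>b\<in>S. (norm (cinner x b))\<^sup>2) \<le> (norm x)\<^sup>2"
    by (intro eventually_finite_subsets_at_top_weakI)
qed simp

text \<open>The series converges by Bessel's inequality, and its sum has the same coefficients as \<open>x\<close>.\<close>

lemma basis_expansion: "((\<lambda>b. cinner x b *\<^sub>C b) has_sum x) chosen_basis"
proof -
  have "(\<lambda>b. cinner x b *\<^sub>C b) summable_on chosen_basis"
  proof (rule orthogonal_summable)
    show "(\<lambda>b. (norm (cinner x b *\<^sub>C b))\<^sup>2) summable_on chosen_basis"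
      by (rule summable_on_cong[THEN iffD1, OF _ bessel_summable[of x]])
        (simp add: norm_scaleC norm_chosen_basis)
  qed (simp add: cinner_simps cinner_chosen_basis)
  then obtain s where s: "((\<lambda>b. cinner x b *\<^sub>C b) has_sum s) chosen_basis"
    unfolding summable_on_def by blast
  have "cinner (x - s) c = 0" if c: "c \<in> chosen_basis" for c
  proof -
    have "((\<lambda>b. cinner (cinner x b *\<^sub>C b) c) has_sum cinner s c) chosen_basis"
      by (rule has_sum_bounded_linear[OF bounded_linear_cinner_left s])
    moreover have "((\<lambda>b. cinner (cinner x b *\<^sub>C b) c) has_sum cinner x c) chosen_basis"
      by (rule has_sum_cong_neutral[THEN iffD1, of _ "{c}" "\<lambda>b. cinner (cinner x b *\<^sub>C b) c"])
        (use c in \<open>auto simp: cinner_simps cinner_chosen_basis intro!: has_sum_finiteI\<close>)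
    ultimately have "cinner s c = cinner x c" by (rule has_sum_unique)
    then show ?thesis by (simp add: cinner_simps)
  qed
  then have "x - s \<in> orthogonal_to (closure (cspan chosen_basis))"
    by (simp only: orthogonal_to_closure_cspan) (simp add: orthogonal_to_def)
  then have "x = s" by (simp add: chosen_basis)
  then show ?thesis using s by simp
qed


section \<open>Operators on tensor products\<close>

definition tensor_coord :: "('g :: hilbert_space, 'h :: hilbert_space) tensor \<Rightarrow> 'g \<Rightarrow> 'h"
  where "tensor_coord u b = l2_coord (tensor_family u) b"

lemma tensor_coord_eqI: "(\<And>b. tensor_coord u b = tensor_coord v b) \<Longrightarrow> u = v"
  by (intro tensor_eqI l2_eqI) (simp add: tensor_coord_def)

lemma tensor_coord_simps:
  "tensor_coord 0 b = 0"
  "tensor_coord (u + v) b = tensor_coord u b + tensor_coord v b"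
  "tensor_coord (a *\<^sub>C u) b = a *\<^sub>C tensor_coord u b"
  by (simp_all add: tensor_coord_def tensor_family_simps tensor_family_scaleC l2_coord_simps
      l2_coord_scaleC)

lemma tensor_coord_outside: "b \<notin> chosen_basis \<Longrightarrow> tensor_coord u b = 0"
  by (simp add: tensor_coord_def tensor_family_outside)

lemma bounded_clinear_tensor_coord: "bounded_clinear (\<lambda>u. tensor_coord u b)"
  by (rule bounded_clinearI[where K = 1])
    (auto simp: tensor_coord_simps, auto simp: tensor_coord_def intro: order_trans[OF norm_coord_le]
      simp: norm_tensor_family)

lemma tensor_coord_summable: "(\<lambda>b. (norm (tensor_coord u b))\<^sup>2) summable_on S"
  using square_summable_coord[of "tensor_family u"]
  unfolding square_summable_def tensor_coord_def
  by (rule summable_on_subset) simp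

lemma sum_tensor_coord_le: "finite S \<Longrightarrow> (\<Sum>b\<in>S. (norm (tensor_coord u b))\<^sup>2) \<le> (norm u)\<^sup>2"
  unfolding tensor_coord_def using sum_coord_le_norm_l2[of S "tensor_family u"]
  by (simp add: norm_tensor_family)

lemma tensor_coord_tensor_vec:
  "tensor_coord (g \<otimes>\<^sub>v h) b = (if b \<in> chosen_basis then cinner g b *\<^sub>C h else 0)"
proof -
  let ?f = "\<lambda>b. if b \<in> chosen_basis then cinner g b *\<^sub>C h else 0"
  have "(\<lambda>b. (norm h)\<^sup>2 * (norm (cinner g b))\<^sup>2) summable_on chosen_basis"
    by (intro summable_on_cmult_right bessel_summable)
  then have "(\<lambda>b. (norm (?f b))\<^sup>2) summable_on UNIV"
    by (rule summable_on_cong_neutral[THEN iffD1, rotated -1])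
      (auto simp: norm_scaleC power_mult_distrib mult.commute)
  then have "square_summable ?f" by (simp only: square_summable_def)
  then have "l2_coord (Abs_l2 ?f) = ?f" by (rule coord_Abs)
  then show ?thesis unfolding tensor_coord_def tensor_vec_def by (subst family_Abs) auto
qed

lemma tensor_vec_add_left: "(g + g') \<otimes>\<^sub>v h = g \<otimes>\<^sub>v h + g' \<otimes>\<^sub>v h"
  and tensor_vec_add_right: "g \<otimes>\<^sub>v (h + h') = g \<otimes>\<^sub>v h + g \<otimes>\<^sub>v h'"
  and tensor_vec_scaleC_left: "(a *\<^sub>C g) \<otimes>\<^sub>v h = a *\<^sub>C (g \<otimes>\<^sub>v h)"
  and tensor_vec_scaleC_right: "g \<otimes>\<^sub>v (a *\<^sub>C h) = a *\<^sub>C (g \<otimes>\<^sub>v h)"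
  by (rule tensor_coord_eqI; simp add: tensor_coord_simps tensor_coord_tensor_vec cinner_simps
      scaleC_add_left scaleC_add_right scaleC_scaleC mult.commute)+

lemma cinner_tensor_vec: "cinner (g \<otimes>\<^sub>v h) (g' \<otimes>\<^sub>v h') = cinner g g' * cinner h h'"
proof -
  let ?t = "\<lambda>b. cinner (tensor_coord (g \<otimes>\<^sub>v h) b) (tensor_coord (g' \<otimes>\<^sub>v h') b)"
  have "((\<lambda>b. cinner (cinner g b *\<^sub>C b) g' * cinner h h') has_sum (cinner g g' * cinner h h')) chosen_basis"
    by (intro has_sum_cmult_left has_sum_bounded_linear[OF bounded_linear_cinner_left basis_expansion])
  then have "(?t has_sum (cinner g g' * cinner h h')) UNIV"
    by (rule has_sum_cong_neutral[THEN iffD1, rotated -1])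
      (auto simp: tensor_coord_tensor_vec cinner_simps cinner_commute[of _ g'] mult_ac)
  then show ?thesis
    by (simp add: cinner_tensor_def cinner_l2_def infsumI flip: tensor_coord_def)
qed

lemma norm_tensor_vec: "norm (g \<otimes>\<^sub>v h) = norm g * norm h"
proof -
  have "complex_of_real ((norm (g \<otimes>\<^sub>v h))\<^sup>2) = complex_of_real ((norm g)\<^sup>2 * (norm h)\<^sup>2)"
    using cinner_tensor_vec[of g h g h] unfolding cinner_self by simp
  then show ?thesis
    unfolding of_real_eq_iff power_mult_distrib[symmetric]
    by (metis norm_ge_zero mult_nonneg_nonneg power2_eq_iff_nonneg)
qed

lemma bounded_clinear_tensor_left: "bounded_clinear (\<lambda>g. g \<otimes>\<^sub>v h)"
  by (rule bounded_clinearI[where K = "norm h"])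
    (simp_all add: tensor_vec_add_left tensor_vec_scaleC_left norm_tensor_vec mult.commute)

lemma bounded_clinear_tensor_right: "bounded_clinear (\<lambda>h. g \<otimes>\<^sub>v h)"
  by (rule bounded_clinearI[where K = "norm g"])
    (simp_all add: tensor_vec_add_right tensor_vec_scaleC_right norm_tensor_vec)

text \<open>Elementary tensors span a dense subspace, in the explicit form that every tensor is an
  orthogonal series of them.\<close>

lemma tensor_expansion: "((\<lambda>b. b \<otimes>\<^sub>v tensor_coord u b) has_sum u) chosen_basis"
proof -
  have "(\<lambda>b. b \<otimes>\<^sub>v tensor_coord u b) summable_on chosen_basis"
  proof (rule orthogonal_summable)
    show "(\<lambda>b. (norm (b \<otimes>\<^sub>v tensor_coord u b))\<^sup>2) summable_on chosen_basis"
      by (rule summable_on_cong[THEN iffD1, OF _ tensor_coord_summable[of u]])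
        (simp add: norm_tensor_vec norm_chosen_basis)
  qed (simp add: cinner_tensor_vec cinner_chosen_basis)
  then obtain s where s: "((\<lambda>b. b \<otimes>\<^sub>v tensor_coord u b) has_sum s) chosen_basis"
    unfolding summable_on_def by blast
  have "tensor_coord s c = tensor_coord u c" for c
  proof (cases "c \<in> chosen_basis")
    case c: True
    have "((\<lambda>b. tensor_coord (b \<otimes>\<^sub>v tensor_coord u b) c) has_sum tensor_coord s c) chosen_basis"
      by (rule has_sum_bounded_linear[OF bounded_clinear_bounded[OF bounded_clinear_tensor_coord] s])
    moreover have "((\<lambda>b. tensor_coord (b \<otimes>\<^sub>v tensor_coord u b) c) has_sum tensor_coord u c) chosen_basis"
      by (rule has_sum_cong_neutral[THEN iffD1, of _ "{c}" "\<lambda>b. tensor_coord (b \<otimes>\<^sub>v tensor_coord u b) c"])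
        (use c in \<open>auto simp: tensor_coord_tensor_vec cinner_chosen_basis intro!: has_sum_finiteI\<close>)
    ultimately show ?thesis by (rule has_sum_unique)
  qed (simp add: tensor_coord_outside)
  then have "s = u" by (rule tensor_coord_eqI)
  then show ?thesis using s by simp
qed

lemma bounded_linear_tensor_ext:
  assumes "bounded_linear F" "bounded_linear G" "\<And>x y. F (x \<otimes>\<^sub>v y) = G (x \<otimes>\<^sub>v y)"
  shows "F u = G u"
  using has_sum_bounded_linear[OF assms(1) tensor_expansion[of u]]
    has_sum_bounded_linear[OF assms(2) tensor_expansion[of u]]
  by (simp add: assms(3) has_sum_unique)

lemma bounded_clinear_tensor_ext:
  assumes "bounded_clinear F" "bounded_clinear G" "\<And>x y. F (x \<otimes>\<^sub>v y) = G (x \<otimes>\<^sub>v y)"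
  shows "F = G"
  using bounded_linear_tensor_ext[OF bounded_clinear_bounded bounded_clinear_bounded] assms by blast

lemma tensor_ext:
  assumes "\<And>x y. cinner u (x \<otimes>\<^sub>v y) = cinner v (x \<otimes>\<^sub>v y)" shows "u = v"
proof -
  have "cinner u w = cinner v w" for w
    by (rule bounded_linear_tensor_ext[OF bounded_linear_cinner_right bounded_linear_cinner_right])
      (rule assms)
  then show ?thesis by (rule cinner_ext)
qed

text \<open>This is the boundedness of \<open>f \<otimes> I\<close>: with the positive square root \<open>R\<close> of \<open>K\<^sup>2 - f\<^sup>* f\<close> one has
  \<open>K\<^sup>2 \<langle>b, c\<rangle> = \<langle>f b, f c\<rangle> + \<langle>R b, R c\<rangle>\<close>, so \<open>K\<^sup>2\<close> times the squared norm of \<open>\<Sum> b \<otimes> h b\<close> is the sum of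
  those of \<open>\<Sum> f b \<otimes> h b\<close> and \<open>\<Sum> R b \<otimes> h b\<close>.\<close>

lemma norm_sum_tensor_le:
  fixes f :: "'g :: hilbert_space \<Rightarrow> 'k :: hilbert_space" and h :: "'g \<Rightarrow> 'h :: hilbert_space"
  assumes f: "bounded_clinear f" and K: "\<And>x. norm (f x) \<le> K * norm x"
    and S: "finite S" "S \<subseteq> chosen_basis"
  shows "(norm (\<Sum>b\<in>S. f b \<otimes>\<^sub>v h b))\<^sup>2 \<le> K\<^sup>2 * (\<Sum>b\<in>S. (norm (h b))\<^sup>2)"
proof -
  define A where "A = (\<lambda>x. K\<^sup>2 *\<^sub>R x - adj f (f x))"
  have "positive_operator A"
  proof (rule positive_operatorI)
    show "bounded_clinear A"
      unfolding A_def
      by (intro bounded_clinear_subtract bounded_clinear_timesR bounded_clinear_ident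
          bounded_clinear_compose[OF bounded_clinear_adj[OF f] f])
    show "cinner (A x) y = cinner x (A y)" for x y
      by (simp add: A_def cinner_simps cinner_adj[OF f] cinner_adj_left[OF f])
    have "(norm (f x))\<^sup>2 \<le> K\<^sup>2 * (norm x)\<^sup>2" for x
      using power_mono[OF K[of x] norm_ge_zero, of 2] by (simp add: power_mult_distrib)
    then show "Re (cinner (A x) x) \<ge> 0" for x
      by (simp add: A_def cinner_simps cinner_adj_left[OF f] cinner_self del: of_real_power)
  qed
  then obtain R where R: "positive_operator R" "R \<circ> R = A" using positive_sqrt_exists by blast
  have split: "cinner (f b) (f c) + cinner (R b) (R c) = K\<^sup>2 * cinner b c" for b c
  proof -
    have "cinner (R b) (R c) = cinner (A b) c"
      using positive_operator_selfadjoint[OF R(1), of "R b" c] R(2) by (simp add: fun_eq_iff)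
    then show ?thesis by (simp add: A_def cinner_simps cinner_adj_left[OF f])
  qed
  have expand: "complex_of_real ((norm (\<Sum>b\<in>S. g b \<otimes>\<^sub>v h b))\<^sup>2)
      = (\<Sum>b\<in>S. \<Sum>c\<in>S. cinner (g c) (g b) * cinner (h c) (h b))"
    for g :: "'g \<Rightarrow> 'l :: hilbert_space"
    by (simp only: cinner_self[symmetric] cinner_sum_left cinner_sum_right cinner_tensor_vec)
  have "complex_of_real ((norm (\<Sum>b\<in>S. f b \<otimes>\<^sub>v h b))\<^sup>2) + complex_of_real ((norm (\<Sum>b\<in>S. R b \<otimes>\<^sub>v h b))\<^sup>2)
      = (\<Sum>b\<in>S. \<Sum>c\<in>S. K\<^sup>2 * cinner c b * cinner (h c) (h b))"
    unfolding expand by (simp only: split[symmetric] sum.distrib[symmetric] distrib_right)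
  also have "\<dots> = (\<Sum>b\<in>S. \<Sum>c\<in>S. if c = b then complex_of_real (K\<^sup>2 * (norm (h b))\<^sup>2) else 0)"
  proof (intro sum.cong refl)
    fix b c assume bc: "b \<in> S" "c \<in> S"
    have "cinner c b = (if c = b then 1 else 0)" using bc S(2) by (intro cinner_chosen_basis) auto
    then show "K\<^sup>2 * cinner c b * cinner (h c) (h b)
        = (if c = b then complex_of_real (K\<^sup>2 * (norm (h b))\<^sup>2) else 0)"
      by (simp add: cinner_self)
  qed
  also have "\<dots> = complex_of_real (K\<^sup>2 * (\<Sum>b\<in>S. (norm (h b))\<^sup>2))"
    using S(1) by (simp add: sum_distrib_left)
  finally have "(norm (\<Sum>b\<in>S. f b \<otimes>\<^sub>v h b))\<^sup>2 + (norm (\<Sum>b\<in>S. R b \<otimes>\<^sub>v h b))\<^sup>2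
      = K\<^sup>2 * (\<Sum>b\<in>S. (norm (h b))\<^sup>2)"
    unfolding of_real_add[symmetric] of_real_eq_iff .
  then show ?thesis using zero_le_power2[of "norm (\<Sum>b\<in>S. R b \<otimes>\<^sub>v h b)"] by linarith
qed

text \<open>The operator is \<open>u \<mapsto> \<Sum> f b \<otimes> g (u b)\<close>, summed over the basis elements \<open>b\<close>; its terms are not
  orthogonal, and the series converges by the preceding estimate.\<close>

lemma tensor_op_exists:
  fixes f :: "'g :: hilbert_space \<Rightarrow> 'k :: hilbert_space"
    and g :: "'h :: hilbert_space \<Rightarrow> 'l :: hilbert_space"
  assumes f: "bounded_clinear f" and g: "bounded_clinear g"
  shows "\<exists>F. bounded_clinear F \<and> (\<forall>x y. F (x \<otimes>\<^sub>v y) = f x \<otimes>\<^sub>v g y)"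
proof -
  obtain K where K: "K > 0" "\<And>x. norm (f x) \<le> K * norm x" using bounded_clinear_normE[OF f] by metis
  obtain L where L: "L > 0" "\<And>x. norm (g x) \<le> L * norm x" using bounded_clinear_normE[OF g] by metis
  let ?t = "\<lambda>u b. f b \<otimes>\<^sub>v g (tensor_coord u b)"
  have le: "(norm (\<Sum>b\<in>S. ?t u b))\<^sup>2 \<le> (\<Sum>b\<in>S. (K * L)\<^sup>2 * (norm (tensor_coord u b))\<^sup>2)"
    if S: "finite S" "S \<subseteq> chosen_basis" for S and u :: "('g, 'h) tensor"
  proof -
    have "(norm (\<Sum>b\<in>S. ?t u b))\<^sup>2 \<le> K\<^sup>2 * (\<Sum>b\<in>S. (norm (g (tensor_coord u b)))\<^sup>2)"
      by (rule norm_sum_tensor_le[OF f K(2) S])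
    also have "\<dots> \<le> K\<^sup>2 * (\<Sum>b\<in>S. (L * norm (tensor_coord u b))\<^sup>2)"
      by (intro mult_left_mono sum_mono power_mono L norm_ge_zero) simp
    finally show ?thesis by (simp add: power_mult_distrib sum_distrib_left mult.assoc)
  qed
  have "?t u summable_on chosen_basis" for u
    by (rule summable_on_norm_square_bound[OF summable_on_cmult_right[OF tensor_coord_summable] le])
  then obtain F where F: "\<And>u. (?t u has_sum F u) chosen_basis"
    unfolding summable_on_def by metis
  have "bounded_clinear F"
  proof (rule bounded_clinearI)
    show "F (u + v) = F u + F v" for u v
      using has_sum_add[OF F[of u] F[of v]] F[of "u + v"]
      by (simp add: tensor_coord_simps bounded_clinear_simps[OF g] tensor_vec_add_right has_sum_unique)
    show "F (a *\<^sub>C u) = a *\<^sub>C F u" for a u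
      using has_sum_bounded_linear[OF bounded_linear_scaleC F[of u], of a] F[of "a *\<^sub>C u"]
      by (simp add: tensor_coord_simps bounded_clinear_simps[OF g] tensor_vec_scaleC_right has_sum_unique)
    show "norm (F u) \<le> K * L * norm u" for u
    proof (rule tendsto_upperbound[OF tendsto_norm])
      show "(sum (?t u) \<longlongrightarrow> F u) (finite_subsets_at_top chosen_basis)"
        using F[of u] by (simp add: has_sum_def)
      have "norm (\<Sum>b\<in>S. ?t u b) \<le> K * L * norm u" if S: "finite S" "S \<subseteq> chosen_basis" for S
      proof (rule power2_le_imp_le)
        have "(norm (\<Sum>b\<in>S. ?t u b))\<^sup>2 \<le> (K * L)\<^sup>2 * (\<Sum>b\<in>S. (norm (tensor_coord u b))\<^sup>2)"
          using le[OF S, of u] by (simp add: sum_distrib_left)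
        also have "\<dots> \<le> (K * L)\<^sup>2 * (norm u)\<^sup>2"
          by (intro mult_left_mono sum_tensor_coord_le S) simp
        finally show "(norm (\<Sum>b\<in>S. ?t u b))\<^sup>2 \<le> (K * L * norm u)\<^sup>2"
          by (simp add: power_mult_distrib)
      qed (use K L in simp)
      then show "\<forall>\<^sub>F S in finite_subsets_at_top chosen_basis. norm (\<Sum>b\<in>S. ?t u b) \<le> K * L * norm u"
        by (intro eventually_finite_subsets_at_top_weakI)
    qed simp
  qed
  moreover have "F (x \<otimes>\<^sub>v y) = f x \<otimes>\<^sub>v g y" for x y
  proof -
    have "bounded_linear (\<lambda>z. f z \<otimes>\<^sub>v g y)"
      by (intro bounded_clinear_bounded bounded_clinear_compose[OF bounded_clinear_tensor_left f])
    from has_sum_bounded_linear[OF this basis_expansion[of x]]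
    have "((\<lambda>b. f (cinner x b *\<^sub>C b) \<otimes>\<^sub>v g y) has_sum (f x \<otimes>\<^sub>v g y)) chosen_basis" .
    moreover have "f (cinner x b *\<^sub>C b) \<otimes>\<^sub>v g y = ?t (x \<otimes>\<^sub>v y) b" if "b \<in> chosen_basis" for b
      using that by (simp add: tensor_coord_tensor_vec bounded_clinear_simps[OF f]
          bounded_clinear_simps[OF g] tensor_vec_scaleC_left tensor_vec_scaleC_right)
    ultimately have "(?t (x \<otimes>\<^sub>v y) has_sum (f x \<otimes>\<^sub>v g y)) chosen_basis"
      by (simp cong: has_sum_cong)
    then show ?thesis using F has_sum_unique by blast
  qed
  ultimately show ?thesis by blast
qed

lemma tensor_op_eqI:
  assumes "bounded_clinear F" "\<And>x y. F (x \<otimes>\<^sub>v y) = f x \<otimes>\<^sub>v g y"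
  shows "f \<otimes>\<^sub>o g = F"
  unfolding tensor_op_def
proof (rule the_equality)
  fix G assume "bounded_clinear G \<and> (\<forall>x y. G (x \<otimes>\<^sub>v y) = f x \<otimes>\<^sub>v g y)"
  then show "G = F" using assms by (intro bounded_clinear_tensor_ext) auto
qed (use assms in auto)

lemma
  assumes "bounded_clinear f" "bounded_clinear g"
  shows bounded_clinear_tensor_op: "bounded_clinear (f \<otimes>\<^sub>o g)"
    and tensor_op_tensor_vec: "(f \<otimes>\<^sub>o g) (x \<otimes>\<^sub>v y) = f x \<otimes>\<^sub>v g y"
  using tensor_op_exists[OF assms] tensor_op_eqI[of _ f g] by auto

lemma tensor_op_comp:
  assumes "bounded_clinear f" "bounded_clinear g" "bounded_clinear f'" "bounded_clinear g'"
  shows "(f \<otimes>\<^sub>o g) ((f' \<otimes>\<^sub>o g') u) = ((f \<circ> f') \<otimes>\<^sub>o (g \<circ> g')) u"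
  by (subst tensor_op_eqI[of "\<lambda>u. (f \<otimes>\<^sub>o g) ((f' \<otimes>\<^sub>o g') u)"])
    (use assms in \<open>auto intro!: bounded_clinear_compose[OF bounded_clinear_tensor_op bounded_clinear_tensor_op]
       simp: tensor_op_tensor_vec\<close>)

lemma tensor_op_id: "(id \<otimes>\<^sub>o id) u = u"
  by (subst tensor_op_eqI[of "\<lambda>u. u"]) (auto intro: bounded_clinear_ident)

lemma adj_tensor_op:
  assumes f: "bounded_clinear f" and g: "bounded_clinear g"
  shows "adj (f \<otimes>\<^sub>o g) = adj f \<otimes>\<^sub>o adj g"
proof (rule bounded_clinear_tensor_ext)
  note fg = bounded_clinear_tensor_op[OF f g]
  show "bounded_clinear (adj (f \<otimes>\<^sub>o g))" by (rule bounded_clinear_adj[OF fg])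
  show "bounded_clinear (adj f \<otimes>\<^sub>o adj g)"
    by (intro bounded_clinear_tensor_op bounded_clinear_adj f g)
  show "adj (f \<otimes>\<^sub>o g) (x \<otimes>\<^sub>v y) = (adj f \<otimes>\<^sub>o adj g) (x \<otimes>\<^sub>v y)" for x y
    by (rule tensor_ext) (simp add: cinner_adj_left[OF fg] tensor_op_tensor_vec f g
        bounded_clinear_adj cinner_tensor_vec cinner_adj_left)
qed

lemma tensor_split_nth: "tensor_split u $ i = (id \<otimes>\<^sub>o (\<lambda>v. v $ i)) u"
  by (simp add: tensor_split_def)

lemma bounded_clinear_vec_lambda:
  assumes "\<And>i :: 'n :: finite. bounded_clinear (f i)"
  shows "bounded_clinear (\<lambda>x. \<chi> i. f i x)"
proof -
  have "(\<lambda>x. \<chi> i. f i x) = (\<lambda>x. \<Sum>i\<in>UNIV. axis i (f i x))"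
    by (auto simp: vec_eq_iff axis_def if_distrib[of "\<lambda>z. z $ _"] sum_component cong: if_cong)
  then show ?thesis
    by (auto intro!: bounded_clinear_setsum bounded_clinear_compose[OF bounded_clinear_axis] assms)
qed

lemma bounded_clinear_row:
  assumes "\<And>i. bounded_clinear (X i)" shows "bounded_clinear (row X)"
  unfolding row_def
  by (intro bounded_clinear_setsum bounded_clinear_compose[OF assms bounded_clinear_nth])

lemma bounded_clinear_tensor_split: "bounded_clinear tensor_split"
  unfolding tensor_split_def
  by (intro bounded_clinear_vec_lambda bounded_clinear_tensor_op bounded_clinear_id bounded_clinear_nth)


section \<open>Words and row contractions\<close>

lemma word_append: "word X (\<alpha> @ \<beta>) x = word X \<alpha> (word X \<beta> x)"
  by (induction \<alpha>) simp_all

lemma bounded_clinear_word: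
  assumes "\<And>i. bounded_clinear (X i)" shows "bounded_clinear (word X \<alpha>)"
proof (induction \<alpha>)
  case (Cons i \<alpha>)
  then show ?case using bounded_clinear_comp[OF assms] by (simp add: o_def)
qed (simp add: bounded_clinear_ident)

lemma adj_word:
  assumes X: "\<And>i. bounded_clinear (X i)"
  shows "adj (word X \<alpha>) = word (\<lambda>i. adj (X i)) (rev \<alpha>)"
proof (induction \<alpha>)
  case Nil
  show ?case using adj_id by (simp add: id_def)
next
  case (Cons i \<alpha>)
  have "adj (word X (i # \<alpha>)) = adj (X i \<circ> word X \<alpha>)" by simp
  also have "\<dots> = adj (word X \<alpha>) \<circ> adj (X i)" by (rule adj_comp[OF X bounded_clinear_word[OF X]])
  also have "\<dots> = word (\<lambda>i. adj (X i)) (rev (i # \<alpha>))"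
    by (simp add: Cons.IH fun_eq_iff word_append)
  finally show ?case .
qed

lemma finite_words: "finite {\<alpha> :: 'n :: finite list. length \<alpha> = k}"
  using finite_lists_length_eq[of "UNIV :: 'n set" k] by simp

lemma sum_words_0: "(\<Sum>\<alpha> | length \<alpha> = 0. f \<alpha>) = f []"
  by simp

lemma sum_words_Suc:
  "(\<Sum>\<alpha> | length \<alpha> = Suc k. f \<alpha>) = (\<Sum>i\<in>UNIV. \<Sum>\<alpha> | length \<alpha> = k. f ((i :: 'n :: finite) # \<alpha>))"
proof -
  have "{\<alpha> :: 'n list. length \<alpha> = Suc k} = (\<lambda>(i, \<alpha>). i # \<alpha>) ` (UNIV \<times> {\<alpha>. length \<alpha> = k})"
    by (auto simp: length_Suc_conv image_iff)
  moreover have "inj_on (\<lambda>(i, \<alpha>). i # \<alpha>) (UNIV \<times> {\<alpha> :: 'n list. length \<alpha> = k})"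
    by (auto simp: inj_on_def)
  ultimately show ?thesis
    by (simp add: sum.reindex sum.cartesian_product case_prod_unfold)
qed

lemma sum_words_Suc_snoc:
  fixes f :: "'n :: finite list \<Rightarrow> 'b :: comm_monoid_add"
  shows "(\<Sum>\<alpha> | length \<alpha> = Suc k. f \<alpha>) = (\<Sum>\<alpha> | length \<alpha> = k. \<Sum>i\<in>UNIV. f (\<alpha> @ [i]))"
proof -
  have "bij_betw rev {\<alpha> :: 'n list. length \<alpha> = l} {\<alpha>. length \<alpha> = l}" for l
    by (rule bij_betwI[where g = rev]) auto
  from sum.reindex_bij_betw[OF this]
  have rev: "(\<Sum>\<alpha> | length \<alpha> = l. g (rev \<alpha>)) = (\<Sum>\<alpha> | length \<alpha> = l. g \<alpha>)"
    for l and g :: "'n list \<Rightarrow> 'b" .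
  have "(\<Sum>\<alpha> | length \<alpha> = Suc k. f \<alpha>) = (\<Sum>\<alpha> | length \<alpha> = Suc k. f (rev \<alpha>))"
    by (rule rev[symmetric])
  also have "\<dots> = (\<Sum>i\<in>UNIV. \<Sum>\<alpha> | length \<alpha> = k. f (rev \<alpha> @ [i]))"
    by (simp add: sum_words_Suc)
  also have "\<dots> = (\<Sum>\<alpha> | length \<alpha> = k. \<Sum>i\<in>UNIV. f (\<alpha> @ [i]))"
    by (simp only: rev[of "\<lambda>\<alpha>. f (\<alpha> @ [i])" k for i]) (rule sum.swap)
  finally show ?thesis .
qed

lemma adj_row:
  assumes X: "\<And>i. bounded_clinear (X i)"
  shows "adj (row X) = (\<lambda>x. \<chi> i. adj (X i) x)"
  by (rule adj_eqI) (simp add: row_def cinner_vec_def cinner_sum_left cinner_adj[OF X])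

lemma closed_csubspace_closure_range:
  assumes "bounded_clinear f" shows "closed_csubspace (closure (range f))"
proof -
  have "csubspace (range f)"
  proof (rule complex_vector.subspaceI)
    show "0 \<in> range f" using rangeI[of f 0] by (simp add: bounded_clinear_0[OF assms])
    show "x + y \<in> range f" if "x \<in> range f" "y \<in> range f" for x y
      using that rangeI[of f "_ + _"] by (auto simp: bounded_clinear_add[OF assms])
    show "a *\<^sub>C x \<in> range f" if "x \<in> range f" for a x
      using that rangeI[of f "a *\<^sub>C _"] by (auto simp: bounded_clinear_scaleC[OF assms])
  qed
  then show ?thesis by (simp add: closed_csubspace_def csubspace_closure)
qed

text \<open>If \<open>x\<close> is orthogonal to the range of \<open>s\<close>, then \<open>\<langle>s x, s x\<rangle> = \<langle>x, s (s x)\<rangle> = 0\<close>.\<close>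

lemma positive_operator_kernel:
  assumes s: "positive_operator s"
  shows "orthogonal_to (closure (range s)) = {x. s x = 0}"
proof
  note sa = positive_operator_selfadjoint[OF s]
  show "orthogonal_to (closure (range s)) \<subseteq> {x. s x = 0}"
  proof
    fix x assume "x \<in> orthogonal_to (closure (range s))"
    moreover have "s (s x) \<in> closure (range s)" by (rule subsetD[OF closure_subset rangeI])
    ultimately have "cinner x (s (s x)) = 0" by (simp add: orthogonal_to_def)
    then have "cinner (s x) (s x) = 0" by (simp add: sa)
    then show "x \<in> {x. s x = 0}" by simp
  qed
  show "{x. s x = 0} \<subseteq> orthogonal_to (closure (range s))"
  proof
    fix x assume x: "x \<in> {x. s x = 0}"
    have "range s \<subseteq> orthogonal_to {x}" using x by (auto simp: orthogonal_to_def sa)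
    then have "closure (range s) \<subseteq> orthogonal_to {x}"
      by (rule closure_minimal) (rule closed_csubspaceD(6)[OF closed_csubspace_orthogonal_to])
    then show "x \<in> orthogonal_to (closure (range s))"
      by (auto simp: orthogonal_to_def cinner_eq_0_commute)
  qed
qed

locale row_contractive =
  fixes T :: "'n :: finite \<Rightarrow> 'a :: hilbert_space \<Rightarrow> 'a"
  assumes row_contraction: "row_contraction T"
begin

lemma clinear_T: "bounded_clinear (T i)"
  using row_contraction by (auto simp: row_contraction_on_def operators_def)

lemma clinear_adj_T: "bounded_clinear (adj (T i))"
  by (rule bounded_clinear_adj[OF clinear_T])

lemma clinear_row: "bounded_clinear (row T)"
  by (rule bounded_clinear_row[OF clinear_T])

lemma row_axis: "row T (axis i x) = T i x"
proof -
  have "row T (axis i x) = (\<Sum>j\<in>UNIV. if j = i then T i x else 0)"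
    unfolding row_def by (rule sum.cong) (auto simp: axis_def bounded_clinear_0[OF clinear_T])
  then show ?thesis by simp
qed

lemma positive_defect_square: "positive_operator (\<lambda>x. x - (\<Sum>i\<in>UNIV. T i (adj (T i) x)))"
  using row_contraction by (simp add: row_contraction_on_def)

lemma positive_defect: "positive_operator (defect T)"
  unfolding defect_def by (rule sqrt_operator_positive[OF positive_defect_square])

lemmas clinear_defect = positive_operatorD(1)[OF positive_defect]
  and selfadjoint_defect = positive_operator_selfadjoint[OF positive_defect]

lemma defect_defect: "defect T (defect T x) = x - (\<Sum>i\<in>UNIV. T i (adj (T i) x))"
  unfolding defect_def by (rule sqrt_operator_square[OF positive_defect_square])

lemma norm_defect: "(norm (defect T x))\<^sup>2 = (norm x)\<^sup>2 - (\<Sum>i\<in>UNIV. (norm (adj (T i) x))\<^sup>2)"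
proof -
  have "complex_of_real ((norm (defect T x))\<^sup>2) = cinner (defect T (defect T x)) x"
    by (simp only: cinner_self[symmetric] selfadjoint_defect)
  also have "\<dots> = complex_of_real ((norm x)\<^sup>2 - (\<Sum>i\<in>UNIV. (norm (adj (T i) x))\<^sup>2))"
    by (simp only: defect_defect cinner_simps cinner_adj[OF clinear_T, symmetric] cinner_self of_real_diff of_real_sum)
  finally show ?thesis unfolding of_real_eq_iff .
qed

lemma sum_norm_adj_le: "(\<Sum>i\<in>UNIV. (norm (adj (T i) x))\<^sup>2) \<le> (norm x)\<^sup>2"
  using norm_defect[of x] zero_le_power2[of "norm (defect T x)"] by linarith

lemma norm_row_le: "norm (row T v) \<le> norm v"
proof -
  have "norm (adj (row T) x) \<le> 1 * norm x" for x
    by (rule power2_le_imp_le) (simp_all add: adj_row[OF clinear_T] norm_vec_square sum_norm_adj_le)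
  then have "norm (adj (adj (row T)) v) \<le> 1 * norm v"
    by (rule norm_adj_le[OF bounded_clinear_adj[OF clinear_row]]) simp
  then show ?thesis by (simp add: adj_adj[OF clinear_row])
qed

lemma positive_defect_adj_square: "positive_operator (\<lambda>v. v - adj (row T) (row T v))"
proof (rule positive_operatorI)
  show "bounded_clinear (\<lambda>v. v - adj (row T) (row T v))"
    by (intro bounded_clinear_subtract bounded_clinear_ident
        bounded_clinear_compose[OF bounded_clinear_adj] clinear_row)
  show "cinner (x - adj (row T) (row T x)) y = cinner x (y - adj (row T) (row T y))" for x y
    by (simp add: cinner_simps cinner_adj[OF clinear_row] cinner_adj_left[OF clinear_row])
  show "0 \<le> Re (cinner (x - adj (row T) (row T x)) x)" for x
    using power_mono[OF norm_row_le[of x] norm_ge_zero, of 2]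
    by (simp add: cinner_simps cinner_adj_left[OF clinear_row] cinner_self del: of_real_power)
qed

lemma positive_defect_adj: "positive_operator (defect_adj T)"
  unfolding defect_adj_def by (rule sqrt_operator_positive[OF positive_defect_adj_square])

lemmas clinear_defect_adj = positive_operatorD(1)[OF positive_defect_adj]
  and selfadjoint_defect_adj = positive_operator_selfadjoint[OF positive_defect_adj]

lemma cinner_defect_adj: "cinner (defect_adj T v) (defect_adj T w) = cinner v w - cinner (row T v) (row T w)"
proof -
  have "defect_adj T (defect_adj T v) = v - adj (row T) (row T v)"
    unfolding defect_adj_def by (rule sqrt_operator_square[OF positive_defect_adj_square])
  then show ?thesis
    using selfadjoint_defect_adj[of "defect_adj T v" w]
    by (simp add: cinner_simps cinner_adj_left[OF clinear_row])
qed

lemma norm_defect_adj: "(norm (defect_adj T v))\<^sup>2 = (norm v)\<^sup>2 - (norm (row T v))\<^sup>2"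
  using cinner_defect_adj[of v v] unfolding cinner_self of_real_diff[symmetric] of_real_eq_iff .

lemma closed_defect_space: "closed_csubspace (defect_space T)"
  and closed_defect_adj_space: "closed_csubspace (defect_adj_space T)"
  unfolding defect_space_def defect_adj_space_def
  by (rule closed_csubspace_closure_range[OF clinear_defect],
      rule closed_csubspace_closure_range[OF clinear_defect_adj])

lemma orthogonal_defect_space: "orthogonal_to (defect_space T) = {x. defect T x = 0}"
  unfolding defect_space_def by (rule positive_operator_kernel[OF positive_defect])

lemma defect_mem: "defect T x \<in> defect_space T"
  and defect_adj_mem: "defect_adj T v \<in> defect_adj_space T"
  unfolding defect_space_def defect_adj_space_def by (rule subsetD[OF closure_subset rangeI])+

text \<open>If \<open>\<Delta>\<^sub>T x = 0\<close> then \<open>T T\<^sup>* x = x\<close>, so \<open>T\<close> is isometric on \<open>T\<^sup>* x\<close>; thus \<open>T\<^sup>*\<close> maps the kernel of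
  \<open>\<Delta>\<^sub>T\<close> into the kernel of \<open>\<Delta>\<^sub>T\<^sub>*\<close>.\<close>

lemma row_defect_adj_space: "v \<in> defect_adj_space T \<Longrightarrow> row T v \<in> defect_space T"
proof -
  assume v: "v \<in> defect_adj_space T"
  have "range (defect_adj T) \<subseteq> {v. row T v \<in> defect_space T}"
  proof clarify
    fix w
    have "cinner (row T (defect_adj T w)) x = 0" if x: "defect T x = 0" for x
    proof -
      have "row T (adj (row T) x) = x"
        using defect_defect[of x] x bounded_clinear_0[OF clinear_defect]
        by (simp add: adj_row[OF clinear_T] row_def)
      then have "complex_of_real ((norm (adj (row T) x))\<^sup>2) = complex_of_real ((norm x)\<^sup>2)"
        unfolding cinner_self[symmetric] by (simp add: cinner_adj_left[OF clinear_row])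
      then have "(norm (defect_adj T (adj (row T) x)))\<^sup>2 = 0"
        unfolding of_real_eq_iff norm_defect_adj by (simp add: \<open>row T (adj (row T) x) = x\<close>)
      then have "defect_adj T (adj (row T) x) = 0" by simp
      then show ?thesis
        by (simp add: cinner_adj[OF clinear_row, symmetric] selfadjoint_defect_adj)
    qed
    then have "row T (defect_adj T w) \<in> orthogonal_to (orthogonal_to (defect_space T))"
      unfolding orthogonal_defect_space by (simp add: orthogonal_to_def)
    then show "row T (defect_adj T w) \<in> defect_space T"
      by (simp only: orthogonal_to_orthogonal_to[OF closed_defect_space])
  qed
  then have "defect_adj_space T \<subseteq> {v. row T v \<in> defect_space T}"
    unfolding defect_adj_space_def
    by (rule closure_minimal)
      (rule closed_csubspaceD(6)[OF closed_csubspace_vimage[OF clinear_row closed_defect_space]])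
  then show ?thesis using v by blast
qed

end


section \<open>The coefficients of the characteristic function\<close>

text \<open>A row contraction stays one after tensoring with an identity, on either side: the identity
  \<open>\<Sum> X\<^sub>i X\<^sub>i\<^sup>* + R\<^sup>2 = s I\<close> is preserved, and it need only be checked on elementary tensors.\<close>

lemma sum_norm_adj_le_of_identity:
  fixes E :: "'n :: finite \<Rightarrow> ('g :: hilbert_space, 'h :: hilbert_space) tensor \<Rightarrow> ('g, 'h) tensor"
  assumes E: "\<And>i. bounded_clinear (E i)" and P: "bounded_clinear P"
    and eq: "\<And>x y. (\<Sum>i\<in>UNIV. E i (adj (E i) (x \<otimes>\<^sub>v y))) + P (adj P (x \<otimes>\<^sub>v y)) = s *\<^sub>R (x \<otimes>\<^sub>v y)"
  shows "(\<Sum>i\<in>UNIV. (norm (adj (E i) w))\<^sup>2) \<le> s * (norm w)\<^sup>2"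
proof -
  have "(\<lambda>w. (\<Sum>i\<in>UNIV. E i (adj (E i) w)) + P (adj P w)) = (\<lambda>w. s *\<^sub>R w)"
    by (rule bounded_clinear_tensor_ext)
      (intro bounded_clinear_plus bounded_clinear_setsum bounded_clinear_timesR bounded_clinear_ident
        bounded_clinear_compose[OF E bounded_clinear_adj[OF E]]
        bounded_clinear_compose[OF P bounded_clinear_adj[OF P]] eq)+
  from fun_cong[OF this, of w]
  have "cinner ((\<Sum>i\<in>UNIV. E i (adj (E i) w)) + P (adj P w)) w = cinner (s *\<^sub>R w) w" by simp
  then have "(\<Sum>i\<in>UNIV. complex_of_real ((norm (adj (E i) w))\<^sup>2)) + complex_of_real ((norm (adj P w))\<^sup>2)
      = complex_of_real (s * (norm w)\<^sup>2)"
    by (simp only: cinner_simps cinner_adj[OF E, symmetric] cinner_adj[OF P, symmetric] cinner_self of_real_mult)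
  then have "(\<Sum>i\<in>UNIV. (norm (adj (E i) w))\<^sup>2) + (norm (adj P w))\<^sup>2 = s * (norm w)\<^sup>2"
    unfolding of_real_sum[symmetric] of_real_add[symmetric] of_real_eq_iff .
  then show ?thesis using zero_le_power2[of "norm (adj P w)"] by linarith
qed

lemma positive_operator_adj: "positive_operator R \<Longrightarrow> adj R = R"
  by (rule adj_eqI) (rule positive_operator_selfadjoint)

lemma sum_norm_tensor_adj_left_le:
  fixes X :: "'n :: finite \<Rightarrow> 'g :: hilbert_space \<Rightarrow> 'g" and w :: "('g, 'h :: hilbert_space) tensor"
  assumes X: "\<And>i. bounded_clinear (X i)"
    and p: "positive_operator (\<lambda>x. s *\<^sub>R x - (\<Sum>i\<in>UNIV. X i (adj (X i) x)))"
  shows "(\<Sum>i\<in>UNIV. (norm ((adj (X i) \<otimes>\<^sub>o id) w))\<^sup>2) \<le> s * (norm w)\<^sup>2"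
proof -
  obtain R where R: "positive_operator R" "\<And>x. R (R x) = s *\<^sub>R x - (\<Sum>i\<in>UNIV. X i (adj (X i) x))"
    using positive_sqrt_exists[OF p] by (auto simp: fun_eq_iff)
  note Rl = positive_operatorD(1)[OF R(1)]
  have "(\<Sum>i\<in>UNIV. (norm (adj (X i \<otimes>\<^sub>o id) w))\<^sup>2) \<le> s * (norm w)\<^sup>2"
  proof (rule sum_norm_adj_le_of_identity[where P = "R \<otimes>\<^sub>o id"])
    fix x :: 'g and y :: 'h
    have "(\<Sum>i\<in>UNIV. (X i \<otimes>\<^sub>o id) (adj (X i \<otimes>\<^sub>o id) (x \<otimes>\<^sub>v y))) + (R \<otimes>\<^sub>o id) (adj (R \<otimes>\<^sub>o id) (x \<otimes>\<^sub>v y))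
        = ((\<Sum>i\<in>UNIV. X i (adj (X i) x)) + R (R x)) \<otimes>\<^sub>v y"
      by (simp add: tensor_op_tensor_vec adj_tensor_op adj_id positive_operator_adj[OF R(1)] X
          bounded_clinear_adj Rl bounded_clinear_id
          bounded_clinear_simps[OF bounded_clinear_tensor_left] del: R(2))
    also have "\<dots> = s *\<^sub>R (x \<otimes>\<^sub>v y)"
      by (simp add: R(2) bounded_clinear_simps[OF bounded_clinear_tensor_left])
    finally show "(\<Sum>i\<in>UNIV. (X i \<otimes>\<^sub>o id) (adj (X i \<otimes>\<^sub>o id) (x \<otimes>\<^sub>v y))) + (R \<otimes>\<^sub>o id) (adj (R \<otimes>\<^sub>o id) (x \<otimes>\<^sub>v y))
        = s *\<^sub>R (x \<otimes>\<^sub>v y)" .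
  qed (intro bounded_clinear_tensor_op X Rl bounded_clinear_id)+
  then show ?thesis by (simp add: adj_tensor_op X bounded_clinear_id adj_id)
qed

lemma (in row_contractive) sum_norm_tensor_adj_right_le:
  fixes w :: "('g :: hilbert_space, 'a) tensor"
  shows "(\<Sum>i\<in>UNIV. (norm ((id \<otimes>\<^sub>o adj (T i)) w))\<^sup>2) \<le> (norm w)\<^sup>2"
proof -
  have "(\<Sum>i\<in>UNIV. (norm (adj (id \<otimes>\<^sub>o T i) w))\<^sup>2) \<le> 1 * (norm w)\<^sup>2"
  proof (rule sum_norm_adj_le_of_identity[where P = "id \<otimes>\<^sub>o defect T"])
    fix x :: 'g and y :: 'a
    have "(\<Sum>i\<in>UNIV. (id \<otimes>\<^sub>o T i) (adj (id \<otimes>\<^sub>o T i) (x \<otimes>\<^sub>v y))) + (id \<otimes>\<^sub>o defect T) (adj (id \<otimes>\<^sub>o defect T) (x \<otimes>\<^sub>v y))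
        = x \<otimes>\<^sub>v ((\<Sum>i\<in>UNIV. T i (adj (T i) y)) + defect T (defect T y))"
      by (simp add: tensor_op_tensor_vec adj_tensor_op adj_id positive_operator_adj[OF positive_defect]
          clinear_T clinear_adj_T clinear_defect bounded_clinear_id
          bounded_clinear_simps[OF bounded_clinear_tensor_right])
    then show "(\<Sum>i\<in>UNIV. (id \<otimes>\<^sub>o T i) (adj (id \<otimes>\<^sub>o T i) (x \<otimes>\<^sub>v y))) + (id \<otimes>\<^sub>o defect T) (adj (id \<otimes>\<^sub>o defect T) (x \<otimes>\<^sub>v y))
        = 1 *\<^sub>R (x \<otimes>\<^sub>v y)"
      by (simp add: defect_defect)
  qed (intro bounded_clinear_tensor_op clinear_T clinear_defect bounded_clinear_id)+
  then show ?thesis by (simp add: adj_tensor_op clinear_T bounded_clinear_id adj_id)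
qed


text \<open>The number \<open>s\<close> is the norm of \<open>\<Sum> X\<^sub>i X\<^sub>i\<^sup>*\<close>.\<close>

lemma strict_row_contractionE:
  fixes X :: "'n :: finite \<Rightarrow> 'g :: hilbert_space \<Rightarrow> 'g"
  assumes "strict_row_contraction X"
  obtains s where "0 \<le> s" "s < 1" "positive_operator (\<lambda>x. s *\<^sub>R x - (\<Sum>i\<in>UNIV. X i (adj (X i) x)))"
proof -
  let ?g = "\<lambda>x. \<Sum>i\<in>UNIV. X i (adj (X i) x)"
  have X: "bounded_clinear (X i)" for i using assms by (simp add: strict_row_contraction_def)
  have g: "bounded_clinear ?g"
    by (intro bounded_clinear_setsum bounded_clinear_compose[OF X bounded_clinear_adj[OF X]])
  have "positive_operator (\<lambda>x. onorm ?g *\<^sub>R x - ?g x)"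
  proof (rule positive_operatorI)
    show "bounded_clinear (\<lambda>x. onorm ?g *\<^sub>R x - ?g x)"
      by (rule bounded_clinear_subtract[OF bounded_clinear_timesR[OF bounded_clinear_ident] g])
    show "cinner (onorm ?g *\<^sub>R x - ?g x) y = cinner x (onorm ?g *\<^sub>R y - ?g y)" for x y
      by (simp add: cinner_simps cinner_adj[OF X, symmetric] cinner_adj_left[OF X, symmetric])
    have "Re (cinner (?g x) x) \<le> onorm ?g * (norm x)\<^sup>2" for x
    proof -
      have "Re (cinner (?g x) x) \<le> norm (?g x) * norm x"
        using complex_Re_le_cmod norm_cinner_le by (rule order_trans)
      also have "\<dots> \<le> onorm ?g * norm x * norm x"
        by (intro mult_right_mono onorm bounded_clinear_bounded g) simp
      finally show ?thesis by (simp add: power2_eq_square mult.assoc)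
    qed
    then show "0 \<le> Re (cinner (onorm ?g *\<^sub>R x - ?g x) x)" for x
      by (simp add: cinner_diff_left cinner_scaleR_left cinner_self del: of_real_power)
  qed
  moreover have "onorm ?g < 1" using assms by (simp add: strict_row_contraction_def)
  ultimately show ?thesis using that onorm_pos_le[OF bounded_clinear_bounded[OF g]] by blast
qed

text \<open>The characteristic function is defined through an inverse function, so it is convenient to have
  the two basic properties of the operator norm for all functions with a bound.  At \<open>0\<close> the quotient
  \<open>0 / 0 = 0\<close> contributes to the supremum.\<close>

lemma
  fixes f :: "'a :: real_normed_vector \<Rightarrow> 'b :: real_normed_vector"
  assumes le: "\<And>x. norm (f x) \<le> b * norm x"
  shows onorm_nonneg_of_bound: "0 \<le> onorm f"
    and norm_le_onorm_of_bound: "norm (f x) \<le> onorm f * norm x"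
proof -
  have "norm (f x) / norm x \<le> \<bar>b\<bar>" for x
  proof (cases "x = 0")
    case False
    have "norm (f x) \<le> \<bar>b\<bar> * norm x"
      by (rule order_trans[OF le]) (simp add: mult_right_mono)
    then show ?thesis using False by (simp add: divide_le_eq)
  qed simp
  then have "bdd_above (range (\<lambda>x. norm (f x) / norm x))" by (auto intro!: bdd_aboveI)
  then have up: "norm (f x) / norm x \<le> onorm f" for x
    unfolding onorm_def by (intro cSUP_upper) auto
  show "0 \<le> onorm f" using up[of 0] by simp
  show "norm (f x) \<le> onorm f * norm x"
  proof (cases "x = 0")
    case True
    then show ?thesis using le[of 0] by simp
  next
    case False
    then show ?thesis using up[of x] by (simp add: divide_le_eq)
  qed
qed

text \<open>The coefficient at \<open>\<beta> g\<^sub>i\<close> comes from the term of the Neumann series at \<open>\<beta>\<close> and the summand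
  \<open>X\<^sub>i \<otimes> I\<close> of the row operator; \<open>word (\<lambda>i. adj (T i)) \<beta>\<close> is the adjoint of the word \<open>\<beta>\<close> reversed.\<close>

definition fourier_coeff :: "('n :: finite \<Rightarrow> 'a :: hilbert_space \<Rightarrow> 'a) \<Rightarrow> 'n list \<Rightarrow> 'a ^ 'n \<Rightarrow> 'a"
  where "fourier_coeff T \<alpha> =
    (if \<alpha> = [] then (\<lambda>v. - row T (proj (defect_adj_space T) v))
     else (\<lambda>v. defect T (word (\<lambda>i. adj (T i)) (butlast \<alpha>)
       (defect_adj T (proj (defect_adj_space T) v) $ last \<alpha>))))"

context row_contractive
begin

lemma clinear_defect_adj_proj: "bounded_clinear (\<lambda>v. defect_adj T (proj (defect_adj_space T) v))"
  by (rule bounded_clinear_compose[OF clinear_defect_adj bounded_clinear_proj[OF closed_defect_adj_space]])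

lemma clinear_adj_word: "bounded_clinear (word (\<lambda>i. adj (T i)) \<alpha>)"
  by (rule bounded_clinear_word[OF clinear_adj_T])

lemma clinear_fourier_coeff: "bounded_clinear (fourier_coeff T \<alpha>)"
proof (cases "\<alpha> = []")
  case True
  then show ?thesis
    by (simp add: fourier_coeff_def bounded_clinear_uminus
        bounded_clinear_compose[OF clinear_row bounded_clinear_proj[OF closed_defect_adj_space]])
next
  case False
  have "bounded_clinear (\<lambda>v. defect T (word (\<lambda>i. adj (T i)) (butlast \<alpha>)
       (defect_adj T (proj (defect_adj_space T) v) $ last \<alpha>)))"
    by (rule bounded_clinear_compose[OF clinear_defect], rule bounded_clinear_compose[OF clinear_adj_word],
        rule bounded_clinear_compose[OF bounded_clinear_nth clinear_defect_adj_proj])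
  then show ?thesis using False by (simp add: fourier_coeff_def)
qed

lemma fourier_coeff_operators: "fourier_coeff T \<alpha> \<in> operators (defect_adj_space T) (defect_space T)"
  unfolding operators_def
proof (intro CollectI conjI ballI subsetI)
  show "bounded_clinear (fourier_coeff T \<alpha>)" by (rule clinear_fourier_coeff)
  fix v assume "v \<in> orthogonal_to (defect_adj_space T)"
  then have "proj (defect_adj_space T) v = 0" by (simp add: proj_eq_0_iff closed_defect_adj_space)
  then show "fourier_coeff T \<alpha> v = 0"
    by (simp add: fourier_coeff_def bounded_clinear_0 clinear_row clinear_defect_adj clinear_adj_word
        clinear_defect)
next
  fix y assume "y \<in> range (fourier_coeff T \<alpha>)"
  then obtain v where y: "y = fourier_coeff T \<alpha> v" by blast
  have "row T (proj (defect_adj_space T) v) \<in> defect_space T"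
    by (rule row_defect_adj_space[OF proj_mem[OF closed_defect_adj_space]])
  then have "(-1) *\<^sub>R row T (proj (defect_adj_space T) v) \<in> defect_space T"
    by (rule closed_csubspaceD[OF closed_defect_space])
  then show "y \<in> defect_space T" using defect_mem by (simp add: y fourier_coeff_def)
qed

end

text \<open>With \<open>Y = \<Sum> X\<^sub>i \<otimes> T\<^sub>i\<^sup>*\<close> the characteristic function is
  \<open>- I \<otimes> T + (I \<otimes> \<Delta>\<^sub>T) (I - Y)\<^sup>-\<^sup>1 \<rho>\<close>, and the terms of its expansion are those of the Neumann series
  of \<open>(I - Y)\<^sup>-\<^sup>1\<close>.\<close>

locale char_evaluation = row_contractive T
  for T :: "'n :: finite \<Rightarrow> 'a :: hilbert_space \<Rightarrow> 'a" +
  fixes X :: "'n \<Rightarrow> 'g :: hilbert_space \<Rightarrow> 'g"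
  assumes strict: "strict_row_contraction X"
begin

definition Y :: "('g, 'a) tensor \<Rightarrow> ('g, 'a) tensor"
  where "Y w = (\<Sum>i\<in>UNIV. (X i \<otimes>\<^sub>o adj (T i)) w)"

definition \<rho> :: "('g, 'a ^ 'n) tensor \<Rightarrow> ('g, 'a) tensor"
  where "\<rho> u = row (\<lambda>i. X i \<otimes>\<^sub>o id)
    (tensor_split ((id \<otimes>\<^sub>o (defect_adj T \<circ> proj (defect_adj_space T))) u))"

lemma clinear_X: "bounded_clinear (X i)"
  using strict by (simp add: strict_row_contraction_def)

lemma clinear_Y: "bounded_clinear Y"
  unfolding Y_def by (intro bounded_clinear_setsum bounded_clinear_tensor_op clinear_X clinear_adj_T)

lemma clinear_\<rho>: "bounded_clinear \<rho>"
  unfolding \<rho>_def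
  by (intro bounded_clinear_compose[OF bounded_clinear_row] bounded_clinear_compose[OF bounded_clinear_tensor_split]
      bounded_clinear_tensor_op bounded_clinear_comp clinear_X bounded_clinear_id
      clinear_defect_adj bounded_clinear_proj closed_defect_adj_space)

text \<open>\<open>\<langle>Y w, z\<rangle> = \<Sum> \<langle>(I \<otimes> T\<^sub>i\<^sup>*) w, (X\<^sub>i\<^sup>* \<otimes> I) z\<rangle>\<close>, where the first column has norm at most \<open>1\<close> and the
  second at most \<open>sqrt s\<close>; take \<open>z = Y w\<close>.\<close>

lemma Y_contractive: "\<exists>r. 0 \<le> r \<and> r < 1 \<and> (\<forall>w. norm (Y w) \<le> r * norm w)"
proof -
  obtain s where s: "0 \<le> s" "s < 1"
    and p: "positive_operator (\<lambda>x. s *\<^sub>R x - (\<Sum>i\<in>UNIV. X i (adj (X i) x)))"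
    by (rule strict_row_contractionE[OF strict])
  have "norm (Y w) \<le> sqrt s * norm w" for w
  proof (cases "Y w = 0")
    case False
    define a where "a = (\<chi> i. (id \<otimes>\<^sub>o adj (T i)) w)"
    define b where "b = (\<chi> i. (adj (X i) \<otimes>\<^sub>o id) (Y w))"
    have "norm a \<le> norm w"
      by (rule power2_le_imp_le) (simp_all add: a_def norm_vec_square sum_norm_tensor_adj_right_le)
    have "norm b \<le> sqrt s * norm (Y w)"
      by (rule power2_le_imp_le)
        (use s in \<open>simp_all add: b_def norm_vec_square power_mult_distrib
          sum_norm_tensor_adj_left_le[OF clinear_X p]\<close>)
    have move: "cinner ((X i \<otimes>\<^sub>o id) u) v = cinner u ((adj (X i) \<otimes>\<^sub>o id) v)"
      for i and u v :: "('g, 'a) tensor"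
      using cinner_adj[OF bounded_clinear_tensor_op[OF clinear_X bounded_clinear_id], of u i v]
      by (simp add: adj_tensor_op clinear_X bounded_clinear_id adj_id)
    have "(X i \<otimes>\<^sub>o adj (T i)) w = (X i \<otimes>\<^sub>o id) ((id \<otimes>\<^sub>o adj (T i)) w)" for i
      by (simp add: tensor_op_comp clinear_X clinear_adj_T bounded_clinear_id)
    then have "cinner (Y w) (Y w) = (\<Sum>i\<in>UNIV. cinner ((X i \<otimes>\<^sub>o id) ((id \<otimes>\<^sub>o adj (T i)) w)) (Y w))"
      by (subst (1) Y_def) (simp add: cinner_sum_left)
    also have "\<dots> = cinner a b"
      by (simp add: a_def b_def cinner_vec_def move)
    finally have "(norm (Y w))\<^sup>2 = norm (cinner a b)"
      by (metis cinner_self norm_of_real abs_of_nonneg zero_le_power2)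
    also have "\<dots> \<le> norm a * norm b" by (rule norm_cinner_le)
    also have "\<dots> \<le> norm w * (sqrt s * norm (Y w))"
      by (intro mult_mono \<open>norm a \<le> norm w\<close> \<open>norm b \<le> _\<close>) auto
    finally have "norm (Y w) * norm (Y w) \<le> (sqrt s * norm w) * norm (Y w)"
      by (simp add: power2_eq_square mult_ac)
    then show ?thesis using False by simp
  qed (use s in simp)
  moreover have "0 \<le> sqrt s" "sqrt s < 1" using s by auto
  ultimately show ?thesis by blast
qed

text \<open>A strict contraction \<open>w \<mapsto> z + Y w\<close> has a unique fixed point, so \<open>I - Y\<close> is invertible.\<close>

lemma inv_Y: "inv (\<lambda>w. w - Y w) z - Y (inv (\<lambda>w. w - Y w) z) = z"
proof -
  obtain r where r: "0 \<le> r" "r < 1" "\<And>w. norm (Y w) \<le> r * norm w" using Y_contractive by blast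
  have "\<exists>!w. z + Y w = w" for z
    by (rule banach_fix_type[OF r(1,2)])
      (use r(3) in \<open>simp add: dist_norm bounded_clinear_diff[OF clinear_Y, symmetric]\<close>)
  then have "\<exists>w. w - Y w = z" for z by (metis add_diff_cancel_right')
  then have "surj (\<lambda>w. w - Y w)" by (metis surjI)
  then show ?thesis by (rule surj_f_inv_f)
qed

lemma clinear_funpow_Y: "bounded_clinear (Y ^^ k)"
proof (induction k)
  case (Suc k)
  then show ?case using bounded_clinear_comp[OF clinear_Y] by (simp add: o_def)
qed (simp add: bounded_clinear_ident)

lemma funpow_Y: "(Y ^^ k) w = (\<Sum>\<alpha> | length \<alpha> = k. (word X \<alpha> \<otimes>\<^sub>o word (\<lambda>i. adj (T i)) \<alpha>) w)"
proof (induction k)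
  case 0
  then show ?case using tensor_op_id[of w] by (simp add: id_def)
next
  case (Suc k)
  have "(X i \<otimes>\<^sub>o adj (T i)) ((word X \<alpha> \<otimes>\<^sub>o word (\<lambda>i. adj (T i)) \<alpha>) w)
      = (word X (i # \<alpha>) \<otimes>\<^sub>o word (\<lambda>i. adj (T i)) (i # \<alpha>)) w" for i \<alpha>
    by (simp only: word_op.simps tensor_op_comp[OF clinear_X clinear_adj_T bounded_clinear_word[OF clinear_X] clinear_adj_word])
  then show ?case
    by (simp only: funpow.simps o_apply Suc sum_words_Suc) (simp add: Y_def bounded_clinear_sum
        bounded_clinear_tensor_op clinear_X clinear_adj_T)
qed

lemma \<rho>_sum: "\<rho> u = (\<Sum>i\<in>UNIV. (X i \<otimes>\<^sub>o (\<lambda>v. defect_adj T (proj (defect_adj_space T) v) $ i)) u)"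
proof -
  let ?D = "defect_adj T \<circ> proj (defect_adj_space T)"
  have D: "bounded_clinear ?D" using clinear_defect_adj_proj by (simp add: o_def)
  have "(X i \<otimes>\<^sub>o id) (tensor_split ((id \<otimes>\<^sub>o ?D) u) $ i)
      = (X i \<otimes>\<^sub>o (\<lambda>v. defect_adj T (proj (defect_adj_space T) v) $ i)) u" for i
    by (simp add: tensor_split_nth tensor_op_comp clinear_X bounded_clinear_id bounded_clinear_nth D
        bounded_clinear_comp) (simp add: o_def)
  then show ?thesis unfolding \<rho>_def row_def by simp
qed

lemma char_fun_eq:
  "char_fun T X u = - (id \<otimes>\<^sub>o (row T \<circ> proj (defect_adj_space T))) u
    + (id \<otimes>\<^sub>o defect T) (inv (\<lambda>w. w - Y w) (\<rho> u))"
  unfolding char_fun_def Y_def \<rho>_def ..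

lemma fourier_partial_sum:
  "(\<Sum>k<Suc N. \<Sum>\<alpha> | length \<alpha> = k. (word X \<alpha> \<otimes>\<^sub>o fourier_coeff T \<alpha>) u)
    = - (id \<otimes>\<^sub>o (row T \<circ> proj (defect_adj_space T))) u
      + (id \<otimes>\<^sub>o defect T) (\<Sum>k<N. (Y ^^ k) (\<rho> u))"
proof -
  have R: "bounded_clinear (row T \<circ> proj (defect_adj_space T))"
    by (intro bounded_clinear_comp clinear_row bounded_clinear_proj closed_defect_adj_space)
  have "word X [] \<otimes>\<^sub>o fourier_coeff T [] = (\<lambda>u. - (id \<otimes>\<^sub>o (row T \<circ> proj (defect_adj_space T))) u)"
    by (rule tensor_op_eqI)
      (simp_all add: bounded_clinear_uminus bounded_clinear_tensor_op bounded_clinear_id R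
        tensor_op_tensor_vec fourier_coeff_def bounded_clinear_minus[OF bounded_clinear_tensor_right])
  then have zero: "(word X [] \<otimes>\<^sub>o fourier_coeff T []) u = - (id \<otimes>\<^sub>o (row T \<circ> proj (defect_adj_space T))) u"
    by (rule fun_cong)
  let ?d = "\<lambda>i v. defect_adj T (proj (defect_adj_space T) v) $ i"
  have d: "bounded_clinear (?d i)" for i
    by (rule bounded_clinear_compose[OF bounded_clinear_nth clinear_defect_adj_proj])
  have "(id \<otimes>\<^sub>o defect T) ((word X \<alpha> \<otimes>\<^sub>o word (\<lambda>i. adj (T i)) \<alpha>) ((X i \<otimes>\<^sub>o ?d i) u))
      = (word X (\<alpha> @ [i]) \<otimes>\<^sub>o fourier_coeff T (\<alpha> @ [i])) u" for \<alpha> i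
  proof -
    have "word X (\<alpha> @ [i]) = id \<circ> (word X \<alpha> \<circ> X i)" by (simp add: fun_eq_iff word_append)
    moreover have "fourier_coeff T (\<alpha> @ [i]) = defect T \<circ> (word (\<lambda>i. adj (T i)) \<alpha> \<circ> ?d i)"
      by (simp add: fun_eq_iff fourier_coeff_def)
    ultimately show ?thesis
      by (simp only: tensor_op_comp bounded_clinear_comp bounded_clinear_word clinear_X clinear_adj_T d
          clinear_defect bounded_clinear_id)
  qed
  then have "(\<Sum>\<alpha> | length \<alpha> = Suc k. (word X \<alpha> \<otimes>\<^sub>o fourier_coeff T \<alpha>) u)
      = (id \<otimes>\<^sub>o defect T) ((Y ^^ k) (\<rho> u))" for k
    by (simp only: sum_words_Suc_snoc funpow_Y \<rho>_sum bounded_clinear_sum bounded_clinear_tensor_op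
        bounded_clinear_id clinear_defect bounded_clinear_word clinear_X clinear_adj_T)
  then show ?thesis
    by (simp only: sum.lessThan_Suc_shift sum_words_0 zero
        bounded_clinear_sum[OF bounded_clinear_tensor_op[OF bounded_clinear_id clinear_defect]])
qed

text \<open>\<open>w = (I - Y)\<^sup>-\<^sup>1 \<rho> u\<close> solves \<open>w = \<rho> u + Y w\<close>; substituting this equation into itself \<open>N\<close> times
  splits off the first \<open>N\<close> terms of the Neumann series.\<close>

lemma fourier_remainder:
  "char_fun T X u - (\<Sum>k<Suc N. \<Sum>\<alpha> | length \<alpha> = k. (word X \<alpha> \<otimes>\<^sub>o fourier_coeff T \<alpha>) u)
    = (id \<otimes>\<^sub>o defect T) ((Y ^^ N) (inv (\<lambda>w. w - Y w) (\<rho> u)))"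
proof -
  define w where "w = inv (\<lambda>w. w - Y w) (\<rho> u)"
  have fix_w: "w = \<rho> u + Y w" using inv_Y[of "\<rho> u"] by (simp add: w_def algebra_simps)
  have "w = (\<Sum>k<N. (Y ^^ k) (\<rho> u)) + (Y ^^ N) w" for N
  proof (induction N)
    case (Suc N)
    have "(Y ^^ N) w = (Y ^^ N) (\<rho> u) + (Y ^^ N) (Y w)"
      by (subst fix_w) (rule bounded_clinear_add[OF clinear_funpow_Y])
    also have "(Y ^^ N) (Y w) = (Y ^^ Suc N) w" by (simp add: funpow_swap1)
    finally have "(\<Sum>k<N. (Y ^^ k) (\<rho> u)) + ((Y ^^ N) (\<rho> u) + (Y ^^ Suc N) w) = w"
      using Suc by metis
    then show ?case by (simp only: sum.lessThan_Suc add.assoc)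
  qed simp
  from this[of N] have "w - (\<Sum>k<N. (Y ^^ k) (\<rho> u)) = (Y ^^ N) w" by (metis add_diff_cancel_left')
  then show ?thesis
    unfolding char_fun_eq fourier_partial_sum w_def[symmetric]
    by (simp add: bounded_clinear_diff[OF bounded_clinear_tensor_op[OF bounded_clinear_id clinear_defect], symmetric])
qed

lemma fourier_remainder_bound:
  obtains C r where "0 \<le> r" "r < 1"
    "\<And>N u. norm (char_fun T X u - (\<Sum>k<Suc N. \<Sum>\<alpha> | length \<alpha> = k. (word X \<alpha> \<otimes>\<^sub>o fourier_coeff T \<alpha>) u))
      \<le> C * r ^ N * norm u"
proof -
  obtain r where r: "0 \<le> r" "r < 1" "\<And>w. norm (Y w) \<le> r * norm w" using Y_contractive by blast
  obtain K where K: "K > 0" "\<And>x. norm ((id \<otimes>\<^sub>o defect T) x :: ('g, 'a) tensor) \<le> K * norm x"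
    using bounded_clinear_normE[OF bounded_clinear_tensor_op[OF bounded_clinear_id clinear_defect]] by metis
  obtain L where L: "L > 0" "\<And>u. norm (\<rho> u) \<le> L * norm u"
    using bounded_clinear_normE[OF clinear_\<rho>] by metis
  have pow: "norm ((Y ^^ N) w) \<le> r ^ N * norm w" for N w
  proof (induction N)
    case (Suc N)
    have "norm (Y ((Y ^^ N) w)) \<le> r * (r ^ N * norm w)"
      by (rule order_trans[OF r(3) mult_left_mono[OF Suc r(1)]])
    then show ?case by (simp add: mult.assoc)
  qed simp
  have inv: "norm (inv (\<lambda>w. w - Y w) z) \<le> norm z / (1 - r)" for z
  proof -
    define w where "w = inv (\<lambda>w. w - Y w) z"
    have "w - Y w = z" unfolding w_def by (rule inv_Y)
    then have "norm w \<le> norm z + norm (Y w)" by (metis diff_add_cancel norm_triangle_ineq)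
    then have "(1 - r) * norm w \<le> norm z" using r(3)[of w] by (simp add: algebra_simps)
    then show ?thesis using r(2) by (simp add: w_def pos_le_divide_eq mult.commute)
  qed
  show ?thesis
  proof (rule that[OF r(1,2)])
    fix N and u :: "('g, 'a ^ 'n) tensor"
    have "norm ((id \<otimes>\<^sub>o defect T) ((Y ^^ N) (inv (\<lambda>w. w - Y w) (\<rho> u)))) 
        \<le> K * (r ^ N * (L * norm u / (1 - r)))"
    proof (rule order_trans[OF K(2) mult_left_mono[OF order_trans[OF pow mult_left_mono]]])
      show "norm (inv (\<lambda>w. w - Y w) (\<rho> u)) \<le> L * norm u / (1 - r)"
        by (rule order_trans[OF inv divide_right_mono[OF L(2)]]) (use r in simp)
    qed (use r K in auto)
    then show "norm (char_fun T X u - (\<Sum>k<Suc N. \<Sum>\<alpha> | length \<alpha> = k. (word X \<alpha> \<otimes>\<^sub>o fourier_coeff T \<alpha>) u))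
        \<le> (K * L / (1 - r)) * r ^ N * norm u"
      unfolding fourier_remainder by (simp add: field_simps)
  qed
qed

text \<open>With this bound, convergence of any expansion in the operator norm implies pointwise convergence.\<close>

lemma char_fun_bounded: "\<exists>C. \<forall>u. norm (char_fun T X u) \<le> C * norm u"
proof -
  define S where "S u = (\<Sum>k<Suc 0. \<Sum>\<alpha> | length \<alpha> = k. (word X \<alpha> \<otimes>\<^sub>o fourier_coeff T \<alpha>) u)" for u
  have S: "bounded_clinear S"
    unfolding S_def
    by (rule bounded_clinear_setsum, rule bounded_clinear_setsum, rule bounded_clinear_tensor_op,
        rule bounded_clinear_word, rule clinear_X, rule clinear_fourier_coeff)
  obtain K where K: "\<And>u. norm (S u) \<le> K * norm u"
    by (rule bounded_clinear_normE[OF S]) (rule that; assumption)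
  obtain C r where C: "\<And>N u. norm (char_fun T X u
      - (\<Sum>k<Suc N. \<Sum>\<alpha> | length \<alpha> = k. (word X \<alpha> \<otimes>\<^sub>o fourier_coeff T \<alpha>) u))
        \<le> C * r ^ N * norm u"
    by (rule fourier_remainder_bound) (rule that; assumption)
  have "norm (char_fun T X u) \<le> (K + C) * norm u" for u
  proof -
    have "norm (char_fun T X u) \<le> norm (S u) + norm (char_fun T X u - S u)"
      by (rule norm_triangle_sub)
    also have "\<dots> \<le> K * norm u + C * r ^ 0 * norm u"
      by (rule add_mono[OF K]) (unfold S_def, rule C)
    finally show ?thesis by (simp add: distrib_right)
  qed
  then show ?thesis by blast
qed

end

lemma (in row_contractive) char_expansion_fourier_coeff:
  "char_expansion TYPE('g :: hilbert_space) T (fourier_coeff T)"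
  unfolding char_expansion_def
proof (intro conjI allI impI)
  show "fourier_coeff T \<alpha> \<in> operators (defect_adj_space T) (defect_space T)" for \<alpha>
    by (rule fourier_coeff_operators)
  fix X :: "'n \<Rightarrow> 'g \<Rightarrow> 'g" assume "strict_row_contraction X"
  then interpret char_evaluation T X by unfold_locales
  let ?D = "\<lambda>N u. char_fun T X u - (\<Sum>k<N. \<Sum>\<alpha> | length \<alpha> = k. (word X \<alpha> \<otimes>\<^sub>o fourier_coeff T \<alpha>) u)"
  obtain C r where r: "0 \<le> r" "r < 1" and D: "\<And>N u. norm (?D (Suc N) u) \<le> C * r ^ N * norm u"
    by (rule fourier_remainder_bound) (rule that; assumption)
  have "(\<lambda>N. onorm (?D (Suc N))) \<longlonglongrightarrow> 0"
  proof (rule tendsto_sandwich)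
    have D': "norm (?D (Suc N) u) \<le> \<bar>C\<bar> * r ^ N * norm u" for N u
    proof -
      have "C * r ^ N * norm u \<le> \<bar>C\<bar> * r ^ N * norm u"
        by (intro mult_right_mono) (use r in auto)
      with D[where N = N and u = u] show ?thesis by (rule order_trans)
    qed
    have "0 \<le> onorm (?D (Suc N))" for N by (rule onorm_nonneg_of_bound) (rule D)
    then show "\<forall>\<^sub>F N in sequentially. 0 \<le> onorm (?D (Suc N))" by (rule always_eventually[OF allI])
    have "onorm (?D (Suc N)) \<le> \<bar>C\<bar> * r ^ N" for N
      by (rule onorm_bound[OF _ D']) (use r in simp)
    then show "\<forall>\<^sub>F N in sequentially. onorm (?D (Suc N)) \<le> \<bar>C\<bar> * r ^ N"
      by (rule always_eventually[OF allI])
    show "(\<lambda>N. \<bar>C\<bar> * r ^ N) \<longlonglongrightarrow> 0"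
      using tendsto_mult_right_zero[OF LIMSEQ_power_zero, of r "\<bar>C\<bar>"] r by simp
  qed simp
  then show "(\<lambda>N. onorm (?D N)) \<longlonglongrightarrow> 0" by (rule LIMSEQ_imp_Suc)
qed


subsection \<open>Uniqueness of the coefficients\<close>

text \<open>The left creation operator \<open>e\<^sub>\<gamma> \<mapsto> e\<^sub>i \<otimes> e\<^sub>\<gamma>\<close>, in coordinates.\<close>

definition creation :: "'n \<Rightarrow> 'n fock \<Rightarrow> 'n fock"
  where "creation i u = Abs_l2 (\<lambda>\<beta>. case \<beta> of [] \<Rightarrow> 0 | j # \<gamma> \<Rightarrow> if j = i then l2_coord u \<gamma> else 0)"

lemma
  shows l2_coord_creation:
    "l2_coord (creation i u) \<beta> = (case \<beta> of [] \<Rightarrow> 0 | j # \<gamma> \<Rightarrow> if j = i then l2_coord u \<gamma> else 0)"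
    and norm_creation: "norm (creation i u) = norm u"
proof -
  let ?f = "\<lambda>\<beta>. case \<beta> of [] \<Rightarrow> 0 | j # \<gamma> \<Rightarrow> if j = i then l2_coord u \<gamma> else 0"
  have inj: "inj_on ((#) i) UNIV" by (simp add: inj_on_def)
  have outside: "?f \<beta> = 0" if "\<beta> \<notin> range ((#) i)" for \<beta>
    using that by (auto split: list.split)
  have "(\<lambda>\<gamma>. (norm (l2_coord u \<gamma>))\<^sup>2) summable_on UNIV"
    using square_summable_coord[of u] by (simp add: square_summable_def)
  then have "(\<lambda>\<beta>. (norm (?f \<beta>))\<^sup>2) summable_on range ((#) i)"
    by (subst summable_on_reindex[OF inj]) (simp add: o_def)
  then have "(\<lambda>\<beta>. (norm (?f \<beta>))\<^sup>2) summable_on UNIV"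
    by (rule summable_on_cong_neutral[THEN iffD1, rotated -1]) (use outside in auto)
  then have "square_summable ?f" by (simp only: square_summable_def)
  then have coord: "l2_coord (creation i u) = ?f" unfolding creation_def by (rule coord_Abs)
  then show "l2_coord (creation i u) \<beta> = ?f \<beta>" by simp
  have "(norm (creation i u))\<^sup>2 = (\<Sum>\<^sub>\<infinity>\<beta>\<in>range ((#) i). (norm (?f \<beta>))\<^sup>2)"
    unfolding norm_l2_square coord by (rule infsum_cong_neutral) (use outside in auto)
  also have "\<dots> = (norm u)\<^sup>2"
    by (subst infsum_reindex[OF inj]) (simp add: o_def norm_l2_square)
  finally show "norm (creation i u) = norm u" by simp
qed

lemma bounded_clinear_creation: "bounded_clinear (creation i)"
  by (rule bounded_clinearI[where K = 1])
    (auto simp: norm_creation l2_coord_creation l2_coord_simps l2_coord_scaleC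
      intro!: l2_eqI split: list.split)

lemma l2_coord_fock_basis: "l2_coord (fock_basis \<alpha>) \<beta> = (if \<beta> = \<alpha> then 1 else 0)"
proof -
  let ?f = "\<lambda>\<beta>. if \<beta> = \<alpha> then 1 else 0 :: complex"
  have "(\<lambda>\<beta>. (norm (?f \<beta>))\<^sup>2) summable_on {\<alpha>}" by (rule summable_on_finite) simp
  then have "(\<lambda>\<beta>. (norm (?f \<beta>))\<^sup>2) summable_on UNIV"
    by (rule summable_on_cong_neutral[THEN iffD1, rotated -1]) auto
  then have "l2_coord (Abs_l2 ?f) = ?f" by (intro coord_Abs) (simp only: square_summable_def)
  then show ?thesis by (simp add: fock_basis_def)
qed

lemma cinner_fock_basis: "cinner (fock_basis \<alpha>) (fock_basis \<beta>) = (if \<alpha> = \<beta> then 1 else 0)"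
proof -
  have "cinner (fock_basis \<alpha>) (fock_basis \<beta>) = (\<Sum>\<^sub>\<infinity>\<gamma>\<in>{\<alpha>}. if \<alpha> = \<beta> then 1 else 0)"
    unfolding cinner_l2_def
    by (rule infsum_cong_neutral) (auto simp: l2_coord_fock_basis cinner_complex_def)
  then show ?thesis by simp
qed

lemma creation_fock_basis: "creation i (fock_basis \<alpha>) = fock_basis (i # \<alpha>)"
  by (rule l2_eqI) (auto simp: l2_coord_creation l2_coord_fock_basis split: list.split)

text \<open>With \<open>c = 1 / (2 n)\<close> every \<open>X\<^sub>i\<close> below has norm at most \<open>c\<close>, so that the norm of \<open>\<Sum> X\<^sub>i X\<^sub>i\<^sup>*\<close> is at
  most \<open>n c\<^sup>2 = 1 / (4 n) < 1\<close>.\<close>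

definition creation_scale :: "'n :: finite itself \<Rightarrow> real"
  where "creation_scale _ = 1 / (2 * real CARD('n))"

definition scaled_creation :: "'n :: finite \<Rightarrow> 'n fock \<Rightarrow> 'n fock"
  where "scaled_creation i u = creation_scale TYPE('n) *\<^sub>R creation i u"

lemma creation_scale_pos: "0 < creation_scale TYPE('n :: finite)"
  by (simp add: creation_scale_def)

lemma clinear_scaled_creation: "bounded_clinear (scaled_creation i)"
  unfolding scaled_creation_def[abs_def] by (intro bounded_clinear_timesR bounded_clinear_creation)

lemma strict_scaled_creation: "strict_row_contraction (scaled_creation :: 'n :: finite \<Rightarrow> _)"
  unfolding strict_row_contraction_def
proof (intro conjI allI)
  let ?c = "creation_scale TYPE('n)"
  show "bounded_clinear (scaled_creation i)" for i :: 'n by (rule clinear_scaled_creation)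
  have X: "norm (scaled_creation i u) \<le> ?c * norm u" for i :: 'n and u
    using creation_scale_pos[where 'n = 'n] by (simp add: scaled_creation_def norm_creation)
  have aX: "norm (adj (scaled_creation i) u) \<le> ?c * norm u" for i :: 'n and u
    by (rule norm_adj_le[OF clinear_scaled_creation X less_imp_le[OF creation_scale_pos]])
  have "onorm (\<lambda>x. \<Sum>i\<in>UNIV. scaled_creation (i :: 'n) (adj (scaled_creation i) x))
      \<le> real CARD('n) * (?c * ?c)"
  proof (rule onorm_bound)
    show "norm (\<Sum>i\<in>UNIV. scaled_creation (i :: 'n) (adj (scaled_creation i) x))
        \<le> real CARD('n) * (?c * ?c) * norm x" for x
    proof -
      have "norm (scaled_creation (i :: 'n) (adj (scaled_creation i) x)) \<le> ?c * (?c * norm x)" for i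
        by (rule order_trans[OF X mult_left_mono[OF aX less_imp_le[OF creation_scale_pos]]])
      then have "norm (\<Sum>i\<in>UNIV. scaled_creation (i :: 'n) (adj (scaled_creation i) x))
          \<le> (\<Sum>i\<in>(UNIV :: 'n set). ?c * (?c * norm x))"
        by (intro sum_norm_le)
      then show ?thesis by (simp add: mult.assoc)
    qed
  qed simp
  also have "\<dots> < 1"
  proof -
    have "1 \<le> real CARD('n)" by (simp add: Suc_le_eq)
    then have "1 < real CARD('n) * 4" by linarith
    then show ?thesis by (simp add: creation_scale_def field_simps)
  qed
  finally show "onorm (\<lambda>x. \<Sum>i\<in>UNIV. scaled_creation (i :: 'n) (adj (scaled_creation i) x)) < 1" .
qed

lemma word_scaled_creation:
  fixes \<alpha> :: "'n :: finite list"
  shows "word scaled_creation \<alpha> (fock_basis []) = creation_scale TYPE('n) ^ length \<alpha> *\<^sub>R fock_basis \<alpha>"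
  by (induction \<alpha>)
    (simp_all add: scaled_creation_def creation_fock_basis bounded_clinear_scaleR[OF bounded_clinear_creation])

text \<open>The word \<open>\<beta>\<close> in the creation operators maps the vacuum vector to \<open>e\<^sub>\<beta>\<close>, so pairing with
  \<open>e\<^sub>\<alpha> \<otimes> y\<close> isolates the coefficient at \<open>\<alpha>\<close>.\<close>

lemma cinner_partial_sum_scaled_creation:
  fixes A :: "'n :: finite list \<Rightarrow> 'k :: hilbert_space \<Rightarrow> 'h :: hilbert_space"
  assumes A: "\<And>\<alpha>. bounded_clinear (A \<alpha>)" and N: "length \<alpha> < N"
  shows "cinner (\<Sum>k<N. \<Sum>\<beta> | length \<beta> = k. (word scaled_creation \<beta> \<otimes>\<^sub>o A \<beta>) (fock_basis [] \<otimes>\<^sub>v h))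
      (fock_basis \<alpha> \<otimes>\<^sub>v y) = creation_scale TYPE('n) ^ length \<alpha> * cinner (A \<alpha> h) y"
proof -
  let ?t = "complex_of_real (creation_scale TYPE('n) ^ length \<alpha>) * cinner (A \<alpha> h) y"
  have "cinner ((word scaled_creation \<beta> \<otimes>\<^sub>o A \<beta>) (fock_basis [] \<otimes>\<^sub>v h)) (fock_basis \<alpha> \<otimes>\<^sub>v y)
      = (if \<beta> = \<alpha> then ?t else 0)" for \<beta>
    by (simp add: tensor_op_tensor_vec bounded_clinear_word clinear_scaled_creation A cinner_tensor_vec
        word_scaled_creation cinner_scaleR_left cinner_fock_basis)
  then have "cinner (\<Sum>k<N. \<Sum>\<beta> | length \<beta> = k. (word scaled_creation \<beta> \<otimes>\<^sub>o A \<beta>) (fock_basis [] \<otimes>\<^sub>v h))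
      (fock_basis \<alpha> \<otimes>\<^sub>v y) = (\<Sum>k<N. \<Sum>\<beta> | length \<beta> = k. if \<beta> = \<alpha> then ?t else 0)"
    by (simp only: cinner_sum_left)
  also have "\<dots> = (\<Sum>k<N. if k = length \<alpha> then ?t else 0)"
    by (intro sum.cong refl) (auto simp: sum.delta' sum.delta finite_words)
  also have "\<dots> = ?t" using N by simp
  finally show ?thesis by simp
qed

text \<open>The partial sums of two expansions have the same limit, so by the preceding lemma they have the
  same coefficients.\<close>

lemma (in row_contractive) char_coeff_eq: "char_coeff T = fourier_coeff T"
  unfolding char_coeff_def
proof (rule the_equality)
  show "char_expansion TYPE('n fock) T (fourier_coeff T)" by (rule char_expansion_fourier_coeff)
  fix A assume A: "char_expansion TYPE('n fock) T A"
  let ?X = "scaled_creation :: 'n \<Rightarrow> 'n fock \<Rightarrow> 'n fock"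
  let ?S = "\<lambda>A N u. \<Sum>k<N. \<Sum>\<alpha> | length \<alpha> = k. (word ?X \<alpha> \<otimes>\<^sub>o A \<alpha>) u"
  let ?D = "\<lambda>A N u. char_fun T ?X u - ?S A N u"
  interpret char_evaluation T ?X by unfold_locales (rule strict_scaled_creation)
  obtain C where C: "\<And>u. norm (char_fun T ?X u) \<le> C * norm u" using char_fun_bounded by blast
  have bound: "norm (?D B N u) \<le> onorm (?D B N) * norm u" if B: "\<And>\<alpha>. bounded_clinear (B \<alpha>)" for B N u
  proof -
    have S: "bounded_clinear (?S B N)"
      by (intro bounded_clinear_setsum bounded_clinear_tensor_op bounded_clinear_word
          clinear_scaled_creation B)
    obtain K where K: "\<And>u. norm (?S B N u) \<le> K * norm u"
      by (rule bounded_clinear_normE[OF S]) (rule that; assumption)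
    have "norm (?D B N u) \<le> (C + K) * norm u" for u
      using norm_triangle_ineq4[of "char_fun T ?X u" "?S B N u"] C[of u] K[of u]
      by (simp add: distrib_right)
    then show ?thesis by (rule norm_le_onorm_of_bound)
  qed
  have lA: "bounded_clinear (A \<alpha>)" for \<alpha>
    using A by (auto simp: char_expansion_def operators_def)
  have limA: "(\<lambda>N. onorm (?D A N)) \<longlonglongrightarrow> 0"
    using A strict_scaled_creation unfolding char_expansion_def by blast
  have limF: "(\<lambda>N. onorm (?D (fourier_coeff T) N)) \<longlonglongrightarrow> 0"
    using char_expansion_fourier_coeff[where 'g = "'n fock"] strict_scaled_creation
    unfolding char_expansion_def by blast
  show "A = fourier_coeff T"
  proof (rule ext, rule ext, rule cinner_ext)
    fix \<alpha> :: "'n list" and h :: "'a ^ 'n" and y :: 'a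
    define c where "c = creation_scale TYPE('n) ^ length \<alpha>"
    define u where "u = fock_basis ([] :: 'n list) \<otimes>\<^sub>v h"
    define z where "z = fock_basis \<alpha> \<otimes>\<^sub>v y"
    let ?e = "cinner (A \<alpha> h) y - cinner (fourier_coeff T \<alpha> h) y"
    have le: "norm (c * ?e) \<le> (onorm (?D (fourier_coeff T) N) * norm u + onorm (?D A N) * norm u) * norm z"
      if N: "length \<alpha> < N" for N
    proof -
      have "c * ?e = cinner (?S A N u) z - cinner (?S (fourier_coeff T) N u) z"
        unfolding u_def z_def c_def
        by (simp only: cinner_partial_sum_scaled_creation[OF lA N]
            cinner_partial_sum_scaled_creation[OF clinear_fourier_coeff N] right_diff_distrib)
      also have "\<dots> = cinner (?D (fourier_coeff T) N u - ?D A N u) z"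
        by (simp only: cinner_diff_left)  simp
      finally have "norm (c * ?e) \<le> norm (?D (fourier_coeff T) N u - ?D A N u) * norm z"
        by (simp only: norm_cinner_le)
      also have "\<dots> \<le> (norm (?D (fourier_coeff T) N u) + norm (?D A N u)) * norm z"
        by (intro mult_right_mono norm_triangle_ineq4 norm_ge_zero)
      also have "\<dots> \<le> (onorm (?D (fourier_coeff T) N) * norm u + onorm (?D A N) * norm u) * norm z"
        by (intro mult_right_mono add_mono bound lA clinear_fourier_coeff norm_ge_zero)
      finally show ?thesis .
    qed
    have "(\<lambda>N. (onorm (?D (fourier_coeff T) N) * norm u + onorm (?D A N) * norm u) * norm z)
        \<longlonglongrightarrow> (0 * norm u + 0 * norm u) * norm z"
      by (intro tendsto_intros limA limF)
    then have "norm (c * ?e) \<le> (0 * norm u + 0 * norm u) * norm z"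
      by (rule LIMSEQ_le_const) (use le in \<open>auto intro!: exI[of _ "Suc (length \<alpha>)"]\<close>)
    then have "c * ?e = 0" by simp
    moreover have "c \<noteq> 0" using creation_scale_pos[where 'n = 'n] by (simp add: c_def)
    ultimately show "cinner (A \<alpha> h) y = cinner (fourier_coeff T \<alpha> h) y" by simp
  qed
qed


section \<open>The degree of the characteristic function\<close>

context row_contractive
begin

definition degree_le :: "nat \<Rightarrow> bool"
  where "degree_le m \<longleftrightarrow> (\<forall>\<alpha>. m < length \<alpha> \<longrightarrow> char_coeff T \<alpha> = (\<lambda>_. 0))"

lemma char_polynomial_iff: "char_polynomial T \<longleftrightarrow> (\<exists>m. degree_le m)"
proof
  assume fin: "char_polynomial T"
  have "length \<alpha> \<le> Max (length ` char_support T)" if "\<alpha> \<in> char_support T" for \<alpha>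
    using fin that by (simp add: char_polynomial_def)
  then have "degree_le (Max (length ` char_support T))"
    unfolding degree_le_def char_support_def by fastforce
  then show "\<exists>m. degree_le m" by blast
next
  assume "\<exists>m. degree_le m"
  then obtain m where m: "degree_le m" by blast
  have "char_support T \<subseteq> {\<alpha>. set \<alpha> \<subseteq> UNIV \<and> length \<alpha> \<le> m}"
    using m by (auto simp: char_support_def degree_le_def not_less[symmetric])
  moreover have "finite {\<alpha> :: 'n list. set \<alpha> \<subseteq> UNIV \<and> length \<alpha> \<le> m}"
    by (rule finite_lists_length_le) simp
  ultimately show "char_polynomial T"
    unfolding char_polynomial_def by (rule finite_subset)
qed

lemma char_degree_eq_iff:
  "char_polynomial T \<and> char_degree T = enat m \<longleftrightarrow> degree_le m \<and> (\<forall>k. degree_le k \<longrightarrow> m \<le> k)"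
proof (cases "char_polynomial T")
  case True
  define d where "d = Max (insert 0 (length ` char_support T))"
  have fin: "finite (insert 0 (length ` char_support T))" using True by (simp add: char_polynomial_def)
  have "degree_le k \<longleftrightarrow> (\<forall>\<alpha>\<in>char_support T. length \<alpha> \<le> k)" for k
    by (auto simp: degree_le_def char_support_def not_less[symmetric])
  then have "degree_le k \<longleftrightarrow> d \<le> k" for k
    unfolding d_def using fin by (simp add: Max_le_iff)
  moreover have "char_degree T = enat d" using True by (simp add: char_degree_def d_def)
  ultimately show ?thesis using True by (auto intro: order_antisym)
next
  case False
  then show ?thesis using char_polynomial_iff by blast
qed

text \<open>The right-hand side is the vanishing of the adjoint of the coefficient.\<close>

lemma fourier_coeff_snoc_eq_0_iff:
  "fourier_coeff T (\<beta> @ [i]) = (\<lambda>_. 0) \<longleftrightarrow>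
    (\<forall>h. defect_adj T (axis i (word T (rev \<beta>) (defect T h))) = 0)"
proof -
  have "word (\<lambda>i. adj (T i)) \<beta> = adj (word T (rev \<beta>))" by (simp add: adj_word clinear_T)
  then have c: "cinner (fourier_coeff T (\<beta> @ [i]) v) h
      = cinner v (defect_adj T (axis i (word T (rev \<beta>) (defect T h))))" for v h
    by (simp add: fourier_coeff_def selfadjoint_defect cinner_axis_right[symmetric]
        cinner_adj_left bounded_clinear_word clinear_T selfadjoint_defect_adj
        cinner_proj_member[OF closed_defect_adj_space defect_adj_mem])
  show ?thesis
  proof
    assume z: "fourier_coeff T (\<beta> @ [i]) = (\<lambda>_. 0)"
    then show "\<forall>h. defect_adj T (axis i (word T (rev \<beta>) (defect T h))) = 0"
      using c by (metis cinner_self_eq_0 cinner_zero_left)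
  next
    assume "\<forall>h. defect_adj T (axis i (word T (rev \<beta>) (defect T h))) = 0"
    then have "cinner (fourier_coeff T (\<beta> @ [i]) v) h = cinner 0 h" for v h by (simp add: c)
    then show "fourier_coeff T (\<beta> @ [i]) = (\<lambda>_. 0)" by (intro ext) (rule cinner_ext)
  qed
qed

text \<open>The reversal of words disappears, as it permutes the words of each length.\<close>

lemma degree_le_iff:
  "degree_le m \<longleftrightarrow> (\<forall>\<beta> i h. m \<le> length \<beta> \<longrightarrow> defect_adj T (axis i (word T \<beta> (defect T h))) = 0)"
proof
  assume d: "degree_le m"
  show "\<forall>\<beta> i h. m \<le> length \<beta> \<longrightarrow> defect_adj T (axis i (word T \<beta> (defect T h))) = 0"
  proof (intro allI impI)
    fix \<beta> :: "'n list" and i h assume "m \<le> length \<beta>"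
    then have "fourier_coeff T (rev \<beta> @ [i]) = (\<lambda>_. 0)"
      using d by (simp add: degree_le_def char_coeff_eq)
    then show "defect_adj T (axis i (word T \<beta> (defect T h))) = 0"
      by (simp add: fourier_coeff_snoc_eq_0_iff)
  qed
next
  assume r: "\<forall>\<beta> i h. m \<le> length \<beta> \<longrightarrow> defect_adj T (axis i (word T \<beta> (defect T h))) = 0"
  show "degree_le m"
    unfolding degree_le_def char_coeff_eq
  proof (intro allI impI)
    fix \<alpha> :: "'n list" assume "m < length \<alpha>"
    then show "fourier_coeff T \<alpha> = (\<lambda>_. 0)"
      using r by (cases \<alpha> rule: rev_cases) (simp_all add: fourier_coeff_snoc_eq_0_iff)
  qed
qed

end


section \<open>The kernel of the Poisson kernel\<close>

lemma hilbert_dim_eq_0_iff: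
  assumes "0 \<in> M" shows "hilbert_dim M = 0 \<longleftrightarrow> M = {0}"
proof
  assume 0: "hilbert_dim M = 0"
  then obtain C where C: "finite C" "M \<subseteq> cspan C" and dim: "cdim M = 0"
    by (auto simp: hilbert_dim_def zero_enat_def split: if_splits)
  obtain B where B: "B \<subseteq> M" "\<not> complex_vector.dependent B" "M \<subseteq> cspan B" "card B = cdim M"
    by (rule complex_vector.basis_exists)
  have "finite B"
    using complex_vector.independent_span_bound[OF C(1) B(2)] B(1) C(2) by blast
  then have "B = {}" using B(4) dim by simp
  then show "M = {0}" using B(3) assms by auto
next
  assume M: "M = {0}"
  have "cdim {0 :: 'a} = 0"
    using complex_vector.dim_le_card[of "{0}" "{}"] by simp
  moreover have "\<exists>B. finite B \<and> {0 :: 'a} \<subseteq> cspan B" by (intro exI[of _ "{}"]) simp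
  ultimately show "hilbert_dim M = 0" by (auto simp: M hilbert_dim_def zero_enat_def)
qed

context row_contractive
begin

lemma adj_word_append: "adj (word T (\<alpha> @ \<beta>)) x = adj (word T \<beta>) (adj (word T \<alpha>) x)"
  by (simp add: adj_word clinear_T word_append)

lemma adj_word_single: "adj (word T [i]) = adj (T i)"
  by (simp add: o_def)

lemma sum_norm_adj_word_Suc:
  "(\<Sum>\<alpha> | length \<alpha> = Suc k. (norm (adj (word T \<alpha>) h))\<^sup>2)
    = (\<Sum>\<alpha> | length \<alpha> = k. (norm (adj (word T \<alpha>) h))\<^sup>2)
      - (\<Sum>\<alpha> | length \<alpha> = k. (norm (defect T (adj (word T \<alpha>) h)))\<^sup>2)"
  unfolding sum_words_Suc_snoc adj_word_append adj_word_single norm_defect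
  by (simp add: sum_subtractf)

text \<open>Telescoping \<open>\<parallel>\<Delta>\<^sub>T x\<parallel>\<^sup>2 = \<parallel>x\<parallel>\<^sup>2 - \<Sum> \<parallel>T\<^sub>i\<^sup>* x\<parallel>\<^sup>2\<close> over the words of length less than \<open>N\<close>.\<close>

lemma sum_norm_defect_adj_word:
  "(\<Sum>k<N. \<Sum>\<alpha> | length \<alpha> = k. (norm (defect T (adj (word T \<alpha>) h)))\<^sup>2)
    = (norm h)\<^sup>2 - (\<Sum>\<alpha> | length \<alpha> = N. (norm (adj (word T \<alpha>) h))\<^sup>2)"
proof (induction N)
  case 0
  have "adj (\<lambda>x. x) = (\<lambda>x :: 'a. x)" by (rule adj_eqI) simp
  then show ?case by simp
next
  case (Suc N)
  then show ?case by (simp add: sum_norm_adj_word_Suc)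
qed

text \<open>The vectors whose norm is preserved by the adjoints of all the row operators \<open>[T\<^sub>\<alpha>]\<close>, \<open>|\<alpha>| = k\<close>,
  as \<open>coisometric_vector_iff\<close> shows.  This form is linear in \<open>h\<close>.\<close>

definition coisometric_vector :: "'a \<Rightarrow> bool"
  where "coisometric_vector h \<longleftrightarrow> (\<forall>\<alpha>. defect T (adj (word T \<alpha>) h) = 0)"

lemma coisometric_vector_iff:
  "coisometric_vector h \<longleftrightarrow>
    (\<forall>k\<ge>1. (\<Sum>\<alpha> | length \<alpha> = k. (norm (adj (word T \<alpha>) h))\<^sup>2) = (norm h)\<^sup>2)"
proof
  assume "coisometric_vector h"
  then show "\<forall>k\<ge>1. (\<Sum>\<alpha> | length \<alpha> = k. (norm (adj (word T \<alpha>) h))\<^sup>2) = (norm h)\<^sup>2"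
    using sum_norm_defect_adj_word[of h] by (simp add: coisometric_vector_def)
next
  assume r: "\<forall>k\<ge>1. (\<Sum>\<alpha> | length \<alpha> = k. (norm (adj (word T \<alpha>) h))\<^sup>2) = (norm h)\<^sup>2"
  show "coisometric_vector h"
    unfolding coisometric_vector_def
  proof
    fix \<alpha> :: "'n list"
    have "(\<Sum>k<Suc (length \<alpha>). \<Sum>\<alpha> | length \<alpha> = k. (norm (defect T (adj (word T \<alpha>) h)))\<^sup>2) = 0"
      unfolding sum_norm_defect_adj_word using r by simp
    then have "(\<Sum>\<beta> | length \<beta> = length \<alpha>. (norm (defect T (adj (word T \<beta>) h)))\<^sup>2) = 0"
      by (subst (asm) sum_nonneg_eq_0_iff) (auto intro!: sum_nonneg)
    then show "defect T (adj (word T \<alpha>) h) = 0"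
      by (subst (asm) sum_nonneg_eq_0_iff[OF finite_words]) auto
  qed
qed

lemma completely_non_coisometric_iff:
  "completely_non_coisometric T \<longleftrightarrow> (\<forall>h. coisometric_vector h \<longrightarrow> h = 0)"
  unfolding completely_non_coisometric_def coisometric_vector_iff ..

text \<open>The terms are orthogonal, and the telescoping identity bounds the sum of their squared norms by
  \<open>\<parallel>h\<parallel>\<^sup>2\<close>.  Convergence matters: the sum of a divergent family would be \<open>0\<close> by convention.\<close>

lemma poisson_summable:
  "(\<lambda>\<alpha>. fock_basis \<alpha> \<otimes>\<^sub>v defect T (adj (word T \<alpha>) h)) summable_on UNIV"
proof (rule orthogonal_summable)
  have norm_basis: "(norm (fock_basis \<alpha>))\<^sup>2 = 1" for \<alpha> :: "'n list"
  proof -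
    have "complex_of_real ((norm (fock_basis \<alpha>))\<^sup>2) = complex_of_real 1"
      unfolding cinner_self[symmetric] by (simp add: cinner_fock_basis)
    then show ?thesis unfolding of_real_eq_iff .
  qed
  have "(\<Sum>\<alpha>\<in>S. (norm (fock_basis \<alpha> \<otimes>\<^sub>v defect T (adj (word T \<alpha>) h)))\<^sup>2) \<le> (norm h)\<^sup>2" if "finite S" for S
  proof -
    define N where "N = Suc (Max (insert 0 (length ` S)))"
    have "length \<alpha> < N" if "\<alpha> \<in> S" for \<alpha>
      using \<open>finite S\<close> that by (simp add: N_def less_Suc_eq_le)
    then have "S \<subseteq> (\<Union>k\<in>{..<N}. {\<alpha>. length \<alpha> = k})" by auto
    then have "(\<Sum>\<alpha>\<in>S. (norm (defect T (adj (word T \<alpha>) h)))\<^sup>2)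
        \<le> (\<Sum>\<alpha>\<in>(\<Union>k\<in>{..<N}. {\<alpha>. length \<alpha> = k}). (norm (defect T (adj (word T \<alpha>) h)))\<^sup>2)"
      by (intro sum_mono2) (auto intro: finite_words)
    also have "\<dots> = (\<Sum>k<N. \<Sum>\<alpha> | length \<alpha> = k. (norm (defect T (adj (word T \<alpha>) h)))\<^sup>2)"
      by (rule sum.UNION_disjoint) (auto intro: finite_words)
    also have "\<dots> \<le> (norm h)\<^sup>2"
      unfolding sum_norm_defect_adj_word by (simp add: sum_nonneg)
    finally show ?thesis by (simp add: norm_tensor_vec power_mult_distrib norm_basis)
  qed
  then show "(\<lambda>\<alpha>. (norm (fock_basis \<alpha> \<otimes>\<^sub>v defect T (adj (word T \<alpha>) h)))\<^sup>2) summable_on UNIV"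
    by (intro nonneg_bounded_partial_sums_imp_summable_on eventually_finite_subsets_at_top_weakI) auto
qed (simp add: cinner_tensor_vec cinner_fock_basis)

text \<open>The terms of the series are orthogonal, so each of them vanishes if the sum does.\<close>

lemma poisson_kernel_eq_0_iff: "poisson_kernel T h = 0 \<longleftrightarrow> coisometric_vector h"
proof
  assume z: "poisson_kernel T h = 0"
  let ?t = "\<lambda>\<alpha>. fock_basis \<alpha> \<otimes>\<^sub>v defect T (adj (word T \<alpha>) h)"
  have sum: "(?t has_sum 0) UNIV"
    using has_sum_infsum[OF poisson_summable[of h]] z by (simp add: poisson_kernel_def)
  show "coisometric_vector h"
    unfolding coisometric_vector_def
  proof
    fix \<beta>
    have "((\<lambda>\<alpha>. cinner (?t \<alpha>) (?t \<beta>)) has_sum cinner 0 (?t \<beta>)) UNIV"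
      by (rule has_sum_bounded_linear[OF bounded_linear_cinner_left sum])
    moreover have "((\<lambda>\<alpha>. cinner (?t \<alpha>) (?t \<beta>)) has_sum cinner (?t \<beta>) (?t \<beta>)) UNIV"
      by (rule has_sum_cong_neutral[THEN iffD1, of _ "{\<beta>}" "\<lambda>\<alpha>. cinner (?t \<alpha>) (?t \<beta>)"])
        (auto simp: cinner_tensor_vec cinner_fock_basis intro!: has_sum_finiteI)
    ultimately have "cinner (?t \<beta>) (?t \<beta>) = 0" using has_sum_unique by fastforce
    then show "defect T (adj (word T \<beta>) h) = 0" by (simp add: cinner_tensor_vec cinner_fock_basis)
  qed
next
  assume "coisometric_vector h"
  then show "poisson_kernel T h = 0"
    by (simp add: poisson_kernel_def coisometric_vector_def bounded_clinear_0[OF bounded_clinear_tensor_right])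
qed

lemma completely_non_coisometric_Gamma:
  "completely_non_coisometric T \<longleftrightarrow> Gamma_inv T \<in> UNIV \<times> UNIV \<times> {0}"
proof -
  have 0: "coisometric_vector 0"
    by (simp add: coisometric_vector_def bounded_clinear_0 bounded_clinear_adj bounded_clinear_word
        clinear_T clinear_defect)
  have "Gamma_inv T \<in> UNIV \<times> UNIV \<times> {0} \<longleftrightarrow> hilbert_dim {h. coisometric_vector h} = 0"
    by (simp add: Gamma_inv_def poisson_kernel_eq_0_iff)
  also have "\<dots> \<longleftrightarrow> {h. coisometric_vector h} = {0}"
    by (rule hilbert_dim_eq_0_iff) (simp add: 0)
  also have "\<dots> \<longleftrightarrow> completely_non_coisometric T"
    using 0 by (auto simp: completely_non_coisometric_iff)
  finally show ?thesis by (rule sym)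
qed

end


section \<open>From a bound on the degree to a representation\<close>

lemma proj_orthogonal_to:
  assumes M: "closed_csubspace M"
  shows "proj (orthogonal_to M) x = x - proj M x"
  by (rule proj_eqI[OF closed_csubspace_orthogonal_to proj_orthogonal[OF M]])
    (simp add: orthogonal_to_orthogonal_to[OF M] proj_mem[OF M])

lemma cinner_orthogonal_to: "x \<in> M \<Longrightarrow> y \<in> orthogonal_to M \<Longrightarrow> cinner x y = 0"
  by (subst cinner_eq_0_commute) (simp add: orthogonal_to_def)

lemma operatorsD:
  assumes "f \<in> operators M K"
  shows "bounded_clinear f" "f x \<in> K" "x \<in> orthogonal_to M \<Longrightarrow> f x = 0"
  using assms by (auto simp: operators_def)

lemma row_contraction_onI:
  assumes M: "closed_csubspace M" and X: "\<And>i. X i \<in> operators M M"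
    and le: "\<And>x. x \<in> M \<Longrightarrow> (\<Sum>i\<in>UNIV. (norm (adj (X i) x))\<^sup>2) \<le> (norm x)\<^sup>2"
  shows "row_contraction_on M X"
  unfolding row_contraction_on_def
proof (intro conjI allI X positive_operatorI)
  have Xl: "bounded_clinear (X i)" for i by (rule operatorsD[OF X])
  show "bounded_clinear (\<lambda>x. proj M x - (\<Sum>i\<in>UNIV. X i (adj (X i) x)))"
    by (intro bounded_clinear_subtract bounded_clinear_proj M bounded_clinear_setsum
        bounded_clinear_compose[OF Xl bounded_clinear_adj[OF Xl]])
  show "cinner (proj M x - (\<Sum>i\<in>UNIV. X i (adj (X i) x))) y
      = cinner x (proj M y - (\<Sum>i\<in>UNIV. X i (adj (X i) y)))" for x y
    by (simp add: cinner_simps cinner_proj[OF M] cinner_adj[OF Xl, symmetric] cinner_adj_left[OF Xl, symmetric])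
  have aX: "adj (X i) (proj M x) = adj (X i) x" for i x
  proof (rule cinner_ext)
    fix z
    have "X i z \<in> M" by (rule operatorsD[OF X])
    then show "cinner (adj (X i) (proj M x)) z = cinner (adj (X i) x) z"
      by (simp add: cinner_adj_left[OF Xl] cinner_proj_member[OF M])
  qed
  show "0 \<le> Re (cinner (proj M x - (\<Sum>i\<in>UNIV. X i (adj (X i) x))) x)" for x
  proof -
    have "cinner (proj M x) x = complex_of_real ((norm (proj M x))\<^sup>2)"
      by (subst cinner_proj_left[OF M]) (rule cinner_self)
    moreover have "cinner (X i (adj (X i) x)) x = complex_of_real ((norm (adj (X i) x))\<^sup>2)" for i
      by (simp only: cinner_adj[OF Xl, symmetric] cinner_self)
    ultimately have "cinner (proj M x - (\<Sum>i\<in>UNIV. X i (adj (X i) x))) x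
        = complex_of_real ((norm (proj M x))\<^sup>2 - (\<Sum>i\<in>UNIV. (norm (adj (X i) x))\<^sup>2))"
      by (simp only: cinner_simps of_real_diff of_real_sum)
    then show ?thesis using le[OF proj_mem[OF M], of x] by (simp add: aX del: of_real_diff of_real_sum)
  qed
qed

text \<open>Such a subspace gives a triangular representation of \<open>T\<close>, with an isometric first diagonal
  entry \<open>V\<close>; whether \<open>V\<close> is pure and \<open>N\<close> nilpotent depends on \<open>M\<close> and \<open>T\<close>.\<close>

locale isometric_invariant = row_contractive T
  for T :: "'n :: finite \<Rightarrow> 'a :: hilbert_space \<Rightarrow> 'a" +
  fixes M :: "'a set"
  assumes closed_M: "closed_csubspace M"
    and invariant: "x \<in> M \<Longrightarrow> T i x \<in> M"
    and isometric: "x \<in> M \<Longrightarrow> y \<in> M \<Longrightarrow> cinner (T i x) (T j y) = (if i = j then cinner x y else 0)"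
begin

abbreviation "P \<equiv> proj M"
abbreviation "Q \<equiv> proj (orthogonal_to M)"

definition V :: "'n \<Rightarrow> 'a \<Rightarrow> 'a" where "V i x = T i (P x)"
definition N :: "'n \<Rightarrow> 'a \<Rightarrow> 'a" where "N i x = Q (T i (Q x))"

lemmas P_mem = proj_mem[OF closed_M]
  and P_id = proj_id[OF closed_M]
  and clinear_P = bounded_clinear_proj[OF closed_M]
  and closed_Mo = closed_csubspace_orthogonal_to[of M]

lemmas Q_mem = proj_mem[OF closed_Mo]
  and Q_id = proj_id[OF closed_Mo]
  and clinear_Q = bounded_clinear_proj[OF closed_Mo]
  and Q_eq = proj_orthogonal_to[OF closed_M]

lemma Q_eq_0: "x \<in> M \<Longrightarrow> Q x = 0"
  by (simp add: Q_eq P_id)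

lemma P_eq_0: "x \<in> orthogonal_to M \<Longrightarrow> P x = 0"
  by (simp add: proj_eq_0_iff[OF closed_M])

lemma clinear_V: "bounded_clinear (V i)"
  unfolding V_def[abs_def] by (rule bounded_clinear_compose[OF clinear_T clinear_P])

lemma clinear_N: "bounded_clinear (N i)"
  unfolding N_def[abs_def]
  by (rule bounded_clinear_compose[OF clinear_Q bounded_clinear_compose[OF clinear_T clinear_Q]])

lemma V_operators: "V i \<in> operators M M"
  using clinear_V by (auto simp: operators_def V_def P_eq_0 bounded_clinear_0[OF clinear_T] invariant P_mem)

lemma N_operators: "N i \<in> operators (orthogonal_to M) (orthogonal_to M)"
  using clinear_N
  by (auto simp: operators_def N_def Q_mem Q_eq_0 orthogonal_to_orthogonal_to[OF closed_M]
      bounded_clinear_0[OF clinear_T] bounded_clinear_0[OF clinear_Q])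

lemma orthogonal_decomposition: "orthogonal_decomposition M (orthogonal_to M)"
  unfolding orthogonal_decomposition_def
proof (intro conjI closed_M closed_Mo ballI allI)
  show "cinner x y = 0" if "x \<in> M" "y \<in> orthogonal_to M" for x y
    using that by (rule cinner_orthogonal_to)
  show "\<exists>x\<in>M. \<exists>y\<in>orthogonal_to M. h = x + y" for h
    using P_mem[of h] Q_mem[of h] by (intro bexI[of _ "P h"] bexI[of _ "Q h"]) (simp_all add: Q_eq)
qed

lemma upper_triangular: "upper_triangular T M (orthogonal_to M) V N"
  unfolding upper_triangular_def
proof (intro allI bexI ballI)
  fix i
  let ?R = "\<lambda>y. P (T i (Q y))"
  have "bounded_clinear ?R"
    by (rule bounded_clinear_compose[OF clinear_P bounded_clinear_compose[OF clinear_T clinear_Q]])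
  then show "?R \<in> operators (orthogonal_to M) M"
    by (auto simp: operators_def P_mem Q_eq_0 orthogonal_to_orthogonal_to[OF closed_M] bounded_clinear_0[OF clinear_T] bounded_clinear_0[OF clinear_P])
  fix x y assume "x \<in> M" "y \<in> orthogonal_to M"
  then show "T i (x + y) = (V i x + ?R y) + N i y"
    by (simp add: V_def N_def P_id Q_id bounded_clinear_add[OF clinear_T] Q_eq[of "T i y"])
qed

lemma row_contraction_V: "row_contraction_on M V"
proof (rule row_contraction_onI[OF closed_M V_operators])
  fix x assume x: "x \<in> M"
  have "adj (V i) x = P (adj (T i) x)" for i
    using adj_comp[OF clinear_T clinear_P, of i] adj_proj[OF closed_M]
    by (simp add: V_def[abs_def] o_def fun_eq_iff)
  then have "(\<Sum>i\<in>UNIV. (norm (adj (V i) x))\<^sup>2) \<le> (\<Sum>i\<in>UNIV. (norm (adj (T i) x))\<^sup>2)"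
    by (intro sum_mono power_mono) (simp_all add: norm_proj_le[OF closed_M])
  also have "\<dots> \<le> (norm x)\<^sup>2" by (rule sum_norm_adj_le)
  finally show "(\<Sum>i\<in>UNIV. (norm (adj (V i) x))\<^sup>2) \<le> (norm x)\<^sup>2" .
qed

lemma row_contraction_N: "row_contraction_on (orthogonal_to M) N"
proof (rule row_contraction_onI[OF closed_Mo N_operators])
  fix x assume x: "x \<in> orthogonal_to M"
  have "adj (N i) x = Q (adj (T i) x)" for i
  proof (rule cinner_ext)
    fix z
    have "cinner (adj (N i) x) z = cinner x (Q (T i (Q z)))"
      by (simp add: cinner_adj_left clinear_N) (simp add: N_def)
    also have "\<dots> = cinner (Q x) (T i (Q z))" by (rule cinner_proj[OF closed_Mo, symmetric])
    also have "\<dots> = cinner (adj (T i) x) (Q z)" by (simp add: Q_id[OF x] cinner_adj_left[OF clinear_T])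
    also have "\<dots> = cinner (Q (adj (T i) x)) z" by (rule cinner_proj[OF closed_Mo, symmetric])
    finally show "cinner (adj (N i) x) z = cinner (Q (adj (T i) x)) z" .
  qed
  then have "(\<Sum>i\<in>UNIV. (norm (adj (N i) x))\<^sup>2) \<le> (\<Sum>i\<in>UNIV. (norm (adj (T i) x))\<^sup>2)"
    by (intro sum_mono power_mono) (simp_all add: norm_proj_le[OF closed_Mo])
  also have "\<dots> \<le> (norm x)\<^sup>2" by (rule sum_norm_adj_le)
  finally show "(\<Sum>i\<in>UNIV. (norm (adj (N i) x))\<^sup>2) \<le> (norm x)\<^sup>2" .
qed

lemma row_isometry_V: "row_isometry_on M V"
  unfolding row_isometry_on_def
proof (intro allI ballI)
  fix i j x assume x: "x \<in> M"
  show "adj (V i) (V j x) = (if i = j then x else 0)"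
  proof (rule cinner_ext)
    fix z
    have "cinner (adj (V i) (V j x)) z = cinner (T j x) (T i (P z))"
      by (simp add: cinner_adj_left clinear_V V_def P_id[OF x])
    also have "\<dots> = (if i = j then cinner x (P z) else 0)"
      using isometric[OF x P_mem] by auto
    also have "cinner x (P z) = cinner x z"
      by (simp add: cinner_proj[OF closed_M, symmetric] P_id[OF x])
    finally show "cinner (adj (V i) (V j x)) z = cinner (if i = j then x else 0) z" by simp
  qed
qed

lemma word_mem: "x \<in> M \<Longrightarrow> word T \<alpha> x \<in> M"
  by (induction \<alpha>) (simp_all add: invariant)

lemma word_isometric:
  "length \<alpha> = length \<beta> \<Longrightarrow> x \<in> M \<Longrightarrow> y \<in> M \<Longrightarrow>
    cinner (word T \<alpha> x) (word T \<beta> y) = (if \<alpha> = \<beta> then cinner x y else 0)"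
  by (induction \<alpha> \<beta> rule: list_induct2) (auto simp: isometric word_mem)

lemma word_V: "word_op M V \<alpha> x = word T \<alpha> (P x)"
  by (induction \<alpha>) (simp_all add: V_def P_id[OF word_mem[OF P_mem]])

text \<open>\<open>N\<close> is the compression of \<open>T\<close> to a coinvariant subspace, hence so are its products.\<close>

lemma word_N: "word_op (orthogonal_to M) N \<alpha> x = Q (word T \<alpha> (Q x))"
proof (induction \<alpha>)
  case Nil
  show ?case by (simp add: Q_id[OF Q_mem])
next
  case (Cons i \<alpha>)
  have q: "Q (T i (Q z)) = Q (T i z)" for z
    using Q_eq_0[OF invariant[OF P_mem, of i z]]
    by (simp add: Q_eq[of z] bounded_clinear_diff[OF clinear_T] bounded_clinear_diff[OF clinear_Q])
  have "word_op (orthogonal_to M) N (i # \<alpha>) x = N i (Q (word T \<alpha> (Q x)))" by (simp add: Cons)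
  then show ?case by (simp only:) (simp add: N_def Q_id[OF Q_mem] q)
qed

subsection \<open>Purity\<close>

text \<open>\<open>E k\<close> is the orthogonal projection onto the closed span of the \<open>T\<^sub>\<alpha> M\<close> with \<open>|\<alpha>| = k\<close>; its
  summands are the projections onto these mutually orthogonal subspaces.\<close>

definition W :: "'n list \<Rightarrow> 'a \<Rightarrow> 'a" where "W \<alpha> x = word T \<alpha> (P x)"

definition E :: "nat \<Rightarrow> 'a \<Rightarrow> 'a" where "E k x = (\<Sum>\<alpha> | length \<alpha> = k. W \<alpha> (adj (W \<alpha>) x))"

lemma clinear_W: "bounded_clinear (W \<alpha>)"
  unfolding W_def[abs_def]
  by (rule bounded_clinear_compose[OF bounded_clinear_word[OF clinear_T] clinear_P])

lemma clinear_E: "bounded_clinear (E k)"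
  unfolding E_def[abs_def]
  by (intro bounded_clinear_setsum bounded_clinear_compose[OF clinear_W bounded_clinear_adj[OF clinear_W]])

lemma cinner_E: "cinner (E k x) y = (\<Sum>\<alpha> | length \<alpha> = k. cinner (adj (W \<alpha>) x) (adj (W \<alpha>) y))"
  by (simp add: E_def cinner_sum_left cinner_adj[OF clinear_W])

lemma E_selfadjoint: "cinner (E k x) y = cinner x (E k y)"
  by (simp add: E_def cinner_sum_left cinner_sum_right cinner_adj[OF clinear_W, symmetric]
      cinner_adj_left[OF clinear_W, symmetric])

lemma W_append: "W (\<alpha> @ \<beta>) x = W \<alpha> (W \<beta> x)"
  by (simp add: W_def word_append P_id[OF word_mem[OF P_mem]])

lemma adj_W_W: "length \<alpha> = length \<beta> \<Longrightarrow> adj (W \<alpha>) (W \<beta> x) = (if \<alpha> = \<beta> then P x else 0)"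
proof (rule cinner_ext)
  fix z assume "length \<alpha> = length \<beta>"
  then have "cinner (W \<beta> x) (W \<alpha> z) = (if \<beta> = \<alpha> then cinner (P x) (P z) else 0)"
    unfolding W_def by (intro word_isometric P_mem) simp
  then show "cinner (adj (W \<alpha>) (W \<beta> x)) z = cinner (if \<alpha> = \<beta> then P x else 0) z"
    by (auto simp: cinner_adj_left[OF clinear_W] cinner_proj_left[OF closed_M, symmetric])
qed

lemma E_W: "length \<beta> = k \<Longrightarrow> E k (W \<beta> x) = W \<beta> x"
proof -
  assume b: "length \<beta> = k"
  have "E k (W \<beta> x) = (\<Sum>\<alpha> | length \<alpha> = k. if \<alpha> = \<beta> then W \<beta> (P x) else 0)"
    unfolding E_def
    by (rule sum.cong) (auto simp: adj_W_W b bounded_clinear_0[OF clinear_W])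
  also have "\<dots> = W \<beta> (P x)" using b by (simp add: finite_words)
  also have "\<dots> = W \<beta> x" by (simp add: W_def P_id[OF P_mem])
  finally show ?thesis .
qed

lemma E_E:
  assumes "k \<le> l" shows "E k (E l x) = E l x"
proof -
  have "E k (W \<beta> y) = W \<beta> y" if "length \<beta> = l" for \<beta> y
  proof -
    have "E k (W (take k \<beta>) (W (drop k \<beta>) y)) = W (take k \<beta>) (W (drop k \<beta>) y)"
      using that assms by (intro E_W) simp
    then show ?thesis by (simp only: W_append[symmetric] append_take_drop_id)
  qed
  moreover have "E k (E l x) = (\<Sum>\<alpha> | length \<alpha> = l. E k (W \<alpha> (adj (W \<alpha>) x)))"
    unfolding E_def[of l] by (rule bounded_clinear_sum[OF clinear_E])
  ultimately show ?thesis by (simp add: E_def[of l])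
qed

lemma norm_E: "(norm (E k x))\<^sup>2 = (\<Sum>\<alpha> | length \<alpha> = k. (norm (adj (W \<alpha>) x))\<^sup>2)"
proof -
  have "complex_of_real ((norm (E k x))\<^sup>2) = cinner (E k x) x"
    unfolding cinner_self[symmetric] by (subst E_selfadjoint[symmetric]) (simp add: E_E)
  also have "\<dots> = complex_of_real (\<Sum>\<alpha> | length \<alpha> = k. (norm (adj (W \<alpha>) x))\<^sup>2)"
    by (simp only: cinner_E cinner_self of_real_sum)
  finally show ?thesis unfolding of_real_eq_iff .
qed

lemma norm_E_diff:
  assumes "k \<le> l" shows "(norm (E k x - E l x))\<^sup>2 = (norm (E k x))\<^sup>2 - (norm (E l x))\<^sup>2"
proof -
  have "cinner (E k x) (E l x) = cinner (E l x) (E l x)"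
    using E_E[OF assms] E_E[of l l] E_selfadjoint by (metis order_refl)
  then have "Re (cinner (E k x) (E l x)) = (norm (E l x))\<^sup>2" by (simp add: cinner_self)
  then show ?thesis by (simp add: norm_square_diff)
qed

text \<open>The projections decrease, so \<open>\<parallel>E k x - E l x\<parallel>\<^sup>2\<close> is the difference of the terms of a convergent
  sequence of reals.\<close>

lemma E_convergent: "\<exists>z. (\<lambda>k. E k x) \<longlonglongrightarrow> z \<and> (\<forall>k. E k z = z)"
proof -
  have dec: "decseq (\<lambda>k. (norm (E k x))\<^sup>2)"
    unfolding decseq_def
  proof (intro allI impI)
    fix k l :: nat assume "k \<le> l"
    then show "(norm (E l x))\<^sup>2 \<le> (norm (E k x))\<^sup>2"
      using norm_E_diff[of k l x] zero_le_power2[of "norm (E k x - E l x)"] by linarith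
  qed
  obtain L where "(\<lambda>k. (norm (E k x))\<^sup>2) \<longlonglongrightarrow> L"
    by (rule decseq_convergent[OF dec, of 0]) simp_all
  then have C: "Cauchy (\<lambda>k. (norm (E k x))\<^sup>2)" by (rule LIMSEQ_imp_Cauchy)
  have "Cauchy (\<lambda>k. E k x)"
  proof (rule metric_CauchyI)
    fix e :: real assume e: "e > 0"
    then obtain K where K: "\<And>k l. k \<ge> K \<Longrightarrow> l \<ge> K \<Longrightarrow> dist ((norm (E k x))\<^sup>2) ((norm (E l x))\<^sup>2) < e\<^sup>2"
      using metric_CauchyD[OF C, of "e\<^sup>2"] by auto
    have le: "dist (E k x) (E l x) < e" if "K \<le> k" "k \<le> l" for k l
    proof (rule power_less_imp_less_base)
      show "(dist (E k x) (E l x))\<^sup>2 < e\<^sup>2"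
        using K[of k l] that norm_E_diff[of k l x] by (simp add: dist_norm)
    qed (use e in simp)
    show "\<exists>K. \<forall>k\<ge>K. \<forall>l\<ge>K. dist (E k x) (E l x) < e"
    proof (intro exI[of _ K] allI impI)
      fix k l assume "k \<ge> K" "l \<ge> K"
      then show "dist (E k x) (E l x) < e"
        using le[of k l] le[of l k] by (cases "k \<le> l") (simp_all add: dist_commute)
    qed
  qed
  then obtain z where z: "(\<lambda>k. E k x) \<longlonglongrightarrow> z" using Cauchy_convergent convergent_def by blast
  have "E k z = z" for k
  proof (rule LIMSEQ_unique[OF bounded_linear.tendsto[OF bounded_clinear_bounded[OF clinear_E] z]])
    have "\<forall>\<^sub>F l in sequentially. E l x = E k (E l x)"
      using E_E[of k] by (auto simp: eventually_sequentially intro!: exI[of _ k])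
    then show "(\<lambda>l. E k (E l x)) \<longlonglongrightarrow> z" by (rule Lim_transform_eventually[OF z])
  qed
  then show ?thesis using z by blast
qed

text \<open>A vector in the range of every \<open>E k\<close> loses no norm under the adjoints of the words in \<open>V\<close>, a
  fortiori none under those of the words in \<open>T\<close>; so the limit of \<open>E k h\<close> is \<open>0\<close>.\<close>

lemma pure_V:
  assumes cnc: "completely_non_coisometric T" shows "pure_on M V"
  unfolding pure_on_def
proof
  fix h assume "h \<in> M"
  obtain z where z: "(\<lambda>k. E k h) \<longlonglongrightarrow> z" and fixed: "\<And>k. E k z = z"
    using E_convergent by blast
  have "(\<Sum>\<alpha> | length \<alpha> = k. (norm (adj (word T \<alpha>) z))\<^sup>2) = (norm z)\<^sup>2" for k
  proof (rule order_antisym)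
    have "0 \<le> (\<Sum>k<k. \<Sum>\<alpha> | length \<alpha> = k. (norm (defect T (adj (word T \<alpha>) z)))\<^sup>2)"
      by (intro sum_nonneg) simp
    then show "(\<Sum>\<alpha> | length \<alpha> = k. (norm (adj (word T \<alpha>) z))\<^sup>2) \<le> (norm z)\<^sup>2"
      unfolding sum_norm_defect_adj_word by simp
    have "adj (W \<alpha>) z = P (adj (word T \<alpha>) z)" for \<alpha>
    proof -
      have "W \<alpha> = word T \<alpha> \<circ> P" by (simp add: fun_eq_iff W_def)
      then show ?thesis
        by (simp only: adj_comp[OF bounded_clinear_word[OF clinear_T] clinear_P] adj_proj[OF closed_M] o_apply)
    qed
    then have "(norm (E k z))\<^sup>2 \<le> (\<Sum>\<alpha> | length \<alpha> = k. (norm (adj (word T \<alpha>) z))\<^sup>2)"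
      unfolding norm_E by (intro sum_mono power_mono) (simp_all add: norm_proj_le[OF closed_M])
    then show "(norm z)\<^sup>2 \<le> (\<Sum>\<alpha> | length \<alpha> = k. (norm (adj (word T \<alpha>) z))\<^sup>2)" by (simp add: fixed)
  qed
  then have "z = 0" using cnc unfolding completely_non_coisometric_def by blast
  then have "(\<lambda>k. (norm (E k h))\<^sup>2) \<longlonglongrightarrow> 0"
    using tendsto_power[OF tendsto_norm[OF z], of 2] by simp
  moreover have "word_op M V \<alpha> = W \<alpha>" for \<alpha> by (simp add: fun_eq_iff word_V W_def)
  ultimately show "(\<lambda>k. \<Sum>\<alpha> | length \<alpha> = k. (norm (adj (word_op M V \<alpha>) h))\<^sup>2) \<longlonglongrightarrow> 0"
    by (simp only: norm_E)
qed

text \<open>The words of length \<open>m\<close> in \<open>N\<close> vanish, but shorter ones may vanish as well, so the order is only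
  bounded by \<open>m\<close>.\<close>

lemma nilpotent_N:
  assumes zero: "\<And>\<alpha> y. length \<alpha> = m \<Longrightarrow> y \<in> orthogonal_to M \<Longrightarrow> adj (word T \<alpha>) y = 0"
  shows "\<exists>k\<le>m. nilpotent_of_order_on (orthogonal_to M) N k"
proof -
  let ?z = "\<lambda>k. \<forall>\<alpha>. length \<alpha> = k \<longrightarrow> word_op (orthogonal_to M) N \<alpha> = (\<lambda>_. 0)"
  have "?z m"
  proof (intro allI impI ext)
    fix \<alpha> :: "'n list" and x assume "length \<alpha> = m"
    then have "cinner (Q (word T \<alpha> (Q x))) y = cinner 0 y" for y
      using zero[of \<alpha> "Q y"]
      by (simp add: cinner_proj[OF closed_Mo] cinner_adj[OF bounded_clinear_word[OF clinear_T], symmetric]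
          Q_mem del: cinner_zero_left) simp
    then show "word_op (orthogonal_to M) N \<alpha> x = 0" unfolding word_N by (rule cinner_ext)
  qed
  define k where "k = (LEAST k. ?z k)"
  have "?z k" unfolding k_def by (rule LeastI[of ?z, OF \<open>?z m\<close>])
  moreover have "k \<le> m" unfolding k_def by (rule Least_le[of ?z, OF \<open>?z m\<close>])
  moreover have "\<not> ?z l" if "l < k" for l using that unfolding k_def by (rule not_less_Least)
  ultimately show ?thesis unfolding nilpotent_of_order_on_def by blast
qed

end

context row_contractive
begin

text \<open>For \<open>M\<close> the closed span of the \<open>T\<^sub>\<beta> \<Delta>\<^sub>T h\<close> with \<open>|\<beta>| \<ge> m\<close>, the bound on the degree says that
  \<open>\<Delta>\<^sub>T\<^sub>*\<close> vanishes on \<open>M\<^sup>n\<close>, that is, \<open>T\<close> is a row isometry on \<open>M\<close>.  If \<open>y\<close> is orthogonal to \<open>M\<close> and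
  \<open>|\<alpha>| = m\<close>, then \<open>\<Delta>\<^sub>T T\<^sub>\<gamma>\<^sup>* T\<^sub>\<alpha>\<^sup>* y = 0\<close> for every \<open>\<gamma>\<close>, so \<open>T\<^sub>\<alpha>\<^sup>* y\<close> is a coisometric vector and
  vanishes.\<close>

lemma representation_of_degree_le:
  assumes cnc: "completely_non_coisometric T" and deg: "degree_le m"
  shows "\<exists>k\<le>m. has_representation T k"
proof -
  define S where "S = {word T \<beta> (defect T h) | \<beta> h. m \<le> length \<beta>}"
  define M where "M = closure (cspan S)"
  have closed: "closed_csubspace M" unfolding M_def by (rule closed_csubspace_closure_cspan)
  have inv: "T i x \<in> M" if "x \<in> M" for i x
  proof -
    have "T i y \<in> S" if y: "y \<in> S" for y
    proof -
      obtain \<beta> :: "'n list" and h where "m \<le> length \<beta>" "y = word T \<beta> (defect T h)" using y by (auto simp: S_def)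
      then show ?thesis unfolding S_def by (intro CollectI exI[of _ "i # \<beta>"] exI[of _ h]) simp
    qed
    then have "S \<subseteq> {x. T i x \<in> M}"
      using subsetD[OF closure_cspan_superset[of S]] unfolding M_def by blast
    then have "closure (cspan S) \<subseteq> {x. T i x \<in> M}"
      by (rule closure_cspan_minimal[OF closed_csubspace_vimage[OF clinear_T closed]])
    then have "M \<subseteq> {x. T i x \<in> M}" by (subst (1) M_def)
    then show ?thesis using that by blast
  qed
  have ker: "defect_adj T (axis i x) = 0" if "x \<in> M" for i x
  proof -
    have "S \<subseteq> {x. defect_adj T (axis i x) = 0}" using deg by (auto simp: S_def degree_le_iff)
    then have "M \<subseteq> {x. defect_adj T (axis i x) = 0}"
      unfolding M_def
      by (intro closure_cspan_minimal closed_csubspace_kernel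
          bounded_clinear_compose[OF clinear_defect_adj bounded_clinear_axis])
    then show ?thesis using that by blast
  qed
  have iso: "cinner (T i x) (T j y) = (if i = j then cinner x y else 0)" if "x \<in> M" "y \<in> M" for i j x y
  proof -
    have "cinner (T i x) (T j y) = cinner (axis i x) (axis j y)"
      using cinner_defect_adj[of "axis i x" "axis j y"] ker[OF that(1), of i] by (simp add: row_axis)
    also have "\<dots> = (if i = j then cinner x y else 0)" by (simp add: cinner_axis_left) (simp add: axis_def)
    finally show ?thesis .
  qed
  interpret isometric_invariant T M by unfold_locales (use closed inv iso in auto)
  have "adj (word T \<alpha>) y = 0" if "length \<alpha> = m" "y \<in> orthogonal_to M" for \<alpha> y
  proof -
    have "defect T (adj (word T \<gamma>) (adj (word T \<alpha>) y)) = 0" for \<gamma>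
    proof (rule cinner_ext)
      fix h
      have "word T (\<alpha> @ \<gamma>) (defect T h) \<in> S"
        using that(1) unfolding S_def by (intro CollectI exI[of _ "\<alpha> @ \<gamma>"] exI[of _ h]) simp
      then have "word T (\<alpha> @ \<gamma>) (defect T h) \<in> M"
        using closure_cspan_superset[of S] by (auto simp: M_def)
      then have "cinner y (word T (\<alpha> @ \<gamma>) (defect T h)) = 0"
        using that(2) by (simp add: orthogonal_to_def)
      then show "cinner (defect T (adj (word T \<gamma>) (adj (word T \<alpha>) y))) h = cinner 0 h"
        by (simp add: selfadjoint_defect adj_word_append[symmetric]
            cinner_adj_left[OF bounded_clinear_word[OF clinear_T]])
    qed
    then have "coisometric_vector (adj (word T \<alpha>) y)" by (simp add: coisometric_vector_def)
    then show ?thesis using cnc by (simp add: completely_non_coisometric_iff)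
  qed
  then obtain k where k: "k \<le> m" "nilpotent_of_order_on (orthogonal_to M) N k"
    using nilpotent_N by blast
  have "has_representation T k"
    unfolding has_representation_def
    using orthogonal_decomposition upper_triangular row_contraction_V row_isometry_V pure_V[OF cnc]
      row_contraction_N k(2) by blast
  then show ?thesis using k(1) by blast
qed


section \<open>From a representation to a bound on the degree\<close>

text \<open>Nilpotency of \<open>N\<close> forces \<open>T\<^sub>\<alpha>\<close>, \<open>|\<alpha>| \<ge> m\<close>, to map into the first summand, on which \<open>T\<close> is
  isometric.\<close>

lemma degree_le_of_representation:
  assumes "has_representation T m" shows "degree_le m"
proof -
  obtain Hv Hnil V N where dec: "orthogonal_decomposition Hv Hnil"
    and tri: "upper_triangular T Hv Hnil V N"
    and V: "row_contraction_on Hv V" "row_isometry_on Hv V"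
    and N: "row_contraction_on Hnil N" "nilpotent_of_order_on Hnil N m"
    using assms unfolding has_representation_def by blast
  have cv: "closed_csubspace Hv" and cn: "closed_csubspace Hnil"
    and orth: "\<And>x y. x \<in> Hv \<Longrightarrow> y \<in> Hnil \<Longrightarrow> cinner x y = 0"
    and split: "\<And>h. \<exists>x\<in>Hv. \<exists>y\<in>Hnil. h = x + y"
    using dec by (auto simp: orthogonal_decomposition_def)
  have Vop: "V i \<in> operators Hv Hv" and Nop: "N i \<in> operators Hnil Hnil" for i
    using V(1) N(1) by (auto simp: row_contraction_on_def)
  have proj_nil: "proj Hnil (x + y) = y" if "x \<in> Hv" "y \<in> Hnil" for x y
    by (rule proj_eqI[OF cn that(2)]) (use orth[OF that(1)] in \<open>simp add: orthogonal_to_def\<close>)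
  have proj_T: "proj Hnil (T i z) = N i (proj Hnil z)" for i z
  proof -
    obtain x y where xy: "x \<in> Hv" "y \<in> Hnil" "z = x + y" using split by blast
    obtain R where R: "R \<in> operators Hnil Hv" "T i (x + y) = (V i x + R y) + N i y"
      using tri xy(1,2) unfolding upper_triangular_def by blast
    have "V i x + R y \<in> Hv"
      using Vop[of i] R(1) by (intro closed_csubspaceD[OF cv]) (auto simp: operators_def)
    moreover have "N i y \<in> Hnil" using Nop[of i] by (auto simp: operators_def)
    ultimately show ?thesis using xy by (simp add: R(2) proj_nil)
  qed
  have proj_word: "proj Hnil (word T \<alpha> z) = word_op Hnil N \<alpha> z" for \<alpha> z
    by (induction \<alpha>) (simp_all add: proj_T)
  have mem: "word T \<alpha> z \<in> Hv" if "m \<le> length \<alpha>" for \<alpha> z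
  proof -
    have "word_op Hnil N (take m \<alpha>) = (\<lambda>_. 0)"
      using N(2) that by (simp add: nilpotent_of_order_on_def)
    then have "proj Hnil (word T (take m \<alpha>) (word T (drop m \<alpha>) z)) = 0" by (simp add: proj_word)
    then have 0: "proj Hnil (word T \<alpha> z) = 0" by (simp only: word_append[symmetric] append_take_drop_id)
    obtain x y where xy: "x \<in> Hv" "y \<in> Hnil" "word T \<alpha> z = x + y" using split by blast
    then show ?thesis using 0 proj_nil[OF xy(1,2)] by simp
  qed
  have T_V: "T i x = V i x" if x: "x \<in> Hv" for i x
  proof -
    have 0: "0 \<in> Hnil" by (rule closed_csubspaceD[OF cn])
    obtain R where R: "R \<in> operators Hnil Hv" "T i (x + 0) = (V i x + R 0) + N i 0"
      using tri x 0 unfolding upper_triangular_def by blast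
    have "R 0 = 0" "N i 0 = 0"
      using R(1) Nop[of i] by (auto simp: operators_def bounded_clinear_0)
    then show ?thesis using R(2) by simp
  qed
  show "degree_le m"
    unfolding degree_le_iff
  proof (intro allI impI)
    fix \<beta> :: "'n list" and i :: 'n and h assume b: "m \<le> length \<beta>"
    define w where "w = word T \<beta> (defect T h)"
    have w: "w \<in> Hv" unfolding w_def by (rule mem[OF b])
    have Vl: "bounded_clinear (V i)" using Vop by (auto simp: operators_def)
    have row: "row T (axis i w) = V i w" by (simp add: row_axis T_V[OF w])
    have "adj (V i) (V i w) = w" using V(2) w by (simp add: row_isometry_on_def)
    then have "cinner (V i w) (V i w) = cinner w w" by (metis cinner_adj_left[OF Vl])
    then have "(norm (V i w))\<^sup>2 = (norm w)\<^sup>2" unfolding cinner_self of_real_eq_iff .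
    then have "(norm (defect_adj T (axis i w)))\<^sup>2 = 0" by (simp add: norm_defect_adj row norm_axis)
    then show "defect_adj T (axis i (word T \<beta> (defect T h))) = 0" by (simp add: w_def)
  qed
qed

end

theorem corollary2p6:
  fixes T :: "'n :: finite \<Rightarrow> 'a :: hilbert_space \<Rightarrow> 'a"
  assumes "row_contraction T"
  shows "(completely_non_coisometric T \<longleftrightarrow> Gamma_inv T \<in> UNIV \<times> UNIV \<times> {0}) \<and>
    (completely_non_coisometric T \<longrightarrow>
      (char_polynomial T \<longleftrightarrow> (\<exists>m. has_representation T m)) \<and>
      (\<forall>m::nat. char_polynomial T \<and> char_degree T = enat m \<longleftrightarrow>
        has_representation T m \<and> (\<forall>k. has_representation T k \<longrightarrow> m \<le> k)))"
proof -
  interpret row_contractive T using assms by unfold_locales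
  have rep: "\<exists>k\<le>m. has_representation T k" if "completely_non_coisometric T" "degree_le m" for m
    using that by (rule representation_of_degree_le)
  have deg: "degree_le m" if "has_representation T m" for m
    using that by (rule degree_le_of_representation)
  show ?thesis
  proof (intro conjI impI allI)
    show "completely_non_coisometric T \<longleftrightarrow> Gamma_inv T \<in> UNIV \<times> UNIV \<times> {0}"
      by (rule completely_non_coisometric_Gamma)
    assume cnc: "completely_non_coisometric T"
    show "char_polynomial T \<longleftrightarrow> (\<exists>m. has_representation T m)"
      unfolding char_polynomial_iff using rep[OF cnc] deg by blast
    show "char_polynomial T \<and> char_degree T = enat m \<longleftrightarrow>
        has_representation T m \<and> (\<forall>k. has_representation T k \<longrightarrow> m \<le> k)" for m
      unfolding char_degree_eq_iff
      using rep[OF cnc] deg by (metis order_trans order_antisym)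
  qed
qed

end
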